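(* Let $A$ be an indecomposable positive semi-definite symmetrizable intersection matrix. Then $A$ is braid-equivalent to a standard $d$-fold affinization matrix of some type $X_l^{(b,s,t)}$ ($b+s+t=d$). Moreover, any two standard $d$-fold affinization matrices of the same type are braid-equivalent. Here the type $X_l^{(b,s,t)}$ of a standard $d$-fold affinization matrix must be one of the following forms: (1) $X_l^{(d,0,0)}$ for $X_l=A_l\ (l\ge2),\ D_l,\ E_6,\ E_7,\ E_8$; (2) $X_l^{(b,s,0)}$ for $X_l=C_l\ (l\ge3),\ F_4,\ G_2$; (3) $A_1^{(b,0,t)}$, or $B_l^{(b,s,t)}$ ($l\ge 2$), where for $B_l^{(b,s,t)}$ any added double root must correspond to the double of a short root.
   Context: A generalized intersection matrix is an integral matrix $A=(A_{ij})_{i,j\in I}$, $I$ finite, with $A_{ii}=2$, $A_{ij}<0\Leftrightarrow A_{ji}<0$ and $A_{ij}>0\Leftrightarrow A_{ji}>0$. It is a symmetrizable intersection matrix (SIM) if there is $D=\mathrm{diag}(d_i)_{i\in I}$ with positive integers $d_i$, $\gcd(d_i)=1$, such that $B=DA$ is symmetric; $A$ is positive semi-definite if $DA$ is. $A$ is indecomposable if $I$ is not a disjoint union of nonempty $I_1,I_2$ with $A_{ij}=0=A_{ji}$ for all $i\in I_1,j\in I_2$. The SIM-root basis of $A$ is a basis $\Delta=\{\alpha_i\mid i\in I\}$ of a $\mathbb Q$-vector space of dimension $|I|$ with symmetric bilinear form $(\alpha_i,\alpha_j)=B_{ij}$, so $A_{ij}=2(\alpha_i,\alpha_j)/(\alpha_i,\alpha_i)$;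 $A$ is the structural matrix of $\Delta$. Put $s_\alpha(\beta)=\beta-\frac{2(\alpha,\beta)}{(\alpha,\alpha)}\alpha$. For $a,b\in I$ the braid-transformation $\tau_{a,b}$ replaces $\Delta$ by $\Delta'=\{\alpha'_i\}$ with $\alpha'_i=\alpha_i$ for $i\ne b$ and $\alpha'_b=s_{\alpha_a}(\alpha_b)$; $\tau_{a,b}A$ is the structural matrix of $\Delta'$. Two SIMs are braid-equivalent if one is obtained from the other by a finite sequence of braid-transformations and permutations of the index set. Let $C$ be an $l\times l$ Cartan matrix (positive definite symmetrizable generalized Cartan matrix) with root system $\dot R$, simple roots $\dot\Delta=\{\alpha_1,\dots,\alpha_l\}$ and induced form $(-,-)_C$ with $C_{ij}=2(\alpha_i,\alpha_j)_C/(\alpha_i,\alpha_i)_C$. A $d$-fold affinization of $C$ is an $(l+d)\times(l+d)$ matrix $C^{[d]}$ with $C^{[d]}_{ij}=\frac{2(\alpha_i,\alpha_j)_C}{(\alpha_i,\alpha_i)_C}$, where $\alpha_{l+1},\dots,\alpha_{l+d}\in\dot R\cup2\dot R$ are such that all $C^{[d]}_{ij}$ are integers. It is standard if $\alpha_{l+1},\dots,\alpha_{l+d}\in\dot\Delta\cup2\dot\Delta$. The elements $\beta_{l+1},\dots,\beta_{l+d}$ of the SIM-root basis of $C^{[d]}$ corresponding to $\alpha_{l+1},\dots,\alpha_{l+d}$ are called added roots; $\beta_{l+i}$ is an added single root if $\alpha_{l+i}\in\dot R$ and an added double root if $\alpha_{l+i}\in2\dot R$; an added single root is long (short) if the corresponding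 root $\alpha_{l+i}\in\dot R$ is long (short). If $C$ is symmetric all roots of $\dot R$ are called long by convention. If $C$ is indecomposable of type $X_l$ ($X=A,B,C,D,E,F,G$), $C^{[d]}$ is said to be of type $X_l^{(b,s,t)}$, where $b$ (resp. $s$) is the number of added single long (resp. short) roots and $t$ is the number of added double roots ($b+s+t=d$). Types are named so that $B_l$ ($l\ge2$) has exactly one short simple root and $C_l$ ($l\geq 3$) exactly one long simple root; $D_l$ means $l\ge4$; $B_2$ and $C_2$ are identified. *)

theory Defs
  imports "Jordan_Normal_Form.Matrix" "HOL-Combinatorics.Permutations"
begin

text \<open>A finite index set with n elements is taken to be the set of numbers below n, so that
  matrices over it are square matrices with n rows and the indices of a matrix A range over
  \<open>{..<dim_row A}\<close>.\<close>


subsection \<open>Symmetrizable intersection matrices\<close>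

definition generalized_intersection_matrix :: "int mat \<Rightarrow> bool" where
  "generalized_intersection_matrix A \<longleftrightarrow> square_mat A \<and>
     (\<forall>i<dim_row A. A $$ (i, i) = 2) \<and>
     (\<forall>i<dim_row A. \<forall>j<dim_row A. A $$ (i, j) < 0 \<longleftrightarrow> A $$ (j, i) < 0) \<and>
     (\<forall>i<dim_row A. \<forall>j<dim_row A. A $$ (i, j) > 0 \<longleftrightarrow> A $$ (j, i) > 0)"

definition symmetrized :: "int mat \<Rightarrow> (nat \<Rightarrow> nat) \<Rightarrow> int mat" where
  "symmetrized A D = mat_diag (dim_row A) (\<lambda>i. int (D i)) * A"

text \<open>Since the gcd of the empty set is 0, the empty matrix has no symmetrizer.\<close>

definition symmetrizer :: "int mat \<Rightarrow> (nat \<Rightarrow> nat) \<Rightarrow> bool" where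
  "symmetrizer A D \<longleftrightarrow>
     (\<forall>i<dim_row A. D i > 0) \<and> Gcd (D ` {..<dim_row A}) = 1 \<and>
     transpose_mat (symmetrized A D) = symmetrized A D"

definition SIM :: "int mat \<Rightarrow> bool" where
  "SIM A \<longleftrightarrow> generalized_intersection_matrix A \<and> (\<exists>D. symmetrizer A D)"

definition pos_semidef_mat :: "real mat \<Rightarrow> bool" where
  "pos_semidef_mat B \<longleftrightarrow> (\<forall>x \<in> carrier_vec (dim_row B). x \<bullet> (B *\<^sub>v x) \<ge> 0)"

definition pos_def_mat :: "real mat \<Rightarrow> bool" where
  "pos_def_mat B \<longleftrightarrow>
     (\<forall>x \<in> carrier_vec (dim_row B). x \<noteq> 0\<^sub>v (dim_row B) \<longrightarrow> x \<bullet> (B *\<^sub>v x) > 0)"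

text \<open>The symmetrizer need not be unique if A is decomposable, but two symmetrizers differ by a
  positive factor on each indecomposable block, so definiteness does not depend on the choice.\<close>

definition positive_semidefinite :: "int mat \<Rightarrow> bool" where
  "positive_semidefinite A \<longleftrightarrow>
     (\<exists>D. symmetrizer A D \<and> pos_semidef_mat (map_mat real_of_int (symmetrized A D)))"

definition positive_definite :: "int mat \<Rightarrow> bool" where
  "positive_definite A \<longleftrightarrow>
     (\<exists>D. symmetrizer A D \<and> pos_def_mat (map_mat real_of_int (symmetrized A D)))"

definition indecomposable :: "int mat \<Rightarrow> bool" where
  "indecomposable A \<longleftrightarrow>
     \<not> (\<exists>I1 I2. I1 \<noteq> {} \<and> I2 \<noteq> {} \<and> I1 \<inter> I2 = {} \<and> I1 \<union> I2 = {..<dim_row A} \<and>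
          (\<forall>i\<in>I1. \<forall>j\<in>I2. A $$ (i, j) = 0 \<and> A $$ (j, i) = 0))"


subsection \<open>Root bases and braid-equivalence\<close>

text \<open>The SIM-root basis of A is realised as the standard basis of the space of rational vectors,
  with the form whose Gram matrix is the symmetrized matrix.\<close>

definition root_form :: "int mat \<Rightarrow> (nat \<Rightarrow> nat) \<Rightarrow> rat vec \<Rightarrow> rat vec \<Rightarrow> rat" where
  "root_form A D x y = x \<bullet> (map_mat rat_of_int (symmetrized A D) *\<^sub>v y)"

definition root_basis :: "nat \<Rightarrow> nat \<Rightarrow> rat vec" where
  "root_basis n i = unit_vec n i"

definition reflection :: "(rat vec \<Rightarrow> rat vec \<Rightarrow> rat) \<Rightarrow> rat vec \<Rightarrow> rat vec \<Rightarrow> rat vec" where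
  "reflection Q \<alpha> \<beta> = \<beta> - (2 * Q \<alpha> \<beta> / Q \<alpha> \<alpha>) \<cdot>\<^sub>v \<alpha>"

definition structural_matrix ::
    "nat \<Rightarrow> (rat vec \<Rightarrow> rat vec \<Rightarrow> rat) \<Rightarrow> (nat \<Rightarrow> rat vec) \<Rightarrow> rat mat" where
  "structural_matrix n Q \<Delta> = mat n n (\<lambda>(i, j). 2 * Q (\<Delta> i) (\<Delta> j) / Q (\<Delta> i) (\<Delta> i))"

text \<open>\<open>braid_transformation a b A A'\<close> says that A' is the matrix \<open>\<tau>\<^sub>a\<^sub>,\<^sub>b A\<close>; the indices a and b
  may coincide, in which case the transformation changes the sign of one basis vector.\<close>

definition braid_transformation :: "nat \<Rightarrow> nat \<Rightarrow> int mat \<Rightarrow> int mat \<Rightarrow> bool" where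
  "braid_transformation a b A A' \<longleftrightarrow> a < dim_row A \<and> b < dim_row A \<and>
     (\<exists>D. symmetrizer A D \<and>
        (let n = dim_row A; Q = root_form A D; \<Delta> = root_basis n;
             \<Delta>' = \<Delta>(b := reflection Q (\<Delta> a) (\<Delta> b))
         in map_mat rat_of_int A' = structural_matrix n Q \<Delta>'))"

definition permute_indices :: "(nat \<Rightarrow> nat) \<Rightarrow> int mat \<Rightarrow> int mat" where
  "permute_indices \<pi> A = mat (dim_row A) (dim_row A) (\<lambda>(i, j). A $$ (\<pi> i, \<pi> j))"

inductive braid_step :: "int mat \<Rightarrow> int mat \<Rightarrow> bool" where
  braid: "braid_transformation a b A A' \<Longrightarrow> braid_step A A'"
| permutation: "\<pi> permutes {..<dim_row A} \<Longrightarrow> braid_step A (permute_indices \<pi> A)"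

definition braid_equivalent :: "int mat \<Rightarrow> int mat \<Rightarrow> bool" where
  "braid_equivalent A A' \<longleftrightarrow> SIM A \<and> SIM A' \<and> braid_step\<^sup>*\<^sup>* A A'"


subsection \<open>Cartan matrices and their root systems\<close>

definition generalized_Cartan_matrix :: "int mat \<Rightarrow> bool" where
  "generalized_Cartan_matrix C \<longleftrightarrow> square_mat C \<and>
     (\<forall>i<dim_row C. C $$ (i, i) = 2) \<and>
     (\<forall>i<dim_row C. \<forall>j<dim_row C. i \<noteq> j \<longrightarrow> C $$ (i, j) \<le> 0) \<and>
     (\<forall>i<dim_row C. \<forall>j<dim_row C. C $$ (i, j) = 0 \<longleftrightarrow> C $$ (j, i) = 0)"

definition Cartan_matrix :: "int mat \<Rightarrow> bool" where
  "Cartan_matrix C \<longleftrightarrow> generalized_Cartan_matrix C \<and> (\<exists>D. symmetrizer C D) \<and> positive_definite C"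

text \<open>The root system is the orbit of the simple roots under the Weyl group, which is generated by
  the simple reflections.\<close>

inductive_set root_system :: "int mat \<Rightarrow> (nat \<Rightarrow> nat) \<Rightarrow> rat vec set"
  for C :: "int mat" and D :: "nat \<Rightarrow> nat" where
  simple: "i < dim_row C \<Longrightarrow> root_basis (dim_row C) i \<in> root_system C D"
| reflect: "\<beta> \<in> root_system C D \<Longrightarrow> i < dim_row C \<Longrightarrow>
     reflection (root_form C D) (root_basis (dim_row C) i) \<beta> \<in> root_system C D"

definition simple_roots :: "int mat \<Rightarrow> rat vec set" where
  "simple_roots C = root_basis (dim_row C) ` {..<dim_row C}"

definition double :: "rat vec set \<Rightarrow> rat vec set" where
  "double S = (\<lambda>\<beta>. 2 \<cdot>\<^sub>v \<beta>) ` S"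

text \<open>Only used for indecomposable C, where at most two root lengths occur. If C is moreover
  symmetric, all roots have the same length and are long.\<close>

definition long_roots :: "int mat \<Rightarrow> (nat \<Rightarrow> nat) \<Rightarrow> rat vec set" where
  "long_roots C D = {\<beta> \<in> root_system C D. \<forall>\<gamma> \<in> root_system C D. root_form C D \<gamma> \<gamma> \<le> root_form C D \<beta> \<beta>}"

definition short_roots :: "int mat \<Rightarrow> (nat \<Rightarrow> nat) \<Rightarrow> rat vec set" where
  "short_roots C D = root_system C D - long_roots C D"


subsection \<open>Affinizations\<close>

text \<open>M is the d-fold affinization of C given by the family \<open>\<alpha>\<close>, whose first \<open>dim_row C\<close> members
  are the simple roots and whose next d members are the vectors inducing the added roots. That M is
  an integral matrix expresses the integrality condition. The symmetrizer D fixes the form of C.\<close>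

definition affinization ::
    "int mat \<Rightarrow> (nat \<Rightarrow> nat) \<Rightarrow> nat \<Rightarrow> (nat \<Rightarrow> rat vec) \<Rightarrow> int mat \<Rightarrow> bool" where
  "affinization C D d \<alpha> M \<longleftrightarrow> Cartan_matrix C \<and> symmetrizer C D \<and>
     (let l = dim_row C in
        (\<forall>i<l. \<alpha> i = root_basis l i) \<and>
        (\<forall>i\<in>{l..<l + d}. \<alpha> i \<in> root_system C D \<union> double (root_system C D)) \<and>
        map_mat rat_of_int M = structural_matrix (l + d) (root_form C D) \<alpha>)"

definition standard_affinization ::
    "int mat \<Rightarrow> (nat \<Rightarrow> nat) \<Rightarrow> nat \<Rightarrow> (nat \<Rightarrow> rat vec) \<Rightarrow> int mat \<Rightarrow> bool" where
  "standard_affinization C D d \<alpha> M \<longleftrightarrow> affinization C D d \<alpha> M \<and>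
     (\<forall>i\<in>{dim_row C..<dim_row C + d}. \<alpha> i \<in> simple_roots C \<union> double (simple_roots C))"


subsection \<open>Types\<close>

datatype family = Type_A | Type_B | Type_C | Type_D | Type_E | Type_F | Type_G

fun valid_type :: "family \<Rightarrow> nat \<Rightarrow> bool" where
  "valid_type Type_A l \<longleftrightarrow> l \<ge> 1"
| "valid_type Type_B l \<longleftrightarrow> l \<ge> 2"
| "valid_type Type_C l \<longleftrightarrow> l \<ge> 3"
| "valid_type Type_D l \<longleftrightarrow> l \<ge> 4"
| "valid_type Type_E l \<longleftrightarrow> l \<in> {6, 7, 8}"
| "valid_type Type_F l \<longleftrightarrow> l = 4"
| "valid_type Type_G l \<longleftrightarrow> l = 2"

text \<open>Edges of the Dynkin diagrams on the vertices \<open>0, \<dots>, l - 1\<close>, listed with \<open>i < j\<close>. For D and E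
  the first \<open>l - 1\<close> vertices form a chain, to which the last one is attached.\<close>

fun dynkin_edge :: "family \<Rightarrow> nat \<Rightarrow> nat \<Rightarrow> nat \<Rightarrow> bool" where
  "dynkin_edge Type_D l i j \<longleftrightarrow> (j = i + 1 \<and> j < l - 1) \<or> (i = l - 3 \<and> j = l - 1)"
| "dynkin_edge Type_E l i j \<longleftrightarrow> (j = i + 1 \<and> j < l - 1) \<or> (i = 2 \<and> j = l - 1)"
| "dynkin_edge _ l i j \<longleftrightarrow> j = i + 1"

text \<open>Rows are normalised by \<open>C\<^sub>i\<^sub>j = 2 (\<alpha>\<^sub>i, \<alpha>\<^sub>j) / (\<alpha>\<^sub>i, \<alpha>\<^sub>i)\<close>, so an entry less than \<open>-1\<close> lies in the
  row of the shorter root.\<close>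

fun dynkin_entry :: "family \<Rightarrow> nat \<Rightarrow> nat \<times> nat \<Rightarrow> int" where
  "dynkin_entry X l (i, j) =
     (if i = j then 2
      else if dynkin_edge X l i j \<or> dynkin_edge X l j i then
        (if X = Type_B \<and> i = l - 1 \<and> j = l - 2 then -2
         else if X = Type_C \<and> i = l - 2 \<and> j = l - 1 then -2
         else if X = Type_F \<and> i = 2 \<and> j = 1 then -2
         else if X = Type_G \<and> i = 0 \<and> j = 1 then -3
         else -1)
      else 0)"

definition Cartan_matrix_of_type :: "int mat \<Rightarrow> family \<Rightarrow> nat \<Rightarrow> bool" where
  "Cartan_matrix_of_type C X l \<longleftrightarrow> valid_type X l \<and>
     (\<exists>\<pi>. \<pi> permutes {..<l} \<and> C = permute_indices \<pi> (mat l l (dynkin_entry X l)))"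

text \<open>The affinization of C given by \<open>\<alpha>\<close> has type \<open>X\<^sub>l\<close> with upper index \<open>(b,s,t)\<close>.\<close>

definition affinization_type ::
    "int mat \<Rightarrow> (nat \<Rightarrow> nat) \<Rightarrow> nat \<Rightarrow> (nat \<Rightarrow> rat vec) \<Rightarrow>
     family \<Rightarrow> nat \<Rightarrow> nat \<Rightarrow> nat \<Rightarrow> nat \<Rightarrow> bool" where
  "affinization_type C D d \<alpha> X l b s t \<longleftrightarrow>
     indecomposable C \<and> Cartan_matrix_of_type C X l \<and>
     b = card {i \<in> {l..<l + d}. \<alpha> i \<in> long_roots C D} \<and>
     s = card {i \<in> {l..<l + d}. \<alpha> i \<in> short_roots C D} \<and>
     t = card {i \<in> {l..<l + d}. \<alpha> i \<in> double (root_system C D)}"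

definition standard_affinization_matrix ::
    "int mat \<Rightarrow> nat \<Rightarrow> family \<Rightarrow> nat \<Rightarrow> nat \<Rightarrow> nat \<Rightarrow> nat \<Rightarrow> bool" where
  "standard_affinization_matrix M d X l b s t \<longleftrightarrow>
     (\<exists>C D \<alpha>. standard_affinization C D d \<alpha> M \<and> affinization_type C D d \<alpha> X l b s t)"

end

theory Submission
  imports Defs
begin

text \<open>
  Modulo the radical of its form, the SIM-root basis of a positive semi-definite matrix becomes a
  family of nonzero vectors in a Euclidean space. The matrix is determined by this family, and a
  braid transformation replaces one member of the family by its mirror image in another one. So the
  theorem is about normal forms of such families under these replacements.

  Existence. There is a vector \<open>\<rho>\<close> whose product with every vector that can occur is a nonzero integer
  (\<open>separating_vector\<close>); call this product the height. Take a family in the braid class that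
  minimises the sum of all \<open>2 |h\<^sub>i|\<close> plus the number of negative heights. Since braid transformations
  include changes of sign, all its heights are positive. If two members have positive inner product,
  with entries \<open>k = A\<^sub>a\<^sub>b\<close> and \<open>k' = A\<^sub>b\<^sub>a\<close>, then neither reflection lowers that sum, which means \<open>k h\<^sub>a \<ge> 2 h\<^sub>b\<close> and
  \<open>k' h\<^sub>b \<ge> 2 h\<^sub>a\<close>, hence \<open>k k' \<ge> 4\<close>; this is the case of equality in the Cauchy-Schwarz inequality, so
  the two members are proportional modulo the radical (\<open>exists_minimal_family\<close>). Choosing the lowest
  member on every ray gives vectors with pairwise non-positive products in an open half space. Such
  vectors are linearly independent, so they form a simple system (\<open>obtuse_family_pd\<close>), and every
  other member is one of them or the double of one (\<open>minimal_family_representatives\<close>).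
  The type of the simple system comes from the classification of positive definite Cartan matrices (\<open>pd_gcm_classification\<close>), which removes leaves of the diagram
  one by one and bounds the bonds leaving a simply laced path (\<open>pd_gcm_bond_bound\<close>).

  Uniqueness. A standard affinization matrix is determined by the Dynkin diagram together with the
  simple root and the factor 1 or 2 belonging to each index (\<open>std_data\<close>). If the simple roots
  \<open>\<alpha>\<close> and \<open>\<beta>\<close> are joined by a simple bond, then \<open>s\<^sub>\<alpha> s\<^sub>\<beta> \<alpha> = \<beta>\<close>; since all simple roots belong to the family,
  two braid transformations turn an added root over \<open>\<alpha>\<close> into one over \<open>\<beta>\<close>. Simple roots of equal
  length are connected by simple bonds, so only the numbers of long, short and double added roots
  matter (\<open>std_data_braid_equivalent\<close>).

  Types. The double of a simple root gives an integral matrix only if its row in the Cartan matrix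
  is even, which happens only for \<open>A\<^sub>1\<close> and for the short simple root of \<open>B\<^sub>l\<close> (\<open>dynkin_even_row\<close>).
\<close>

section \<open>Bilinear forms and realizations of intersection matrices\<close>

text \<open>The bilinear form with Gram matrix B. Vectors are functions, only the values below m count. The
  coefficients lie in an arbitrary ring because integral vectors are needed for descent arguments
  and real ones for positivity.\<close>

definition form :: "nat \<Rightarrow> (nat \<Rightarrow> nat \<Rightarrow> int) \<Rightarrow> (nat \<Rightarrow> 'a::comm_ring_1) \<Rightarrow> (nat \<Rightarrow> 'a) \<Rightarrow> 'a" where
  "form m B x y = (\<Sum>i<m. \<Sum>j<m. of_int (B i j) * x i * y j)"

lemma form_diff_left: "form m B (\<lambda>p. x p - k * y p) z = form m B x z - k * form m B y z"
  by (simp add: form_def algebra_simps sum_subtractf sum_distrib_left)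

lemma form_diff_right: "form m B z (\<lambda>p. x p - k * y p) = form m B z x - k * form m B z y"
  by (simp add: form_def algebra_simps sum_subtractf sum_distrib_left)

lemma form_smult_left: "form m B (\<lambda>p. k * y p) z = k * form m B y z"
  by (simp add: form_def algebra_simps sum_distrib_left)

lemma form_smult_right: "form m B z (\<lambda>p. k * y p) = k * form m B z y"
  by (simp add: form_def algebra_simps sum_distrib_left)

lemma form_sum_left: "form m B (\<lambda>p. \<Sum>i\<in>I. f i p) z = (\<Sum>i\<in>I. form m B (f i) z)"
proof (induction I rule: infinite_finite_induct)
  case (insert a I)
  then show ?case by (simp add: form_def algebra_simps sum.distrib)
qed (auto simp: form_def)

lemma form_sym:
  assumes "\<And>i j. i < m \<Longrightarrow> j < m \<Longrightarrow> B i j = B j i"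
  shows "form m B x y = form m B y x"
proof -
  have "form m B x y = (\<Sum>j<m. \<Sum>i<m. of_int (B i j) * x i * y j)"
    unfolding form_def by (rule sum.swap)
  also have "\<dots> = form m B y x"
    unfolding form_def by (intro sum.cong refl) (simp add: assms mult_ac)
  finally show ?thesis .
qed

lemma form_sum_right: "form m B z (\<lambda>p. \<Sum>i\<in>I. f i p) = (\<Sum>i\<in>I. form m B z (f i))"
proof (induction I rule: infinite_finite_induct)
  case (insert a I)
  then show ?case by (simp add: form_def algebra_simps sum.distrib)
qed (auto simp: form_def)

lemma of_int_form: "of_int (form m B x y) = form m B (\<lambda>p. of_int (x p)) (\<lambda>p. of_int (y p))"
  by (simp add: form_def)

definition unitf :: "nat \<Rightarrow> nat \<Rightarrow> 'a::comm_ring_1" where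
  "unitf i = (\<lambda>p. if p = i then 1 else 0)"

lemma form_unit_right: "j < m \<Longrightarrow> form m B x (unitf j) = (\<Sum>i<m. of_int (B i j) * x i)"
  unfolding form_def unitf_def
  by (intro sum.cong refl) (simp add: if_distrib[of "\<lambda>z. _ * z"] cong: if_cong)

lemma form_unit: "i < m \<Longrightarrow> j < m \<Longrightarrow> form m B (unitf i) (unitf j) = of_int (B i j)"
  by (subst form_unit_right) (auto simp: unitf_def if_distrib[of "\<lambda>z. _ * z"] cong: if_cong)

text \<open>A is the structural matrix of a family of non-isotropic integral vectors. The defining quotient
  \<open>2 (v\<^sub>i, v\<^sub>j) / (v\<^sub>i, v\<^sub>i)\<close> is cleared of its denominator, so that everything stays integral.\<close>

definition realizes :: "nat \<Rightarrow> (nat \<Rightarrow> nat \<Rightarrow> int) \<Rightarrow> (nat \<Rightarrow> nat \<Rightarrow> int) \<Rightarrow> int mat \<Rightarrow> bool" where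
  "realizes m B X A \<longleftrightarrow> square_mat A \<and> (\<forall>i<m. \<forall>j<m. B i j = B j i) \<and>
     (\<forall>i<dim_row A. form m B (X i) (X i) > 0) \<and>
     (\<forall>i<dim_row A. \<forall>j<dim_row A. A $$ (i, j) * form m B (X i) (X i) = 2 * form m B (X i) (X j))"

lemma symmetrized_index:
  assumes "square_mat A" "i < dim_row A" "j < dim_row A"
  shows "symmetrized A D $$ (i, j) = int (D i) * A $$ (i, j)"
  using assms unfolding symmetrized_def
  by (subst mat_diag_mult_left[of _ "dim_row A" "dim_row A"]) auto

lemma symmetrized_carrier:
  assumes "square_mat A"
  shows "symmetrized A D \<in> carrier_mat (dim_row A) (dim_row A)"
  using assms unfolding symmetrized_def
  by (subst mat_diag_mult_left[of _ "dim_row A" "dim_row A"]) auto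

lemma symmetrizer_iff:
  assumes "square_mat A"
  shows "symmetrizer A D \<longleftrightarrow> (\<forall>i<dim_row A. D i > 0) \<and> Gcd (D ` {..<dim_row A}) = 1 \<and>
    (\<forall>i<dim_row A. \<forall>j<dim_row A. int (D i) * A $$ (i, j) = int (D j) * A $$ (j, i))"
proof -
  have c: "symmetrized A D \<in> carrier_mat (dim_row A) (dim_row A)"
    using assms by (rule symmetrized_carrier)
  have "transpose_mat (symmetrized A D) = symmetrized A D \<longleftrightarrow>
    (\<forall>i<dim_row A. \<forall>j<dim_row A. int (D i) * A $$ (i, j) = int (D j) * A $$ (j, i))"
    (is "?l = ?r")
  proof
    assume l: ?l
    show ?r
    proof (intro allI impI)
      fix i j assume ij: "i < dim_row A" "j < dim_row A"
      have "transpose_mat (symmetrized A D) $$ (i, j) = symmetrized A D $$ (j, i)"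
        using ij c by auto
      then show "int (D i) * A $$ (i, j) = int (D j) * A $$ (j, i)"
        using l assms ij by (simp add: symmetrized_index)
    qed
  next
    assume ?r then show ?l
      using c assms by (intro eq_matI) (auto simp: symmetrized_index)
  qed
  then show ?thesis unfolding symmetrizer_def by blast
qed

text \<open>Squared lengths compatible with A become a symmetrizer after division by their gcd.\<close>

lemma symmetrizer_of_norms:
  fixes N :: "nat \<Rightarrow> int"
  assumes sq: "square_mat A" and n: "dim_row A > 0"
    and pos: "\<And>i. i < dim_row A \<Longrightarrow> N i > 0"
    and sym: "\<And>i j. i < dim_row A \<Longrightarrow> j < dim_row A \<Longrightarrow> N i * A $$ (i, j) = N j * A $$ (j, i)"
  obtains D k where "symmetrizer A D" "k > 0" "\<And>i. i < dim_row A \<Longrightarrow> N i = k * int (D i)"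
proof -
  define S where "S = (\<lambda>i. nat (N i)) ` {..<dim_row A}"
  define g where "g = Gcd S"
  have g0: "g > 0"
  proof -
    have "nat (N 0) \<in> S" "nat (N 0) \<noteq> 0" using n pos[of 0] by (auto simp: S_def)
    then have "g \<noteq> 0" unfolding g_def by (auto simp: Gcd_0_iff)
    then show ?thesis by simp
  qed
  have dv: "g dvd nat (N i)" if "i < dim_row A" for i
    unfolding g_def using that by (intro Gcd_dvd) (auto simp: S_def)
  define D where "D i = nat (N i) div g" for i
  have ND: "nat (N i) = g * D i" if "i < dim_row A" for i
    using dv[OF that] by (simp add: D_def)
  have ND': "N i = int g * int (D i)" if "i < dim_row A" for i
    using ND[OF that] pos[OF that] by (metis int_nat_eq less_imp_le of_nat_mult)
  have G: "Gcd (D ` {..<dim_row A}) = 1"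
  proof -
    have "S = (*) g ` (D ` {..<dim_row A})"
      unfolding S_def image_image by (intro image_cong refl) (simp add: ND)
    then have "g = normalize (g * Gcd (D ` {..<dim_row A}))"
      unfolding g_def by (metis Gcd_mult)
    then have "g * 1 = g * Gcd (D ` {..<dim_row A})" by simp
    then show ?thesis using g0 by (metis mult_cancel1 not_gr_zero)
  qed
  have "symmetrizer A D"
    unfolding symmetrizer_iff[OF sq]
  proof (intro conjI allI impI G)
    fix i assume i: "i < dim_row A"
    show "D i > 0" using ND'[OF i] pos[OF i] by (cases "D i") auto
    fix j assume j: "j < dim_row A"
    have "int g * (int (D i) * A $$ (i, j)) = int g * (int (D j) * A $$ (j, i))"
      using sym[OF i j] ND'[OF i] ND'[OF j] by (simp add: mult.assoc)
    then show "int (D i) * A $$ (i, j) = int (D j) * A $$ (j, i)" using g0 by simp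
  qed
  then show ?thesis using that[of D "int g"] g0 ND' by simp
qed

text \<open>Each entry has the sign of an inner product, and inner products are symmetric.\<close>

lemma realizes_SIM:
  assumes r: "realizes m B X A" and n: "dim_row A > 0"
  shows "SIM A"
proof -
  have sq: "square_mat A" using r by (simp add: realizes_def)
  define Q where "Q i j = form m B (X i) (X j)" for i j
  have Qs: "Q i j = Q j i" for i j
    unfolding Q_def by (rule form_sym) (use r in \<open>auto simp: realizes_def\<close>)
  have Qp: "Q i i > 0" if "i < dim_row A" for i
    using r that by (auto simp: realizes_def Q_def)
  have AQ: "A $$ (i, j) * Q i i = 2 * Q i j" if "i < dim_row A" "j < dim_row A" for i j
    using r that by (auto simp: realizes_def Q_def)
  have sgA: "sgn (A $$ (i, j)) = sgn (Q i j)" if "i < dim_row A" "j < dim_row A" for i j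
  proof -
    have "sgn (A $$ (i, j) * Q i i) = sgn (2 * Q i j)" using AQ[OF that] by simp
    then show ?thesis using Qp[OF that(1)] by (simp add: sgn_mult)
  qed
  have gim: "generalized_intersection_matrix A"
    unfolding generalized_intersection_matrix_def
  proof (intro conjI allI impI sq)
    fix i assume i: "i < dim_row A"
    show "A $$ (i, i) = 2" using AQ[OF i i] Qp[OF i] by simp
    fix j assume j: "j < dim_row A"
    have e: "sgn (A $$ (i, j)) = sgn (A $$ (j, i))" using sgA i j Qs[of i j] by simp
    show "A $$ (i, j) < 0 \<longleftrightarrow> A $$ (j, i) < 0" using e by (metis sgn_less)
    show "A $$ (i, j) > 0 \<longleftrightarrow> A $$ (j, i) > 0" using e by (metis sgn_greater)
  qed
  obtain D k where "symmetrizer A D"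
    by (rule symmetrizer_of_norms[OF sq n Qp]) (use AQ Qs in \<open>auto simp: mult.commute\<close>)
  then show ?thesis using gim unfolding SIM_def by blast
qed

lemma SIM_dim_pos: "SIM A \<Longrightarrow> dim_row A > 0"
  by (auto simp: SIM_def symmetrizer_def intro!: gr0I)

lemma SIM_realized:
  assumes "SIM A" "symmetrizer A D"
  shows "realizes (dim_row A) (\<lambda>i j. int (D i) * A $$ (i, j)) unitf A"
proof -
  have sq: "square_mat A" using assms by (auto simp: SIM_def generalized_intersection_matrix_def)
  show ?thesis
    using assms sq symmetrizer_iff[OF sq, of D]
    by (auto simp: realizes_def form_unit SIM_def generalized_intersection_matrix_def)
qed

section \<open>Braid transformations in coordinates\<close>

text \<open>The matrix \<open>\<tau>\<^sub>a\<^sub>,\<^sub>b A\<close> in terms of the entries of A. No division occurs because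
  \<open>A\<^sub>a\<^sub>b (\<alpha>\<^sub>a, \<alpha>\<^sub>a) = A\<^sub>b\<^sub>a (\<alpha>\<^sub>b, \<alpha>\<^sub>b)\<close>; this is why braid transformations preserve integrality.\<close>

definition tau :: "nat \<Rightarrow> nat \<Rightarrow> int mat \<Rightarrow> int mat" where
  "tau a b A = mat (dim_row A) (dim_row A) (\<lambda>(i, j).
     if i = b then (if j = b then 2 else A $$ (b, j) - A $$ (b, a) * A $$ (a, j))
     else if j = b then A $$ (i, b) - A $$ (i, a) * A $$ (a, b) else A $$ (i, j))"

lemma dim_tau [simp]: "dim_row (tau a b A) = dim_row A" "dim_col (tau a b A) = dim_row A"
  by (auto simp: tau_def)

text \<open>Braid transformations act on realizing families: \<open>v\<^sub>b - A\<^sub>a\<^sub>b v\<^sub>a\<close> is the reflection of \<open>v\<^sub>b\<close> in \<open>v\<^sub>a\<close>.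
  Both the descent and the motion of added roots take place on families.\<close>

lemma realizes_tau:
  assumes r: "realizes m B X A" and a: "a < dim_row A" and b: "b < dim_row A"
  shows "realizes m B (X(b := (\<lambda>p. X b p - A $$ (a, b) * X a p))) (tau a b A)" (is "realizes m B ?X' _")
proof -
  define Q where "Q i j = form m B (X i) (X j)" for i j
  have Qs: "Q i j = Q j i" for i j
    unfolding Q_def by (rule form_sym) (use r in \<open>auto simp: realizes_def\<close>)
  have AQ: "A $$ (i, j) * Q i i = 2 * Q i j" if "i < dim_row A" "j < dim_row A" for i j
    using r that by (auto simp: realizes_def Q_def)
  define k where "k = A $$ (a, b)"
  have Q': "form m B (?X' i) (?X' j) =
      (if i = b then if j = b then Q b b - k * Q b a - k * (Q a b - k * Q a a) else Q b j - k * Q a j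
       else if j = b then Q i b - k * Q i a else Q i j)" for i j
    by (simp add: form_diff_left form_diff_right Q_def k_def)
  \<comment> \<open>reflections are isometries\<close>
  have bb: "Q b b - k * Q b a - k * (Q a b - k * Q a a) = Q b b"
  proof -
    have "k * Q a a = 2 * Q a b" using AQ[OF a b] by (simp add: k_def)
    then show ?thesis by (simp add: Qs[of b a] algebra_simps)
  qed
  show ?thesis
    unfolding realizes_def
  proof (intro conjI allI impI)
    show "square_mat (tau a b A)" by simp
    show "B i j = B j i" if "i < m" "j < m" for i j using r that by (auto simp: realizes_def)
    fix i assume i: "i < dim_row (tau a b A)"
    show "form m B (?X' i) (?X' i) > 0"
      unfolding Q' bb using r i by (auto simp: realizes_def Q_def)
    fix j assume j: "j < dim_row (tau a b A)"
    have i': "i < dim_row A" and j': "j < dim_row A" using i j by auto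
    have k: "k * Q a a = 2 * Q a b" using AQ[OF a b] by (simp add: k_def)
    consider "i = b" "j = b" | "i = b" "j \<noteq> b" | "i \<noteq> b" "j = b" | "i \<noteq> b" "j \<noteq> b" by blast
    then show "tau a b A $$ (i, j) * form m B (?X' i) (?X' i) = 2 * form m B (?X' i) (?X' j)"
    proof cases
      case 1 then show ?thesis unfolding Q' bb using i' by (simp add: tau_def bb)
    next
      case 2
      have "(A $$ (b, a) * A $$ (a, j)) * Q b b = A $$ (a, j) * (A $$ (b, a) * Q b b)" by simp
      also have "\<dots> = A $$ (a, j) * (k * Q a a)" using AQ[OF b a] k by (simp add: Qs[of b a])
      also have "\<dots> = k * (A $$ (a, j) * Q a a)" by simp
      also have "\<dots> = 2 * (k * Q a j)" using AQ[OF a j'] by simp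
      finally have "(A $$ (b, j) - A $$ (b, a) * A $$ (a, j)) * Q b b = 2 * (Q b j - k * Q a j)"
        using AQ[OF b j'] by (simp add: algebra_simps)
      then show ?thesis unfolding Q' bb using 2 i' j' by (simp add: tau_def)
    next
      case 3
      have "(A $$ (i, b) - A $$ (i, a) * k) * Q i i = A $$ (i, b) * Q i i - k * (A $$ (i, a) * Q i i)"
        by (simp add: algebra_simps)
      also have "\<dots> = 2 * (Q i b - k * Q i a)" unfolding AQ[OF i' b] AQ[OF i' a] by simp
      finally have "(A $$ (i, b) - A $$ (i, a) * k) * Q i i = 2 * (Q i b - k * Q i a)" .
      then show ?thesis unfolding Q' bb using 3 i' j' by (simp add: tau_def k_def)
    next
      case 4 then show ?thesis unfolding Q' using i' j' AQ[OF i' j'] by (simp add: tau_def)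
    qed
  qed
qed

lemma realizes_tau_norm:
  assumes r: "realizes m B X A" and a: "a < dim_row A" and b: "b < dim_row A"
  defines "v \<equiv> (\<lambda>p. X b p - A $$ (a, b) * X a p)"
  shows "form m B v v = form m B (X b) (X b)"
proof -
  have s: "form m B (X b) (X a) = form m B (X a) (X b)" 
    by (rule form_sym) (use r in \<open>auto simp: realizes_def\<close>)
  have "A $$ (a, b) * form m B (X a) (X a) = 2 * form m B (X a) (X b)"
    using r a b by (auto simp: realizes_def)
  then show ?thesis unfolding v_def form_diff_left form_diff_right s by (simp add: algebra_simps)
qed

lemma symmetrized_scalar_prod:
  fixes x y :: "'a::comm_ring_1 vec"
  assumes "square_mat A" "x \<in> carrier_vec (dim_row A)" "y \<in> carrier_vec (dim_row A)"
  shows "x \<bullet> (map_mat of_int (symmetrized A D) *\<^sub>v y) =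
    form (dim_row A) (\<lambda>i j. int (D i) * A $$ (i, j)) (\<lambda>i. x $ i) (\<lambda>i. y $ i)"
proof -
  have c: "symmetrized A D \<in> carrier_mat (dim_row A) (dim_row A)"
    by (rule symmetrized_carrier[OF assms(1)])
  have row: "(map_mat of_int (symmetrized A D) *\<^sub>v y) $ i =
      (\<Sum>j<dim_row A. of_int (int (D i) * A $$ (i, j)) * y $ j)" if i: "i < dim_row A" for i
  proof -
    have "(map_mat of_int (symmetrized A D) *\<^sub>v y) $ i = (\<Sum>j = 0..<dim_row A. of_int (symmetrized A D $$ (i, j)) * y $ j)"
      using c i assms(3) by (simp add: scalar_prod_def)
    also have "\<dots> = (\<Sum>j<dim_row A. of_int (int (D i) * A $$ (i, j)) * y $ j)"
      unfolding lessThan_atLeast0 using i by (intro sum.cong refl) (simp only: symmetrized_index[OF assms(1)] atLeastLessThan_iff)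
    finally show ?thesis .
  qed
  have dm: "dim_vec (map_mat of_int (symmetrized A D) *\<^sub>v y) = dim_row A" using c by auto
  have "x \<bullet> (map_mat of_int (symmetrized A D) *\<^sub>v y) =
      (\<Sum>i<dim_row A. x $ i * (\<Sum>j<dim_row A. of_int (int (D i) * A $$ (i, j)) * y $ j))"
    unfolding scalar_prod_def dm lessThan_atLeast0[symmetric]
    by (intro sum.cong refl) (simp only: row lessThan_iff)
  then show ?thesis
    unfolding form_def sum_distrib_left by (simp only: mult_ac)
qed

lemma root_form_eq_form:
  assumes "square_mat A" "x \<in> carrier_vec (dim_row A)" "y \<in> carrier_vec (dim_row A)"
  shows "root_form A D x y = form (dim_row A) (\<lambda>i j. int (D i) * A $$ (i, j)) (\<lambda>i. x $ i) (\<lambda>i. y $ i)"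
  unfolding root_form_def using assms by (rule symmetrized_scalar_prod)

lemma braid_transformation_tau:
  assumes A: "SIM A" and a: "a < dim_row A" and b: "b < dim_row A"
  shows "braid_transformation a b A (tau a b A)"
proof -
  obtain D where D: "symmetrizer A D" using A by (auto simp: SIM_def)
  have sq: "square_mat A" using A by (auto simp: SIM_def generalized_intersection_matrix_def)
  define n where "n = dim_row A"
  define B where "B = (\<lambda>i j. int (D i) * A $$ (i, j))"
  define Q where "Q = root_form A D"
  define \<Delta>' where "\<Delta>' = (root_basis n)(b := reflection Q (root_basis n a) (root_basis n b))"
  define X where "X = (unitf(b := (\<lambda>p. unitf b p - A $$ (a, b) * unitf a p)) :: nat \<Rightarrow> nat \<Rightarrow> int)"
  have r: "realizes n B X (tau a b A)"
    unfolding X_def n_def B_def by (rule realizes_tau[OF SIM_realized[OF A D] a b])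
  have rA: "realizes n B unitf A" unfolding n_def B_def by (rule SIM_realized[OF A D])
  have ab: "a < n" "b < n" using a b by (auto simp: n_def)
  have Qqf: "Q x y = rat_of_int (form n B u v)"
    if "x \<in> carrier_vec n" "y \<in> carrier_vec n" "\<And>p. p < n \<Longrightarrow> x $ p = of_int (u p)"
      "\<And>p. p < n \<Longrightarrow> y $ p = of_int (v p)" for x y u v
  proof -
    have "Q x y = form n B (\<lambda>i. x $ i) (\<lambda>i. y $ i)"
      unfolding Q_def n_def B_def using that(1,2) by (intro root_form_eq_form[OF sq]) (auto simp: n_def)
    also have "\<dots> = form n B (\<lambda>i. of_int (u i)) (\<lambda>i. of_int (v i))"
      unfolding form_def by (intro sum.cong refl) (simp add: that)
    finally show ?thesis by (simp add: of_int_form)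
  qed
  have unit: "unit_vec n i $ p = rat_of_int (unitf i p)" if "i < n" "p < n" for i p
    using that by (simp add: unitf_def)
  have coeff: "2 * Q (root_basis n a) (root_basis n b) / Q (root_basis n a) (root_basis n a) = of_int (A $$ (a, b))"
  proof -
    have 1: "Q (root_basis n i) (root_basis n j) = of_int (form n B (unitf i) (unitf j))" if "i < n" "j < n" for i j
      unfolding root_basis_def by (rule Qqf) (use that unit in auto)
    have "A $$ (a, b) * form n B (unitf a) (unitf a) = 2 * form n B (unitf a) (unitf b)"
      and "form n B (unitf a :: nat \<Rightarrow> int) (unitf a) > 0"
      using rA a b unfolding realizes_def by auto
    then have "rat_of_int (A $$ (a, b)) * of_int (form n B (unitf a) (unitf a)) = 2 * of_int (form n B (unitf a) (unitf b))"
      by (metis of_int_mult of_int_numeral)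
    then show ?thesis unfolding 1[OF ab] 1[OF ab(1) ab(1)]
      using \<open>form n B (unitf a :: nat \<Rightarrow> int) (unitf a) > 0\<close> by (simp add: field_simps)
  qed
  have \<Delta>'c: "\<Delta>' i \<in> carrier_vec n" for i
    unfolding \<Delta>'_def reflection_def root_basis_def by auto
  have \<Delta>'X: "\<Delta>' i $ p = of_int (X i p)" if "i < n" "p < n" for i p
    unfolding \<Delta>'_def X_def reflection_def coeff
    using that ab unit by (auto simp: root_basis_def)
  have "map_mat rat_of_int (tau a b A) = structural_matrix n Q \<Delta>'"
  proof (rule eq_matI)
    fix i j assume "i < dim_row (structural_matrix n Q \<Delta>')" "j < dim_col (structural_matrix n Q \<Delta>')"
    then have ij: "i < n" "j < n" by (auto simp: structural_matrix_def)
    have QX: "Q (\<Delta>' i) (\<Delta>' j) = of_int (form n B (X i) (X j))" if "i < n" "j < n" for i j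
      by (rule Qqf) (use that \<Delta>'c \<Delta>'X in auto)
    have p: "form n B (X i) (X i) > 0" and
      e: "tau a b A $$ (i, j) * form n B (X i) (X i) = 2 * form n B (X i) (X j)"
      using r ij unfolding realizes_def by (auto simp: n_def)
    have "rat_of_int (tau a b A $$ (i, j)) * of_int (form n B (X i) (X i)) = 2 * of_int (form n B (X i) (X j))"
      using e by (metis of_int_mult of_int_numeral)
    then have "of_int (tau a b A $$ (i, j)) = 2 * Q (\<Delta>' i) (\<Delta>' j) / Q (\<Delta>' i) (\<Delta>' i)"
      unfolding QX[OF ij] QX[OF ij(1) ij(1)] using p by (simp add: field_simps)
    then show "map_mat rat_of_int (tau a b A) $$ (i, j) = structural_matrix n Q \<Delta>' $$ (i, j)"
      using ij by (simp add: structural_matrix_def n_def)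
  qed (auto simp: structural_matrix_def n_def)
  then show ?thesis
    unfolding braid_transformation_def Let_def using a b D
    by (auto simp: \<Delta>'_def n_def Q_def)
qed

text \<open>This allows to identify the end of a chain of braid transformations by its family alone.\<close>

lemma realizes_unique:
  assumes "realizes m B X A" "realizes m B X' A'" "dim_row A' = dim_row A"
    "\<And>i. i < dim_row A \<Longrightarrow> X i = X' i"
  shows "A = A'"
proof (rule eq_matI)
  fix i j assume ij: "i < dim_row A'" "j < dim_col A'"
  then have ij': "i < dim_row A" "j < dim_row A" using assms by (auto simp: realizes_def)
  have "A $$ (i, j) * form m B (X i) (X i) = A' $$ (i, j) * form m B (X i) (X i)"
    "form m B (X i) (X i) > 0"
    using assms ij' by (auto simp: realizes_def)
  then show "A $$ (i, j) = A' $$ (i, j)" by simp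
qed (use assms in \<open>auto simp: realizes_def\<close>)

lemma braid_step_tau: "SIM A \<Longrightarrow> a < dim_row A \<Longrightarrow> b < dim_row A \<Longrightarrow> braid_step A (tau a b A)"
  by (rule braid_step.braid[OF braid_transformation_tau])

text \<open>A splitting of \<open>\<tau>\<^sub>a\<^sub>,\<^sub>b A\<close> already splits A. Rows other than b only change in column b,
  and row b changes by a multiple of row a. If a and b lie in the same part, both new rows vanish on
  the other part, hence so does the old row b. Otherwise the entry at (b, a), which merely changes its
  sign, is zero, so that nothing has changed at all.\<close>

lemma indecomposable_tau:
  assumes A: "SIM A" and ind: "indecomposable A" and a: "a < dim_row A" and b: "b < dim_row A"
  shows "indecomposable (tau a b A)"
  unfolding indecomposable_def
proof (rule notI, elim exE conjE)
  fix I1 I2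
  assume ne: "I1 \<noteq> {}" "I2 \<noteq> {}" and dj: "I1 \<inter> I2 = {}" and un: "I1 \<union> I2 = {..<dim_row (tau a b A)}"
    and z: "\<forall>i\<in>I1. \<forall>j\<in>I2. tau a b A $$ (i, j) = 0 \<and> tau a b A $$ (j, i) = 0"
  have A2: "A $$ (i, i) = 2" if "i < dim_row A" for i
    using A that by (auto simp: SIM_def generalized_intersection_matrix_def)
  have A0: "A $$ (i, j) = 0 \<Longrightarrow> A $$ (j, i) = 0" if "i < dim_row A" "j < dim_row A" for i j
  proof -
    have "A $$ (i, j) < 0 \<longleftrightarrow> A $$ (j, i) < 0" "A $$ (i, j) > 0 \<longleftrightarrow> A $$ (j, i) > 0"
      using A that by (auto simp: SIM_def generalized_intersection_matrix_def)
    then show "A $$ (i, j) = 0 \<Longrightarrow> A $$ (j, i) = 0" by linarith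
  qed
  have split: "A $$ (i, j) = 0"
    if J: "J1 \<inter> J2 = {}" "J1 \<union> J2 = {..<dim_row A}" "b \<in> J1"
      and z: "\<forall>i\<in>J1. \<forall>j\<in>J2. tau a b A $$ (i, j) = 0" and ij: "i \<in> J1" "j \<in> J2" for J1 J2 i j
  proof -
    have lt: "i < dim_row A" "j < dim_row A" and jb: "j \<noteq> b" using ij J by auto
    have t: "tau a b A $$ (i, j) = (if i = b then A $$ (b, j) - A $$ (b, a) * A $$ (a, j) else A $$ (i, j))"
      if "i < dim_row A" "j < dim_row A" "j \<noteq> b" for i j using that by (simp add: tau_def)
    have b0: "A $$ (b, j) - A $$ (b, a) * A $$ (a, j) = 0"
      using z J(3) ij(2) t[OF b lt(2) jb] by auto
    have "A $$ (b, j) = 0"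
    proof (cases "a \<in> J1")
      case True
      show ?thesis
      proof (cases "a = b")
        case True then show ?thesis using b0 A2[OF b] by simp
      next
        case False
        then have "A $$ (a, j) = 0" using z \<open>a \<in> J1\<close> ij(2) t[OF a lt(2) jb] by auto
        then show ?thesis using b0 by simp
      qed
    next
      case False
      then have "a \<in> J2" "a \<noteq> b" using a J by auto
      then have "A $$ (b, a) - A $$ (b, a) * A $$ (a, a) = 0"
        using z J(3) t[OF b a] by auto
      then have "A $$ (b, a) = 0" using A2[OF a] by simp
      then show ?thesis using b0 by simp
    qed
    moreover have "i \<noteq> b \<Longrightarrow> A $$ (i, j) = 0" using z ij t[OF lt jb] by auto
    ultimately show ?thesis by auto
  qed
  have un': "I1 \<union> I2 = {..<dim_row A}" using un by simp
  have "\<forall>i\<in>I1. \<forall>j\<in>I2. A $$ (i, j) = 0 \<and> A $$ (j, i) = 0"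
  proof (intro ballI)
    fix i j assume ij: "i \<in> I1" "j \<in> I2"
    then have lt: "i < dim_row A" "j < dim_row A" using un' by auto
    have "A $$ (i, j) = 0 \<or> A $$ (j, i) = 0"
    proof (cases "b \<in> I1")
      case True
      then show ?thesis using split[OF dj un' True _ ij] z by auto
    next
      case False
      then have b2: "b \<in> I2" using b un' by auto
      have "I2 \<inter> I1 = {}" "I2 \<union> I1 = {..<dim_row A}" using dj un' by auto
      then show ?thesis using split[OF _ _ b2 _ ij(2,1)] z by auto
    qed
    then show "A $$ (i, j) = 0 \<and> A $$ (j, i) = 0" using A0 lt by auto
  qed
  then show False using ind ne dj un' unfolding indecomposable_def by blast
qed

section \<open>Positive definite generalized Cartan matrices\<close>

text \<open>Vertices may form any finite set, since the classification deletes vertices one after the other.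
  The numbers N are half the squared lengths, up to a common factor.\<close>

definition pd_gcm :: "nat set \<Rightarrow> (nat \<Rightarrow> nat \<Rightarrow> int) \<Rightarrow> (nat \<Rightarrow> int) \<Rightarrow> bool" where
  "pd_gcm I c N \<longleftrightarrow> finite I \<and> (\<forall>i\<in>I. N i > 0 \<and> c i i = 2) \<and>
     (\<forall>i\<in>I. \<forall>j\<in>I. i \<noteq> j \<longrightarrow> c i j \<le> 0) \<and> (\<forall>i\<in>I. \<forall>j\<in>I. N i * c i j = N j * c j i) \<and>
     (\<forall>x :: nat \<Rightarrow> real. (\<exists>i\<in>I. x i \<noteq> 0) \<longrightarrow>
        (\<Sum>i\<in>I. \<Sum>j\<in>I. of_int (N i * c i j) * x i * x j) > 0)"

lemma pd_gcmI:
  assumes "finite I" "\<And>i. i \<in> I \<Longrightarrow> N i > 0" "\<And>i. i \<in> I \<Longrightarrow> c i i = 2"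
    "\<And>i j. i \<in> I \<Longrightarrow> j \<in> I \<Longrightarrow> i \<noteq> j \<Longrightarrow> c i j \<le> 0"
    "\<And>i j. i \<in> I \<Longrightarrow> j \<in> I \<Longrightarrow> N i * c i j = N j * c j i"
    "\<And>x :: nat \<Rightarrow> real. \<exists>i\<in>I. x i \<noteq> 0 \<Longrightarrow>
        (\<Sum>i\<in>I. \<Sum>j\<in>I. of_int (N i * c i j) * x i * x j) > 0"
  shows "pd_gcm I c N"
  unfolding pd_gcm_def by (intro conjI ballI allI impI assms)

lemma pd_gcmD:
  assumes "pd_gcm I c N"
  shows "finite I" "i \<in> I \<Longrightarrow> N i > 0" "i \<in> I \<Longrightarrow> c i i = 2"
    "i \<in> I \<Longrightarrow> j \<in> I \<Longrightarrow> i \<noteq> j \<Longrightarrow> c i j \<le> 0"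
    "i \<in> I \<Longrightarrow> j \<in> I \<Longrightarrow> N i * c i j = N j * c j i"
    "i \<in> I \<Longrightarrow> (x :: nat \<Rightarrow> real) i \<noteq> 0 \<Longrightarrow>
        (\<Sum>i\<in>I. \<Sum>j\<in>I. of_int (N i * c i j) * x i * x j) > 0"
  using assms unfolding pd_gcm_def by blast+

lemma pd_gcm_subset:
  assumes "pd_gcm I c N" "J \<subseteq> I"
  shows "pd_gcm J c N"
proof -
  have fin: "finite I" using assms by (auto simp: pd_gcm_def)
  have "(\<Sum>i\<in>J. \<Sum>j\<in>J. of_int (N i * c i j) * x i * x j) > 0" if x: "\<exists>i\<in>J. x i \<noteq> 0" for x :: "nat \<Rightarrow> real"
  proof -
    define y where "y i = (if i \<in> J then x i else 0)" for i
    have "(\<Sum>i\<in>J. \<Sum>j\<in>J. of_int (N i * c i j) * x i * x j) = (\<Sum>i\<in>J. \<Sum>j\<in>J. of_int (N i * c i j) * y i * y j)"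
      by (intro sum.cong) (auto simp: y_def)
    also have "\<dots> = (\<Sum>i\<in>J. \<Sum>j\<in>I. of_int (N i * c i j) * y i * y j)"
      by (intro sum.cong refl sum.mono_neutral_left) (use assms fin in \<open>auto simp: y_def\<close>)
    also have "\<dots> = (\<Sum>i\<in>I. \<Sum>j\<in>I. of_int (N i * c i j) * y i * y j)"
      by (intro sum.mono_neutral_left) (use assms fin in \<open>auto simp: y_def\<close>)
    also have "\<dots> > 0"
    proof -
      have "\<exists>i\<in>I. y i \<noteq> 0" using x assms(2) by (auto simp: y_def)
      then show ?thesis using pd_gcmD(6)[OF assms(1)] by blast
    qed
    finally show ?thesis .
  qed
  moreover have "i \<in> I" if "i \<in> J" for i using assms(2) that by blast
  ultimately show ?thesis
    using finite_subset[OF assms(2) fin] by (intro pd_gcmI) (auto simp: pd_gcmD(2-4)[OF assms(1)] intro: pd_gcmD(5)[OF assms(1)])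
qed

lemma pd_gcm_reindex:
  assumes "pd_gcm I c N" "inj_on f J" "f ` J \<subseteq> I"
  shows "pd_gcm J (\<lambda>i j. c (f i) (f j)) (\<lambda>i. N (f i))"
proof -
  have pd: "pd_gcm (f ` J) c N" using assms by (rule_tac pd_gcm_subset)
  have "(\<Sum>i\<in>J. \<Sum>j\<in>J. of_int (N (f i) * c (f i) (f j)) * x i * x j) > 0"
    if x: "\<exists>i\<in>J. x i \<noteq> 0" for x :: "nat \<Rightarrow> real"
  proof -
    define y where "y = x \<circ> the_inv_into J f"
    have y: "y (f i) = x i" if "i \<in> J" for i using that assms by (simp add: y_def the_inv_into_f_f)
    have "(\<Sum>i\<in>f ` J. \<Sum>j\<in>f ` J. of_int (N i * c i j) * y i * y j) > 0"
    proof -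
      obtain i where "i \<in> J" "x i \<noteq> 0" using x by blast
      then show ?thesis using y[of i] by (intro pd_gcmD(6)[OF pd, of "f i"]) auto
    qed
    then show ?thesis using assms(2) by (simp add: sum.reindex y)
  qed
  moreover have "finite J" using assms pd_gcmD(1)[OF assms(1)] by (metis finite_imageD finite_subset)
  moreover have "f i \<noteq> f j" if "i \<in> J" "j \<in> J" "i \<noteq> j" for i j using that assms(2) by (auto simp: inj_on_def)
  ultimately show ?thesis
    by (intro pd_gcmI) (auto simp: pd_gcmD(2-4)[OF pd] intro: pd_gcmD(5)[OF pd])
qed

lemma pd_gcm_zero_iff:
  assumes "pd_gcm I c N" "i \<in> I" "j \<in> I"
  shows "c i j = 0 \<longleftrightarrow> c j i = 0"
  using pd_gcmD(2)[OF assms(1,2)] pd_gcmD(2)[OF assms(1,3)] pd_gcmD(5)[OF assms] by auto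

text \<open>Affine diagrams are recognised by their null roots. Since the condition only involves the
  matrix c, the lengths do not enter.\<close>

lemma pd_gcm_no_null_vector:
  fixes x :: "nat \<Rightarrow> int"
  assumes pd: "pd_gcm I c N" and J: "J \<subseteq> I" "j \<in> J" "x j \<noteq> 0"
    and null: "\<And>i. i \<in> J \<Longrightarrow> (\<Sum>j\<in>J. c i j * x j) = 0"
  shows False
proof -
  have "(\<Sum>i\<in>J. \<Sum>j\<in>J. of_int (N i * c i j) * real_of_int (x i) * real_of_int (x j)) > 0"
    using J by (intro pd_gcmD(6)[OF pd_gcm_subset[OF pd J(1)]]) auto
  moreover have "(\<Sum>i\<in>J. \<Sum>j\<in>J. of_int (N i * c i j) * real_of_int (x i) * real_of_int (x j)) =
     real_of_int (\<Sum>i\<in>J. N i * x i * (\<Sum>j\<in>J. c i j * x j))"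
    by (simp add: sum_distrib_left mult_ac)
  moreover have "(\<Sum>i\<in>J. N i * x i * (\<Sum>j\<in>J. c i j * x j)) = 0"
    by (intro sum.neutral) (simp add: null)
  ultimately show False by simp
qed

text \<open>The combinatorial core of the classification. Let P be a simply laced tree, so that
  \<open>\<alpha>\<^sub>P = \<Sum>\<^sub>p \<alpha>\<^sub>p\<close> is not longer than a single root of P. Subtracting from \<open>\<alpha>\<^sub>P\<close> its components along the
  neighbours \<open>\<alpha>\<^sub>u\<close> lowers the squared length by a quarter of the bond multiplicity for each u, in units of the squared
  length of a root in P. (That the
  \<open>\<alpha>\<^sub>u\<close> need not be orthogonal only helps, because their products are non-positive.) The result has
  positive length, so the multiplicities of the bonds that leave P add up to less than 4.

  For a single vertex this bounds its valency. For a path it rules out two branch points, a branch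
  point together with a multiple bond, and two multiple bonds, all at once.\<close>

lemma pd_gcm_bond_bound:
  assumes pd: "pd_gcm I c N" and P: "P \<subseteq> I" "P \<noteq> {}" and U: "U \<subseteq> I" "P \<inter> U = {}"
    and N0: "\<And>i. i \<in> P \<Longrightarrow> N i = N0" and tree: "(\<Sum>i\<in>P. \<Sum>j\<in>P. c i j) \<le> 2"
    and \<pi>: "\<And>u. u \<in> U \<Longrightarrow> \<pi> u \<in> P"
  shows "(\<Sum>u\<in>U. c (\<pi> u) u * c u (\<pi> u)) \<le> 3"
proof -
  have fin: "finite P" "finite U" using pd_gcmD(1)[OF pd] P U by (auto intro: finite_subset)
  have np: "c i j \<le> 0" if "i \<in> I" "j \<in> I" "i \<noteq> j" for i j using pd_gcmD[OF pd] that by blast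
  have Np: "N i > 0" if "i \<in> I" for i using pd_gcmD[OF pd] that by blast
  have sy: "N i * c i j = N j * c j i" if "i \<in> I" "j \<in> I" for i j using pd_gcmD[OF pd] that by blast
  define B where "B i j = real_of_int (N i * c i j)" for i j
  have Bs: "B i j = B j i" if "i \<in> I" "j \<in> I" for i j using sy that by (simp add: B_def)
  have Bn: "B i j \<le> 0" if "i \<in> I" "j \<in> I" "i \<noteq> j" for i j
    using np[OF that] Np[OF that(1)] by (simp add: B_def mult_nonneg_nonpos)
  \<comment> \<open>the coefficients of the component of \<open>\<alpha>\<^sub>P\<close> along \<open>\<alpha>\<^sub>u\<close>, negated\<close>
  define t where "t u = - real_of_int (c u (\<pi> u)) / 2" for u
  define x where "x i = (if i \<in> P then 1 else t i)" for i
  have piI: "\<pi> u \<in> I" "\<pi> u \<noteq> u" "u \<in> I" if "u \<in> U" for u using \<pi>[OF that] P U that by auto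
  have t0: "t u \<ge> 0" if "u \<in> U" for u using np[of u "\<pi> u"] piI[OF that] by (auto simp: t_def)
  have N0p: "N0 > 0" using P N0 Np by (metis ex_in_conv subsetD)
  obtain p where p: "p \<in> P" using P by blast
  have "0 < (\<Sum>i\<in>P \<union> U. \<Sum>j\<in>P \<union> U. B i j * x i * x j)"
  proof -
    have "\<exists>i\<in>P \<union> U. x i \<noteq> 0" using p by (auto simp: x_def)
    then show ?thesis
      using pd_gcmD(6)[OF pd_gcm_subset[OF pd, of "P \<union> U"]] P U unfolding B_def by blast
  qed
  also have "\<dots> = (\<Sum>i\<in>P. (\<Sum>j\<in>P. B i j * x i * x j) + (\<Sum>j\<in>U. B i j * x i * x j)) +
      (\<Sum>i\<in>U. (\<Sum>j\<in>P. B i j * x i * x j) + (\<Sum>j\<in>U. B i j * x i * x j))"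
    using fin U by (simp add: sum.union_disjoint)
  also have "\<dots> = (\<Sum>i\<in>P. \<Sum>j\<in>P. B i j) + (\<Sum>i\<in>P. \<Sum>j\<in>U. B i j * t j) +
      ((\<Sum>i\<in>U. \<Sum>j\<in>P. B i j * t i) + (\<Sum>i\<in>U. \<Sum>j\<in>U. B i j * t i * t j))"
  proof -
    have xu: "x u = t u" if "u \<in> U" for u using that U by (auto simp: x_def)
    have xp: "x u = 1" if "u \<in> P" for u using that by (auto simp: x_def)
    show ?thesis unfolding sum.distrib by (intro arg_cong2[of _ _ _ _ "(+)"] sum.cong refl) (simp_all add: xu xp)
  qed
  also have "(\<Sum>i\<in>P. \<Sum>j\<in>U. B i j * t j) = (\<Sum>i\<in>U. \<Sum>j\<in>P. B i j * t i)"
  proof (subst sum.swap, intro sum.cong refl)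
    fix u i assume "u \<in> U" "i \<in> P"
    then have "B i u = B u i" using P U by (intro Bs) auto
    then show "B i u * t u = B u i * t u" by simp
  qed
  also have "(\<Sum>i\<in>P. \<Sum>j\<in>P. B i j) = N0 * (\<Sum>i\<in>P. \<Sum>j\<in>P. c i j)"
    by (simp add: B_def N0 sum_distrib_left)
  also have "\<dots> \<le> 2 * N0" using tree N0p by (simp add: mult.commute flip: of_int_mult)
  also have "(\<Sum>i\<in>U. \<Sum>j\<in>P. B i j * t i) \<le> (\<Sum>u\<in>U. - 2 * N u * (t u)\<^sup>2)"
  proof (rule sum_mono)
    fix u assume u: "u \<in> U"
    have "(\<Sum>j\<in>P. B u j * t u) = B u (\<pi> u) * t u + (\<Sum>j\<in>P - {\<pi> u}. B u j * t u)"
      using fin \<pi>[OF u] by (intro sum.remove) auto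
    also have "(\<Sum>j\<in>P - {\<pi> u}. B u j * t u) \<le> 0"
    proof (intro sum_nonpos mult_nonpos_nonneg t0[OF u])
      fix j assume "j \<in> P - {\<pi> u}"
      then show "B u j \<le> 0" using P U u by (intro Bn) auto
    qed
    also have "B u (\<pi> u) * t u + 0 = - 2 * N u * (t u)\<^sup>2"
      by (simp add: B_def t_def power2_eq_square)
    finally show "(\<Sum>j\<in>P. B u j * t u) \<le> - 2 * N u * (t u)\<^sup>2" by simp
  qed
  also have "(\<Sum>i\<in>U. \<Sum>j\<in>U. B i j * t i * t j) \<le> (\<Sum>u\<in>U. 2 * N u * (t u)\<^sup>2)"
  proof (rule sum_mono)
    fix u assume u: "u \<in> U"
    have "(\<Sum>j\<in>U. B u j * t u * t j) = B u u * t u * t u + (\<Sum>j\<in>U - {u}. B u j * t u * t j)"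
      using fin u by (intro sum.remove) auto
    also have "(\<Sum>j\<in>U - {u}. B u j * t u * t j) \<le> 0"
    proof (intro sum_nonpos mult_nonpos_nonneg t0[OF u])
      fix j assume j: "j \<in> U - {u}"
      then show "B u j \<le> 0" using U u by (intro Bn) auto
      show "t j \<ge> 0" using j t0 by auto
    qed
    also have "B u u * t u * t u + 0 = 2 * N u * (t u)\<^sup>2"
      using pd_gcmD(3)[OF pd] piI[OF u] by (simp add: B_def power2_eq_square)
    finally show "(\<Sum>j\<in>U. B u j * t u * t j) \<le> 2 * N u * (t u)\<^sup>2" by simp
  qed
  finally have *: "0 < 2 * N0 + (\<Sum>u\<in>U. - 2 * N u * (t u)\<^sup>2)"
    by (simp add: sum_negf)
  also have "(\<Sum>u\<in>U. - 2 * N u * (t u)\<^sup>2) = (\<Sum>u\<in>U. - (N0 / 2) * (c (\<pi> u) u * c u (\<pi> u)))"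
  proof (intro sum.cong refl)
    fix u assume u: "u \<in> U"
    have "N u * c u (\<pi> u) = N0 * c (\<pi> u) u" using sy[of u "\<pi> u"] piI[OF u] N0[OF \<pi>[OF u]] by simp
    then have "real_of_int (N u) * c u (\<pi> u) = N0 * c (\<pi> u) u" by (metis of_int_mult)
    then have "real_of_int (N u) * c u (\<pi> u) * c u (\<pi> u) = N0 * (c (\<pi> u) u * c u (\<pi> u))" by simp
    then show "- 2 * N u * (t u)\<^sup>2 = - (N0 / 2) * (c (\<pi> u) u * c u (\<pi> u))"
      by (simp add: t_def power2_eq_square)
  qed
  also have "\<dots> = - (N0 / 2) * (\<Sum>u\<in>U. c (\<pi> u) u * c u (\<pi> u))"
    by (simp add: sum_distrib_left)
  finally have "(real_of_int N0 / 2) * (4 - (\<Sum>u\<in>U. c (\<pi> u) u * c u (\<pi> u))) > 0"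
    by (simp add: algebra_simps)
  then have "4 - real_of_int (\<Sum>u\<in>U. c (\<pi> u) u * c u (\<pi> u)) > 0"
    using N0p by (simp add: zero_less_mult_iff)
  then show ?thesis by linarith
qed

text \<open>The list us collects bonds (u, p) from a vertex u outside the path a, ..., b to a vertex p of it.\<close>

lemma pd_gcm_bond_bound_interval:
  assumes pd: "pd_gcm I c N" and ab: "a \<le> b" "{a..b} \<subseteq> I"
    and ch: "\<And>i. a \<le> i \<Longrightarrow> i < b \<Longrightarrow> c i (Suc i) = -1 \<and> c (Suc i) i = -1"
    and d: "distinct (map fst us)" and us: "\<And>u p. (u, p) \<in> set us \<Longrightarrow> u \<in> I - {a..b} \<and> p \<in> {a..b}"
  shows "(\<Sum>(u, p)\<leftarrow>us. c p u * c u p) \<le> 3"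
proof -
  have N: "N i = N a" if "a \<le> i" "i \<le> b" for i
    using that
  proof (induction i rule: dec_induct)
    case (step i)
    then have "N i * c i (Suc i) = N (Suc i) * c (Suc i) i"
      using step ab by (intro pd_gcmD(5)[OF pd]) auto
    then show ?case using step ch[of i] by simp
  qed auto
  have tree: "(\<Sum>i\<in>{a..k}. \<Sum>j\<in>{a..k}. c i j) \<le> 2" if "a \<le> k" "k \<le> b" for k
    using that
  proof (induction k rule: dec_induct)
    case base
    then show ?case using pd_gcmD(3)[OF pd, of a] ab by auto
  next
    case (step k)
    have np: "c i j \<le> 0" if "i \<in> {a..b}" "j \<in> {a..b}" "i \<noteq> j" for i j
      using that ab by (intro pd_gcmD(4)[OF pd]) auto
    have s: "{a..Suc k} = insert (Suc k) {a..k}" using step by auto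
    have 1: "(\<Sum>i\<in>{a..k}. c i (Suc k)) \<le> -1"
    proof -
      have "(\<Sum>i\<in>{a..k}. c i (Suc k)) = c k (Suc k) + (\<Sum>i\<in>{a..k} - {k}. c i (Suc k))"
        using step by (intro sum.remove) auto
      moreover have "(\<Sum>i\<in>{a..k} - {k}. c i (Suc k)) \<le> 0"
        using step by (intro sum_nonpos np) auto
      ultimately show ?thesis using ch[of k] step by simp
    qed
    have 2: "(\<Sum>i\<in>{a..k}. c (Suc k) i) \<le> -1"
    proof -
      have "(\<Sum>i\<in>{a..k}. c (Suc k) i) = c (Suc k) k + (\<Sum>i\<in>{a..k} - {k}. c (Suc k) i)"
        using step by (intro sum.remove) auto
      moreover have "(\<Sum>i\<in>{a..k} - {k}. c (Suc k) i) \<le> 0"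
        using step by (intro sum_nonpos np) auto
      ultimately show ?thesis using ch[of k] step by simp
    qed
    have 3: "c (Suc k) (Suc k) = 2" using ab step by (intro pd_gcmD(3)[OF pd]) auto
    show ?case unfolding s using 1 2 3 step by (simp add: sum.distrib)
  qed
  let ?U = "set (map fst us)"
  let ?\<pi> = "\<lambda>u. the (map_of us u)"
  have m: "map_of us u = Some p" if "(u, p) \<in> set us" for u p using that d by simp
  have "(\<Sum>u\<in>?U. c (?\<pi> u) u * c u (?\<pi> u)) \<le> 3"
  proof (rule pd_gcm_bond_bound[OF pd ab(2), of _ "N a"])
    show "?U \<subseteq> I" "{a..b} \<inter> ?U = {}" using us by auto
    show "(\<Sum>i = a..b. \<Sum>j = a..b. c i j) \<le> 2" using tree[of b] ab by simp
    show "?\<pi> u \<in> {a..b}" if "u \<in> ?U" for u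
    proof -
      from that obtain p where "(u, p) \<in> set us" by auto
      then show ?thesis using m us by force
    qed
    show "N i = N a" if "i \<in> {a..b}" for i using that by (intro N) auto
  qed (use ab in auto)
  also have "(\<Sum>u\<in>?U. c (?\<pi> u) u * c u (?\<pi> u)) = (\<Sum>u\<leftarrow>map fst us. c (?\<pi> u) u * c u (?\<pi> u))"
    using d by (rule sum.distinct_set_conv_list)
  also have "\<dots> = (\<Sum>(u, p)\<leftarrow>us. c p u * c u p)"
    unfolding map_map by (intro arg_cong[of _ _ sum_list] map_cong refl) (auto simp: m)
  finally show ?thesis .
qed

definition conn :: "nat set \<Rightarrow> (nat \<Rightarrow> nat \<Rightarrow> int) \<Rightarrow> bool" where
  "conn I c \<longleftrightarrow> \<not> (\<exists>I1 I2. I1 \<noteq> {} \<and> I2 \<noteq> {} \<and> I1 \<inter> I2 = {} \<and> I1 \<union> I2 = I \<and>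
     (\<forall>i\<in>I1. \<forall>j\<in>I2. c i j = 0 \<and> c j i = 0))"

lemma connD:
  assumes "conn I c" "I1 \<noteq> {}" "I2 \<noteq> {}" "I1 \<inter> I2 = {}" "I1 \<union> I2 = I"
    "\<And>i j. i \<in> I1 \<Longrightarrow> j \<in> I2 \<Longrightarrow> c i j = 0 \<and> c j i = 0"
  shows False
proof -
  have "I1 \<noteq> {} \<and> I2 \<noteq> {} \<and> I1 \<inter> I2 = {} \<and> I1 \<union> I2 = I \<and> (\<forall>i\<in>I1. \<forall>j\<in>I2. c i j = 0 \<and> c j i = 0)"
    using assms(2-6) by simp
  then have "\<exists>I1 I2. I1 \<noteq> {} \<and> I2 \<noteq> {} \<and> I1 \<inter> I2 = {} \<and> I1 \<union> I2 = I \<and> (\<forall>i\<in>I1. \<forall>j\<in>I2. c i j = 0 \<and> c j i = 0)"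
    by (intro exI[of _ I1] exI[of _ I2])
  then show False using assms(1) unfolding conn_def by (rule notE[rotated])
qed

text \<open>Let \<open>e\<^sub>i\<close> be the normalised roots. Every bond contributes at most \<open>-1\<close> to \<open>|\<Sum>\<^sub>i e\<^sub>i|\<^sup>2 > 0\<close>, so there are
  fewer bonds than vertices and some vertex has at most one bond.\<close>

lemma pd_gcm_leaf:
  assumes pd: "pd_gcm I c N" and cn: "conn I c" and I2: "card I \<ge> 2"
  obtains n p where "n \<in> I" "p \<in> I" "p \<noteq> n" "c n p < 0" "c p n < 0"
    "\<And>q. q \<in> I \<Longrightarrow> q \<noteq> n \<Longrightarrow> q \<noteq> p \<Longrightarrow> c n q = 0 \<and> c q n = 0"
    "conn (I - {n}) c"
proof -
  have fin: "finite I" using pd by (auto simp: pd_gcm_def)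
  define nb where "nb i = {j \<in> I. j \<noteq> i \<and> c i j \<noteq> 0}" for i
  have fnb: "finite (nb i)" for i using fin by (simp add: nb_def)
  have Np: "N i > 0" if "i \<in> I" for i using pd_gcmD[OF pd] that by blast
  have sy: "N i * c i j = N j * c j i" if "i \<in> I" "j \<in> I" for i j using pd_gcmD[OF pd] that by blast
  have np: "c i j \<le> 0" if "i \<in> I" "j \<in> I" "i \<noteq> j" for i j using pd_gcmD[OF pd] that by blast
  define x where "x i = 1 / sqrt (real_of_int (N i))" for i
  define t where "t i j = of_int (N i * c i j) * x i * x j" for i j
  have tii: "t i i = 2" if "i \<in> I" for i
    using pd_gcmD(3)[OF pd that] Np[OF that] by (simp add: t_def x_def)
  have tn: "t i j \<le> -1" if "i \<in> I" "j \<in> nb i" for i j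
  proof -
    have j: "j \<in> I" "j \<noteq> i" "c i j \<noteq> 0" using that by (auto simp: nb_def)
    have neg: "c i j \<le> -1" "c j i \<le> -1"
      using np[of i j] np[of j i] j that(1) pd_gcm_zero_iff[OF pd that(1) j(1)] by auto
    have "t i j * t i j = t i j * (of_int (N j * c j i) * x i * x j)"
      unfolding t_def sy[OF that(1) j(1)] by simp
    also have "\<dots> = real_of_int (c i j * c j i) * (of_int (N i) * (x i)\<^sup>2) * (of_int (N j) * (x j)\<^sup>2)"
      by (simp add: t_def power2_eq_square)
    also have "\<dots> = real_of_int (c i j * c j i)"
      using Np[OF that(1)] Np[OF j(1)] by (simp add: x_def power_divide)
    also have "\<dots> \<ge> 1"
    proof -
      have "1 * 1 \<le> (- c i j) * (- c j i)" using neg by (intro mult_mono) auto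
      then show ?thesis by (simp flip: of_int_mult)
    qed
    finally have "t i j * t i j \<ge> 1" .
    moreover have "t i j \<le> 0"
    proof -
      have "real_of_int (N i * c i j) \<le> 0"
        using neg Np[OF that(1)] by (simp add: mult_nonneg_nonpos)
      moreover have "x i \<ge> 0" "x j \<ge> 0" using Np[OF that(1)] Np[OF j(1)] by (auto simp: x_def)
      ultimately show ?thesis unfolding t_def by (intro mult_nonpos_nonneg)
    qed
    ultimately show ?thesis
      by (smt (verit) mult_le_cancel_right1 mult_less_cancel_left1 minus_mult_minus)
  qed
  have "\<exists>n\<in>I. card (nb n) < 2"
  proof (rule ccontr)
    assume "\<not> ?thesis"
    then have deg: "card (nb n) \<ge> 2" if "n \<in> I" for n using that by auto
    obtain i0 where "i0 \<in> I" using I2 by fastforce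
    then have "x i0 \<noteq> 0" using Np[of i0] by (simp add: x_def)
    then have "0 < (\<Sum>i\<in>I. \<Sum>j\<in>I. t i j)"
      unfolding t_def by (rule pd_gcmD(6)[OF pd \<open>i0 \<in> I\<close>])
    also have "\<dots> \<le> (\<Sum>i\<in>I. 0)"
    proof (rule sum_mono)
      fix i assume i: "i \<in> I"
      have "(\<Sum>j\<in>I. t i j) = (\<Sum>j\<in>insert i (nb i). t i j)"
        by (rule sum.mono_neutral_right) (use fin i in \<open>auto simp: nb_def t_def\<close>)
      also have "\<dots> = t i i + (\<Sum>j\<in>nb i. t i j)" using fnb by (simp add: nb_def)
      also have "(\<Sum>j\<in>nb i. t i j) \<le> (\<Sum>j\<in>nb i. -1)" using tn[OF i] by (intro sum_mono) auto
      also have "(\<Sum>j\<in>nb i. - 1 :: real) \<le> -2" using deg[OF i] by simp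
      finally show "(\<Sum>j\<in>I. t i j) \<le> 0" using tii[OF i] by simp
    qed
    finally show False by simp
  qed
  then obtain n where n: "n \<in> I" "card (nb n) < 2" by blast
  have "nb n \<noteq> {}"
  proof
    assume e: "nb n = {}"
    have "I - {n} \<noteq> {}" 
    proof -
      have "card (I - {n}) \<ge> 1" using I2 n fin by simp
      then show ?thesis by (metis card.empty not_one_le_zero)
    qed
    moreover have "\<forall>i\<in>{n}. \<forall>j\<in>I - {n}. c i j = 0 \<and> c j i = 0"
      using e n pd_gcm_zero_iff[OF pd] by (auto simp: nb_def)
    moreover have "{n} \<union> (I - {n}) = I" using n by auto
    ultimately show False by (intro connD[OF cn, of "{n}" "I - {n}"]) auto
  qed
  then have "card (nb n) = 1" using n fnb[of n] by (metis card_0_eq less_2_cases One_nat_def)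
  then obtain p where p: "nb n = {p}" by (auto simp: card_1_singleton_iff)
  then have pI: "p \<in> I" "p \<noteq> n" "c n p \<noteq> 0" by (auto simp: nb_def)
  have oth: "c n q = 0 \<and> c q n = 0" if "q \<in> I" "q \<noteq> n" "q \<noteq> p" for q
    using p that pd_gcm_zero_iff[OF pd n(1) that(1)] by (auto simp: nb_def)
  have "conn (I - {n}) c"
    unfolding conn_def
  proof (rule notI, elim exE conjE)
    fix I1 I2 assume h: "I1 \<noteq> {}" "I2 \<noteq> {}" "I1 \<inter> I2 = {}" "I1 \<union> I2 = I - {n}"
      "\<forall>i\<in>I1. \<forall>j\<in>I2. c i j = 0 \<and> c j i = 0"
    have *: False if h: "J1 \<noteq> {}" "J2 \<noteq> {}" "J1 \<inter> J2 = {}" "J1 \<union> J2 = I - {n}"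
      "\<forall>i\<in>J1. \<forall>j\<in>J2. c i j = 0 \<and> c j i = 0" "p \<in> J1" for J1 J2
    proof -
      have "insert n J1 \<inter> J2 = {}" "insert n J1 \<union> J2 = I" using h n by auto
      moreover have "\<forall>i\<in>insert n J1. \<forall>j\<in>J2. c i j = 0 \<and> c j i = 0"
      proof (intro ballI)
        fix i j assume ij: "i \<in> insert n J1" "j \<in> J2"
        then have "j \<in> I" "j \<noteq> n" "j \<noteq> p" using h by auto
        then show "c i j = 0 \<and> c j i = 0" using ij h(5) oth by auto
      qed
      ultimately show False by (intro connD[OF cn, of "insert n J1" J2] h(2)) auto
    qed
    have "p \<in> I1 \<or> p \<in> I2" using h pI by auto
    then show False
    proof
      assume "p \<in> I1" then show False by (rule *[OF h])
    next
      assume "p \<in> I2"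
      moreover have "I2 \<inter> I1 = {}" "I2 \<union> I1 = I - {n}" "\<forall>i\<in>I2. \<forall>j\<in>I1. c i j = 0 \<and> c j i = 0"
        using h by auto
      ultimately show False using h(1,2) *[of I2 I1] by simp
    qed
  qed
  moreover have "c n p < 0" "c p n < 0"
    using np[OF n(1) pI(1)] np[OF pI(1) n(1)] pI pd_gcm_zero_iff[OF pd n(1) pI(1)] by auto
  ultimately show ?thesis by (intro that[OF n(1) pI(1,2) _ _ oth])
qed

section \<open>Classification of connected positive definite matrices\<close>

definition has_shape :: "nat set \<Rightarrow> (nat \<Rightarrow> nat \<Rightarrow> int) \<Rightarrow> nat \<Rightarrow> (nat \<Rightarrow> nat \<Rightarrow> int) \<Rightarrow> bool" where
  "has_shape I c m s \<longleftrightarrow> (\<exists>f. bij_betw f {..<m} I \<and> (\<forall>i<m. \<forall>j<m. c (f i) (f j) = s i j))"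

text \<open>A chain \<open>0 - 1 - 2 - \<dots>\<close> whose only possibly multiple bond joins r and \<open>r + 1\<close> and has the entries
  \<open>-u\<close> and \<open>-w\<close>.\<close>

definition bond_chain :: "nat \<Rightarrow> int \<Rightarrow> int \<Rightarrow> nat \<Rightarrow> nat \<Rightarrow> int" where
  "bond_chain r u w i j = (if i = j then 2
     else if j = Suc i then (if i = r then - u else -1)
     else if i = Suc j then (if j = r then - w else -1) else 0)"

text \<open>A chain on the vertices below \<open>m - 1\<close> with the last vertex attached to r. Besides the diagrams of type
  D and E, this covers the chain of type A as the case \<open>r = m - 2\<close>.\<close>

definition fork :: "nat \<Rightarrow> nat \<Rightarrow> nat \<Rightarrow> nat \<Rightarrow> int" where
  "fork m r i j = (if i = j then 2
     else if j = Suc i \<and> Suc j < m \<or> i = Suc j \<and> Suc i < m \<or>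
       i = r \<and> Suc j = m \<or> j = r \<and> Suc i = m then -1 else 0)"

definition add_leaf :: "(nat \<Rightarrow> nat \<Rightarrow> int) \<Rightarrow> nat \<Rightarrow> nat \<Rightarrow> int \<Rightarrow> int \<Rightarrow> nat \<Rightarrow> nat \<Rightarrow> int" where
  "add_leaf s m p y z i j = (if i < m \<and> j < m then s i j else if i = j then 2
     else if i = m then (if j = p then - z else 0) else if i = p then - y else 0)"

text \<open>The shapes that are closed under adding a leaf as long as positive definiteness is maintained. They
  include diagrams that are too large to be positive definite; these are excluded at the end only.
  A fork with \<open>r = 0\<close> is a chain as well; it is represented by its renumbering with \<open>r + 2 = m\<close>.\<close>

definition good_shape :: "nat \<Rightarrow> (nat \<Rightarrow> nat \<Rightarrow> int) \<Rightarrow> bool" where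
  "good_shape m s \<longleftrightarrow> (\<exists>r. s = fork m r \<and> (m = 1 \<and> r = 0 \<or> m \<ge> 2 \<and> r + 2 = m \<or> 1 \<le> r \<and> r + 3 \<le> m)) \<or>
     (\<exists>r u w. s = bond_chain r u w \<and> r + 2 \<le> m \<and> u > 0 \<and> w > 0 \<and> u * w \<ge> 2)"

lemma bij_betw_lessThanI:
  assumes "\<And>i. i < m \<Longrightarrow> g i < (m::nat)" "\<And>i. i < m \<Longrightarrow> h i < m \<and> g (h i) = i"
  shows "bij_betw g {..<m} {..<m}"
proof -
  have "g ` {..<m} = {..<m}" using assms by force
  then show ?thesis by (simp add: bij_betw_def eq_card_imp_inj_on)
qed

lemma has_shape_reindex:
  assumes "has_shape I c m s" "bij_betw g {..<m} {..<m}"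
    "\<And>i j. i < m \<Longrightarrow> j < m \<Longrightarrow> s (g i) (g j) = s' i j"
  shows "has_shape I c m s'"
proof -
  obtain f where f: "bij_betw f {..<m} I" "\<forall>i<m. \<forall>j<m. c (f i) (f j) = s i j"
    using assms(1) unfolding has_shape_def by blast
  have g: "g i < m" if "i < m" for i using bij_betwE[OF assms(2)] that by auto
  show ?thesis unfolding has_shape_def
    using bij_betw_trans[OF assms(2) f(1)] f(2) g assms(3) by (intro exI[of _ "f \<circ> g"]) auto
qed

lemma has_shape_pd:
  assumes "has_shape I c m s" "pd_gcm I c N"
  shows "\<exists>N'. pd_gcm {..<m} s N'"
proof -
  obtain f where f: "bij_betw f {..<m} I" "\<forall>i<m. \<forall>j<m. c (f i) (f j) = s i j"
    using assms(1) unfolding has_shape_def by blast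
  have pd: "pd_gcm {..<m} (\<lambda>i j. c (f i) (f j)) (\<lambda>i. N (f i))"
    using f(1) by (intro pd_gcm_reindex[OF assms(2)]) (auto simp: bij_betw_def)
  have "pd_gcm {..<m} s (\<lambda>i. N (f i))"
  proof (rule pd_gcmI)
    fix x :: "nat \<Rightarrow> real" assume "\<exists>i\<in>{..<m}. x i \<noteq> 0"
    then obtain i where "i \<in> {..<m}" "x i \<noteq> 0" by blast
    then have "(\<Sum>i<m. \<Sum>j<m. of_int (N (f i) * c (f i) (f j)) * x i * x j) > 0"
      by (rule pd_gcmD(6)[OF pd])
    also have "(\<Sum>i<m. \<Sum>j<m. of_int (N (f i) * c (f i) (f j)) * x i * x j) =
      (\<Sum>i<m. \<Sum>j<m. of_int (N (f i) * s i j) * x i * x j)"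
      using f(2) by (intro sum.cong refl) auto
    finally show "(\<Sum>i<m. \<Sum>j<m. of_int (N (f i) * s i j) * x i * x j) > 0" .
  qed (use pd_gcmD[OF pd] f(2) in fastforce)+
  then show ?thesis by blast
qed

lemma has_shape_add_leaf:
  assumes sh: "has_shape (I - {n}) c m s" and n: "n \<in> I" and p: "p \<in> I" "p \<noteq> n"
    and cn: "c n n = 2" and oth: "\<And>q. q \<in> I \<Longrightarrow> q \<noteq> n \<Longrightarrow> q \<noteq> p \<Longrightarrow> c n q = 0 \<and> c q n = 0"
  shows "\<exists>k<m. has_shape I c (Suc m) (add_leaf s m k (- c p n) (- c n p))"
proof -
  obtain f where f: "bij_betw f {..<m} (I - {n})" "\<forall>i<m. \<forall>j<m. c (f i) (f j) = s i j"
    using sh unfolding has_shape_def by blast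
  obtain k where k: "k < m" "f k = p" using f(1) p unfolding bij_betw_def
    by (metis (no_types, lifting) DiffI imageE insertE emptyE lessThan_iff)
  define g where "g = f(m := n)"
  have fI: "f i \<in> I" "f i \<noteq> n" if "i < m" for i using f(1) that unfolding bij_betw_def by auto
  have fp: "f i = p \<longleftrightarrow> i = k" if "i < m" for i
    using f(1) k that unfolding bij_betw_def inj_on_def by auto
  have "bij_betw g (insert m {..<m}) (insert n (I - {n}))"
  proof -
    have "bij_betw g {..<m} (I - {n})" using f(1) by (rule bij_betw_cong[THEN iffD1, rotated]) (simp add: g_def)
    then show ?thesis using notIn_Un_bij_betw[of m "{..<m}" g "I - {n}"] by (simp add: g_def)
  qed
  moreover have "insert m {..<m} = {..<Suc m}" by auto
  moreover have "insert n (I - {n}) = I" using n by auto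
  ultimately have "bij_betw g {..<Suc m} I" by simp
  moreover have "c (g i) (g j) = add_leaf s m k (- c p n) (- c n p) i j" if ij: "i < Suc m" "j < Suc m" for i j
  proof -
    consider "i < m" "j < m" | "i = m" "j = m" | "i < m" "j = m" | "i = m" "j < m"
      using ij less_antisym by blast
    then show ?thesis
    proof cases
      case 3 then show ?thesis using oth[of "f i"] fI[of i] fp[of i] k by (auto simp: g_def add_leaf_def)
    next
      case 4 then show ?thesis using oth[of "f j"] fI[of j] fp[of j] k by (auto simp: g_def add_leaf_def)
    qed (use f(2) cn in \<open>auto simp: g_def add_leaf_def\<close>)
  qed
  ultimately show ?thesis unfolding has_shape_def using k(1) by blast
qed

lemma good_shape_fork: "m = 1 \<and> r = 0 \<or> m \<ge> 2 \<and> r + 2 = m \<or> 1 \<le> r \<and> r + 3 \<le> m \<Longrightarrow> good_shape m (fork m r)"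
  by (auto simp: good_shape_def)

lemma good_shape_bond_chain: "r + 2 \<le> m \<Longrightarrow> u > 0 \<Longrightarrow> w > 0 \<Longrightarrow> u * w \<ge> 2 \<Longrightarrow> good_shape m (bond_chain r u w)"
  by (auto simp: good_shape_def)

lemma has_good_shapeI:
  assumes "has_shape I c m t" "bij_betw g {..<m} {..<m}"
    "\<And>i j. i < m \<Longrightarrow> j < m \<Longrightarrow> t (g i) (g j) = s' i j" "good_shape m s'"
  shows "\<exists>s. good_shape m s \<and> has_shape I c m s"
  using has_shape_reindex[OF assms(1-3)] assms(4) by blast

text \<open>For contradictions, the bound is used with k = 4.\<close>

lemma interval_bound:
  assumes "pd_gcm {..<n} c N" "a \<le> b" "b < n"
    and "\<And>i. a \<le> i \<Longrightarrow> i < b \<Longrightarrow> c i (Suc i) = -1 \<and> c (Suc i) i = -1"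
    and "distinct (map fst us)" and "list_all (\<lambda>(u, p). u < n \<and> (u < a \<or> b < u) \<and> a \<le> p \<and> p \<le> b) us"
    and "k \<le> (\<Sum>(u, p)\<leftarrow>us. c p u * c u p)"
  shows "k \<le> 3"
proof -
  have "(\<Sum>(u, p)\<leftarrow>us. c p u * c u p) \<le> 3"
    by (rule pd_gcm_bond_bound_interval[OF assms(1,2) _ assms(4,5)])
      (use assms(3,6) in \<open>auto simp: list_all_iff\<close>)
  then show ?thesis using assms(7) by simp
qed

text \<open>The path from p to the multiple bond already has this bond leaving it. A multiple new bond, or a
  third neighbour of p, would bring the multiplicities up to 4.\<close>

lemma add_leaf_bond_chain:
  assumes sh: "has_shape I c (Suc m) (add_leaf (bond_chain r u w) m p y z)" and pd: "pd_gcm I c N"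
    and p: "p < m" and r: "r + 2 \<le> m" and uw: "u > 0" "w > 0" "u * w \<ge> 2" and yz: "y > 0" "z > 0"
  shows "\<exists>s. good_shape (Suc m) s \<and> has_shape I c (Suc m) s"
proof -
  obtain N' where pd': "pd_gcm {..<Suc m} (add_leaf (bond_chain r u w) m p y z) N'"
    using has_shape_pd[OF sh pd] by blast
  have yz1: "y * z \<ge> 1" using yz by (metis int_one_le_iff_zero_less mult_pos_pos)
  have one: "y * z = 1 \<Longrightarrow> y = 1 \<and> z = 1" using yz by (metis pos_zmult_eq_1_iff mult.commute)
  have ple: "y * z + u * w \<le> 3" if "p \<le> r"
    by (rule interval_bound[OF pd', of p r "[(m, p), (Suc r, r)]"])
      (use that p r in \<open>auto simp: add_leaf_def bond_chain_def mult.commute\<close>)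
  have pge: "y * z + u * w \<le> 3" if "Suc r \<le> p"
    by (rule interval_bound[OF pd', of "Suc r" p "[(m, p), (r, Suc r)]"])
      (use that p r in \<open>auto simp: add_leaf_def bond_chain_def mult.commute\<close>)
  have "y * z = 1" using ple pge uw yz1 by linarith
  then have yz: "y = 1" "z = 1" using one by auto
  have ends: "p = 0 \<or> Suc p = m"
  proof (rule ccontr)
    assume np: "\<not> ?thesis"
    show False
    proof (cases "p \<le> r")
      case True
      have "4 \<le> (3::int)"
        by (rule interval_bound[OF pd', of p r "[(m, p), (Suc r, r), (p - 1, p)]"])
          (use True np p r uw yz in \<open>auto simp: add_leaf_def bond_chain_def mult.commute\<close>)
      then show False by simp
    next
      case False
      have "4 \<le> (3::int)"
        by (rule interval_bound[OF pd', of "Suc r" p "[(m, p), (r, Suc r), (Suc p, p)]"])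
          (use False np p r uw yz in \<open>auto simp: add_leaf_def bond_chain_def mult.commute\<close>)
      then show False by simp
    qed
  qed
  show ?thesis
  proof (cases "Suc p = m")
    case True
    show ?thesis
      by (rule has_good_shapeI[OF sh, of id _, of "bond_chain r u w"])
        (use True yz r uw in \<open>auto simp: add_leaf_def bond_chain_def good_shape_fork good_shape_bond_chain\<close>)
  next
    case False
    then have p0: "p = 0" using ends by simp
    show ?thesis
    proof (rule has_good_shapeI[OF sh])
      show "bij_betw (\<lambda>i. if i = 0 then m else i - 1) {..<Suc m} {..<Suc m}"
        by (rule bij_betw_lessThanI[of _ _ "\<lambda>i. if i = m then 0 else Suc i"]) auto
      show "add_leaf (bond_chain r u w) m p y z (if i = 0 then m else i - 1) (if j = 0 then m else j - 1) = bond_chain (Suc r) u w i j"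
        if "i < Suc m" "j < Suc m" for i j
        using that p0 yz r by (cases i; cases j) (auto simp: add_leaf_def bond_chain_def)
      show "good_shape (Suc m) (bond_chain (Suc r) u w)" using r uw by (auto simp: good_shape_fork good_shape_bond_chain)
    qed
  qed
qed


text \<open>To a chain, a simple bond can be added anywhere and a multiple one only at the ends. Now let r be a
  proper branch point. The path from r to p is left by two bonds at r and by the new
  bond, so the new bond is simple and p has no further neighbour: the leaf extends one of the three
  arms. An extension of the chain gives a fork again. Extending the short arm gives a fork only if one
  of the other arms has length one and can take over its part; otherwise the diagram contains the affine diagram
  \<open>E\<^sub>6\<^sup>(\<^sup>1\<^sup>)\<close>.\<close>

lemma add_leaf_fork:
  assumes sh: "has_shape I c (Suc m) (add_leaf (fork m r) m p y z)" and pd: "pd_gcm I c N"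
    and p: "p < m" and r: "m = 1 \<and> r = 0 \<or> m \<ge> 2 \<and> r + 2 = m \<or> 1 \<le> r \<and> r + 3 \<le> m" and yz: "y > 0" "z > 0"
  shows "\<exists>s. good_shape (Suc m) s \<and> has_shape I c (Suc m) s"
proof -
  obtain N' where pd': "pd_gcm {..<Suc m} (add_leaf (fork m r) m p y z) N'"
    using has_shape_pd[OF sh pd] by blast
  have yz1: "y * z \<ge> 1" using yz by (metis int_one_le_iff_zero_less mult_pos_pos)
  have one: "y * z = 1 \<Longrightarrow> y = 1 \<and> z = 1" using yz by (metis pos_zmult_eq_1_iff mult.commute)
  note defs = add_leaf_def fork_def mult.commute
  consider "m = 1" | "m \<ge> 2" "r + 2 = m" | "1 \<le> r" "r + 3 \<le> m" using r by blast
  then show ?thesis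
  proof cases
    case 1
    then have p0: "p = 0" using p by simp
    show ?thesis
    proof (cases "y * z = 1")
      case True
      then have "y = 1" "z = 1" using one by auto
      then show ?thesis
        by (intro has_good_shapeI[OF sh, of id "fork (Suc m) 0"])
          (use 1 p0 in \<open>auto simp: defs good_shape_fork good_shape_bond_chain less_Suc_eq\<close>)
    next
      case False
      then have "y * z \<ge> 2" using yz1 by simp
      then show ?thesis
        by (intro has_good_shapeI[OF sh, of id "bond_chain 0 y z"])
          (use 1 p0 yz in \<open>auto simp: defs bond_chain_def good_shape_fork good_shape_bond_chain less_Suc_eq\<close>)
    qed
  next
    case 2
    show ?thesis
    proof (cases "y * z = 1")
      case True
      then have yz': "y = 1" "z = 1" using one by auto
      show ?thesis
      proof (cases "p = 0")
        case True
        show ?thesis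
        proof (rule has_good_shapeI[OF sh])
          show "bij_betw (\<lambda>i. if i = 0 then m else i - 1) {..<Suc m} {..<Suc m}"
            by (rule bij_betw_lessThanI[of _ _ "\<lambda>i. if i = m then 0 else Suc i"]) auto
          show "add_leaf (fork m r) m p y z (if i = 0 then m else i - 1) (if j = 0 then m else j - 1) = fork (Suc m) (Suc r) i j"
            if "i < Suc m" "j < Suc m" for i j
            using that True yz' 2 by (cases i; cases j) (auto simp: add_leaf_def fork_def)
          show "good_shape (Suc m) (fork (Suc m) (Suc r))" using 2 by (auto simp: good_shape_fork good_shape_bond_chain)
        qed
      next
        case False
        then show ?thesis
          by (intro has_good_shapeI[OF sh, of id "fork (Suc m) p"])
            (use 2 p yz' in \<open>auto simp: defs intro!: good_shape_fork\<close>)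
      qed
    next
      case False
      then have yz2: "y * z \<ge> 2" using yz1 by simp
      have "p = 0 \<or> Suc p = m"
      proof (rule ccontr)
        assume np: "\<not> ?thesis"
        have "4 \<le> (3::int)"
          by (rule interval_bound[OF pd', of p p "[(m, p), (Suc p, p), (p - 1, p)]"])
            (use np p 2 yz2 in \<open>auto simp: defs\<close>)
        then show False by simp
      qed
      then show ?thesis
      proof
        assume p0: "p = 0"
        show ?thesis
        proof (rule has_good_shapeI[OF sh])
          show "bij_betw (\<lambda>i. if i = 0 then m else i - 1) {..<Suc m} {..<Suc m}"
            by (rule bij_betw_lessThanI[of _ _ "\<lambda>i. if i = m then 0 else Suc i"]) auto
          show "add_leaf (fork m r) m p y z (if i = 0 then m else i - 1) (if j = 0 then m else j - 1) = bond_chain 0 z y i j"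
            if "i < Suc m" "j < Suc m" for i j
            using that p0 2 by (cases i; cases j) (auto simp: add_leaf_def fork_def bond_chain_def)
          show "good_shape (Suc m) (bond_chain 0 z y)" using 2 yz yz2 by (auto simp: good_shape_fork good_shape_bond_chain mult.commute)
        qed
      next
        assume "Suc p = m"
        then show ?thesis
          by (intro has_good_shapeI[OF sh, of id "bond_chain p y z"])
            (use 2 yz yz2 in \<open>auto simp: defs bond_chain_def good_shape_fork good_shape_bond_chain\<close>)
      qed
    qed
  next
    case 3
    have yz': "y * z = 1"
    proof (rule ccontr)
      assume "\<not> ?thesis"
      then have yz2: "y * z \<ge> 2" using yz1 by simp
      consider (a) "p = r" | (b) "p < r" | (c) "r < p" "Suc p < m" | (d) "Suc p = m" using p by linarith
      then show False
      proof cases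
        case a
        have "4 \<le> (3::int)"
          by (rule interval_bound[OF pd', of r r "[(m, r), (Suc r, r), (r - 1, r)]"])
            (use a 3 yz2 in \<open>auto simp: defs\<close>)
        then show False by simp
      next
        case b
        have "4 \<le> (3::int)"
          by (rule interval_bound[OF pd', of p r "[(m, p), (Suc r, r), (m - 1, r)]"])
            (use b 3 yz2 in \<open>auto simp: defs\<close>)
        then show False by simp
      next
        case c
        have "4 \<le> (3::int)"
          by (rule interval_bound[OF pd', of r p "[(m, p), (r - 1, r), (m - 1, r)]"])
            (use c 3 yz2 in \<open>auto simp: defs\<close>)
        then show False by simp
      next
        case d
        obtain k where k: "r = k + 1" using 3 by (metis le_add_diff_inverse2)
        obtain q where q: "m = k + q + 4" using that[of "m - k - 4"] 3 k by simp
        have pq: "p = k + q + 3" using d q by simp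
        \<comment> \<open>the path from r to p is \<open>r, m - 1\<close> and no interval of indices\<close>
        let ?P = "{k + 1, k + q + 3}" and ?U = "{k, k + 2, k + q + 4}"
        let ?c = "add_leaf (fork m r) m p y z"
        let ?\<pi> = "\<lambda>u. if u = k + q + 4 then k + q + 3 else k + 1"
        have "(\<Sum>u\<in>?U. ?c (?\<pi> u) u * ?c u (?\<pi> u)) \<le> 3"
        proof (rule pd_gcm_bond_bound[OF pd', of ?P ?U "N' (k + 1)"])
          have "N' (k + 1) * ?c (k + 1) (k + q + 3) = N' (k + q + 3) * ?c (k + q + 3) (k + 1)"
            using q by (intro pd_gcmD(5)[OF pd']) auto
          then have "N' (k + q + 3) = N' (k + 1)" unfolding q k by (simp add: add_leaf_def fork_def)
          then show "N' i = N' (k + 1)" if "i \<in> ?P" for i using that by auto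
          show "(\<Sum>i\<in>?P. \<Sum>j\<in>?P. ?c i j) \<le> 2" unfolding q k by (simp add: add_leaf_def fork_def)
        qed (use q in auto)
        moreover have "(\<Sum>u\<in>?U. ?c (?\<pi> u) u * ?c u (?\<pi> u)) = 2 + y * z"
          unfolding q k pq by (simp add: add_leaf_def fork_def)
        ultimately show False using yz2 by simp
      qed
    qed
    then have yz': "y = 1" "z = 1" using one by auto
    have "p = 0 \<or> p + 2 = m \<or> Suc p = m"
    proof (rule ccontr)
      assume np: "\<not> ?thesis"
      show False
      proof (cases "p \<le> r")
        case True
        obtain k where m: "m = r + k + 3" using 3 by (metis add.assoc add.commute le_iff_add)
        obtain p' where p': "p = Suc p'" using np by (cases p) auto
        have "4 \<le> (3::int)"
          by (rule interval_bound[OF pd', of p r "[(m, p), (Suc r, r), (m - 1, r), (p', p)]"])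
            (use True in \<open>auto simp: m p' yz' add_leaf_def fork_def\<close>)
        then show False by simp
      next
        case False
        then have "r < p" "p + 3 \<le> m" using np p by auto
        obtain k where m: "m = p + k + 3" using \<open>p + 3 \<le> m\<close> by (metis add.assoc add.commute le_iff_add)
        obtain r' where r': "r = Suc r'" using 3 by (cases r) auto
        have "4 \<le> (3::int)"
          by (rule interval_bound[OF pd', of r p "[(m, p), (r', r), (m - 1, r), (Suc p, p)]"])
            (use \<open>r < p\<close> in \<open>auto simp: m r' yz' add_leaf_def fork_def\<close>)
        then show False by simp
      qed
    qed
    then consider (a) "p = 0" | (b) "p + 2 = m" | (c) "Suc p = m" "r = 1" | (d) "Suc p = m" "r + 3 = m" | (e) "Suc p = m" "r \<ge> 2" "r + 4 \<le> m"
      using 3 by linarith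
    then show ?thesis
    proof cases
      case a
      show ?thesis
      proof (rule has_good_shapeI[OF sh])
        let ?g = "\<lambda>i. if i = 0 then m else if i = m then m - 1 else i - 1"
        show "bij_betw ?g {..<Suc m} {..<Suc m}"
          by (rule bij_betw_lessThanI[of _ _ "\<lambda>i. if i = m then 0 else if i = m - 1 then m else Suc i"]) (use 3 in auto)
        show "add_leaf (fork m r) m p y z (?g i) (?g j) = fork (Suc m) (Suc r) i j"
          if "i < Suc m" "j < Suc m" for i j
        proof -
          obtain n where n: "m = Suc n" using 3 by (cases m) auto
          have r: "r < n" using 3 n by auto
          have "i = 0 \<or> (\<exists>k<n. i = Suc k) \<or> i = Suc n" "j = 0 \<or> (\<exists>k<n. j = Suc k) \<or> j = Suc n"
            using that n by (cases i; cases j; auto)+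
          then show ?thesis using r a unfolding yz' n
            by (elim disjE exE conjE) (simp_all add: add_leaf_def fork_def)
        qed
        show "good_shape (Suc m) (fork (Suc m) (Suc r))" using 3 by (auto simp: good_shape_fork good_shape_bond_chain)
      qed
    next
      case b
      show ?thesis
      proof (rule has_good_shapeI[OF sh])
        let ?g = "\<lambda>i. if i = m - 1 then m else if i = m then m - 1 else i"
        show "bij_betw ?g {..<Suc m} {..<Suc m}"
          by (rule bij_betw_lessThanI[of _ _ ?g]) (use 3 in auto)
        show "add_leaf (fork m r) m p y z (?g i) (?g j) = fork (Suc m) r i j"
          if "i < Suc m" "j < Suc m" for i j
        proof -
          have m: "m = p + 2" and r: "r < p" using 3 b by auto
          have "i \<le> p \<or> i = p + 1 \<or> i = p + 2" "j \<le> p \<or> j = p + 1 \<or> j = p + 2" using that m by auto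
          then show ?thesis using r unfolding yz' m
            by (elim disjE) (simp_all add: add_leaf_def fork_def)
        qed
        show "good_shape (Suc m) (fork (Suc m) r)" using 3 by (auto simp: good_shape_fork good_shape_bond_chain)
      qed
    next
      case c
      show ?thesis
      proof (rule has_good_shapeI[OF sh])
        let ?g = "\<lambda>i. if i = 0 then m else if i = 1 then m - 1 else if i = m then 0 else i - 1"
        show "bij_betw ?g {..<Suc m} {..<Suc m}"
          by (rule bij_betw_lessThanI[of _ _ "\<lambda>i. if i = m then 0 else if i = m - 1 then 1 else if i = 0 then m else Suc i"]) (use 3 in auto)
        show "add_leaf (fork m r) m p y z (?g i) (?g j) = fork (Suc m) 2 i j"
          if "i < Suc m" "j < Suc m" for i j
        proof -
          obtain n where n: "m = n + 4" using that[of "m - 4"] 3 c by simp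
          have *: "i = 0 \<or> i = 1 \<or> (\<exists>k<n + 2. i = k + 2) \<or> i = n + 4" if "i < Suc m" for i
            using that n by (cases i; cases "i - 1") auto
          show ?thesis using *[OF that(1)] *[OF that(2)] c unfolding yz' n
            by (elim disjE exE conjE) (simp_all add: add_leaf_def fork_def)
        qed
        show "good_shape (Suc m) (fork (Suc m) 2)" using 3 c by (auto simp: good_shape_fork good_shape_bond_chain)
      qed
    next
      case d
      show ?thesis
      proof (rule has_good_shapeI[OF sh])
        let ?g = "\<lambda>i. if i = m - 2 then m - 1 else if i = m - 1 then m else if i = m then m - 2 else i"
        show "bij_betw ?g {..<Suc m} {..<Suc m}"
          by (rule bij_betw_lessThanI[of _ _ "\<lambda>i. if i = m - 1 then m - 2 else if i = m then m - 1 else if i = m - 2 then m else i"]) (use 3 in auto)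
        show "add_leaf (fork m r) m p y z (?g i) (?g j) = fork (Suc m) r i j"
          if "i < Suc m" "j < Suc m" for i j
        proof -
          have m: "m = r + 3" and p: "p = r + 2" using d by auto
          have *: "i \<le> r \<or> i = r + 1 \<or> i = r + 2 \<or> i = r + 3" if "i < Suc m" for i using that m by auto
          show ?thesis using *[OF that(1)] *[OF that(2)] unfolding yz' m p
            by (elim disjE) (simp_all add: add_leaf_def fork_def)
        qed
        show "good_shape (Suc m) (fork (Suc m) r)" using 3 by (auto simp: good_shape_fork good_shape_bond_chain)
      qed
    next
      case e
      obtain k where k: "r = k + 2" using e by (metis le_add_diff_inverse2)
      obtain q where q: "m = k + q + 6" using that[of "m - k - 6"] e k by simp
      \<comment> \<open>three arms of length two carry the null root of the affine diagram \<open>E\<^sub>6\<^sup>(\<^sup>1\<^sup>)\<close>\<close>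
      have p': "p = k + q + 5" using e q by simp
      have False
      proof (rule pd_gcm_no_null_vector[OF pd', of "{k, k + 1, k + 2, k + 3, k + 4, k + q + 5, k + q + 6}" k
            "\<lambda>i. if i = k + 2 then 3 else if i = k + 1 \<or> i = k + 3 \<or> i = k + q + 5 then 2 else 1"])
        show "(\<Sum>j\<in>{k, k + 1, k + 2, k + 3, k + 4, k + q + 5, k + q + 6}. add_leaf (fork m r) m p y z i j *
           (if j = k + 2 then 3 else if j = k + 1 \<or> j = k + 3 \<or> j = k + q + 5 then 2 else 1)) = 0"
          if "i \<in> {k, k + 1, k + 2, k + 3, k + 4, k + q + 5, k + q + 6}" for i
          using that unfolding q k p' yz' by (elim insertE emptyE) (simp_all add: add_leaf_def fork_def)
      qed (use q in auto)
      then show ?thesis ..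
    qed
  qed
qed


lemma pd_gcm_good_shape:
  assumes "pd_gcm I c N" "conn I c" "I \<noteq> {}"
  shows "\<exists>s. good_shape (card I) s \<and> has_shape I c (card I) s"
  using assms
proof (induction "card I" arbitrary: I)
  case 0
  then show ?case using pd_gcmD(1)[OF 0(2)] by auto
next
  case (Suc m)
  note pd = \<open>pd_gcm I c N\<close>
  have fin: "finite I" by (rule pd_gcmD(1)[OF pd])
  show ?case
  proof (cases "m = 0")
    case True
    then obtain i where i: "I = {i}" using Suc(2) by (metis One_nat_def card_1_singletonE)
    have "has_shape I c 1 (fork 1 0)"
      unfolding has_shape_def using pd_gcmD(3)[OF pd, of i] i
      by (intro exI[of _ "\<lambda>_. i"]) (auto simp: fork_def bij_betw_def inj_on_def)
    moreover have "good_shape 1 (fork 1 0)" by (auto simp: good_shape_def)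
    ultimately show ?thesis using True Suc(2) by auto
  next
    case False
    then have "card I \<ge> 2" using Suc(2) by simp
    then obtain n p where np: "n \<in> I" "p \<in> I" "p \<noteq> n" "c n p < 0" "c p n < 0"
      "\<And>q. q \<in> I \<Longrightarrow> q \<noteq> n \<Longrightarrow> q \<noteq> p \<Longrightarrow> c n q = 0 \<and> c q n = 0" "conn (I - {n}) c"
      by (rule pd_gcm_leaf[OF pd \<open>conn I c\<close>]) blast
    have m: "m = card (I - {n})" using Suc(2) np(1) fin by simp
    have "pd_gcm (I - {n}) c N" by (rule pd_gcm_subset[OF pd]) auto
    then obtain s where s: "good_shape m s" "has_shape (I - {n}) c m s"
      using Suc(1)[OF m _ np(7)] np(2,3) m by blast
    obtain k where k: "k < m" "has_shape I c (Suc m) (add_leaf s m k (- c p n) (- c n p))"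
      using has_shape_add_leaf[OF s(2) np(1-3) pd_gcmD(3)[OF pd np(1)] np(6)] by blast
    consider r where "s = fork m r" "m = 1 \<and> r = 0 \<or> m \<ge> 2 \<and> r + 2 = m \<or> 1 \<le> r \<and> r + 3 \<le> m"
      | r u w where "s = bond_chain r u w" "r + 2 \<le> m" "0 < u" "0 < w" "2 \<le> u * w"
      using s(1) unfolding good_shape_def by blast
    then have "\<exists>s. good_shape (Suc m) s \<and> has_shape I c (Suc m) s"
    proof cases
      case (1 r)
      show ?thesis by (rule add_leaf_fork[OF k(2)[unfolded 1(1)] pd k(1) 1(2)]) (use np in auto)
    next
      case (2 r u w)
      show ?thesis by (rule add_leaf_bond_chain[OF k(2)[unfolded 2(1)] pd k(1) 2(2-5)]) (use np in auto)
    qed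
    then show ?thesis using Suc(2) by simp
  qed
qed

lemma fork_reverse:
  assumes "has_shape I c m (fork m r)" "r + 2 \<le> m"
  shows "has_shape I c m (fork m (m - 2 - r))"
proof (rule has_shape_reindex[OF assms(1)])
  let ?g = "\<lambda>i. if Suc i = m then i else m - 2 - i"
  show "bij_betw ?g {..<m} {..<m}"
    by (rule bij_betw_lessThanI[of _ _ ?g]) (use assms(2) in auto)
  show "fork m r (?g i) (?g j) = fork m (m - 2 - r) i j" if "i < m" "j < m" for i j
  proof -
    obtain k where m: "m = r + k + 2" using assms(2) by (metis add.assoc add.commute le_iff_add)
    have g: "?g i < m" "?g j < m" "?g i = ?g j \<longleftrightarrow> i = j" using that assms(2) by auto
    have 1: "?g j = Suc (?g i) \<and> Suc (?g j) < m \<longleftrightarrow> i = Suc j \<and> Suc i < m" if "i < m" "j < m" for i j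
      using that unfolding m by (cases "i = r + k + 1"; cases "j = r + k + 1") auto
    have 2: "?g i = r \<and> Suc (?g j) = m \<longleftrightarrow> i = m - 2 - r \<and> Suc j = m" if "i < m" "j < m" for i j
      using that unfolding m by (cases "i = r + k + 1"; cases "j = r + k + 1") auto
    show ?thesis
      unfolding fork_def using g(3) 1[OF that] 1[OF that(2,1)] 2[OF that] 2[OF that(2,1)] by (simp only: disj_ac)
  qed
qed

lemma bond_chain_reverse:
  assumes "has_shape I c m (bond_chain r u w)" "r + 2 \<le> m"
  shows "has_shape I c m (bond_chain (m - 2 - r) w u)"
proof (rule has_shape_reindex[OF assms(1)])
  let ?g = "\<lambda>i. m - 1 - i"
  show "bij_betw ?g {..<m} {..<m}"
    by (rule bij_betw_lessThanI[of _ _ ?g]) (use assms(2) in auto)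
  show "bond_chain r u w (?g i) (?g j) = bond_chain (m - 2 - r) w u i j" if "i < m" "j < m" for i j
  proof -
    obtain k where m: "m = r + k + 2" using assms(2) by (metis add.assoc add.commute le_iff_add)
    define i' j' where "i' = r + k + 1 - i" and "j' = r + k + 1 - j"
    then have i: "i + i' = r + k + 1" and j: "j + j' = r + k + 1" using that m by auto
    have g: "m - 1 - i = i'" "m - 1 - j = j'" "m - 2 - r = k" using i j m by auto
    have e: "i' = j' \<longleftrightarrow> i = j" "j' = Suc i' \<longleftrightarrow> i = Suc j" "i' = Suc j' \<longleftrightarrow> j = Suc i" using i j by auto
    have "i' = r \<longleftrightarrow> j = k" if "i = Suc j" using that i by auto
    moreover have "j' = r \<longleftrightarrow> i = k" if "j = Suc i" using that j by auto
    ultimately show ?thesis unfolding bond_chain_def g e by auto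
  qed
qed

definition has_dynkin :: "nat set \<Rightarrow> (nat \<Rightarrow> nat \<Rightarrow> int) \<Rightarrow> nat \<Rightarrow> bool" where
  "has_dynkin I c m \<longleftrightarrow> (\<exists>X. valid_type X m \<and> has_shape I c m (\<lambda>i j. dynkin_entry X m (i, j)))"

lemma has_dynkinI:
  assumes "has_shape I c m s" "valid_type X m" "\<And>i j. i < m \<Longrightarrow> j < m \<Longrightarrow> s i j = dynkin_entry X m (i, j)"
  shows "has_dynkin I c m"
  unfolding has_dynkin_def
  by (intro exI[of _ X] conjI assms(2) has_shape_reindex[OF assms(1), of id])
    (simp_all del: dynkin_entry.simps add: assms(3))

lemma dynkin_entry_simply_laced:
  assumes "X = Type_A \<or> X = Type_D \<or> X = Type_E"
  shows "dynkin_entry X l (i, j) = (if i = j then 2 else if dynkin_edge X l i j \<or> dynkin_edge X l j i then -1 else 0)"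
  using assms by auto

text \<open>By reversal of the chain, the left arm may be taken to be the shorter one. Arms of lengths 1, 2, 5
  give \<open>E\<^sub>8\<^sup>(\<^sup>1\<^sup>)\<close> and arms of lengths 1, 3, 3 give \<open>E\<^sub>7\<^sup>(\<^sup>1\<^sup>)\<close>, which leaves the finite types.\<close>

lemma fork_dynkin:
  assumes sh: "has_shape I c m (fork m r)" and pd: "pd_gcm I c N"
    and r: "m = 1 \<and> r = 0 \<or> m \<ge> 2 \<and> r + 2 = m \<or> 1 \<le> r \<and> r + 3 \<le> m"
  shows "has_dynkin I c m"
proof -
  have D: "has_dynkin I c m" if "has_shape I c m (fork m r)" "1 \<le> r" "r + 3 = m" for r
  proof (rule has_dynkinI[OF that(1), of Type_D])
    show "valid_type Type_D m" using that by simp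
    have m: "m - 1 = r + 2" "m - 3 = r" "m = r + 3" using that by auto
    show "fork m r i j = dynkin_entry Type_D m (i, j)" if "i < m" "j < m" for i j
      unfolding fork_def dynkin_entry_simply_laced[OF disjI2[OF disjI1[OF refl]]] dynkin_edge.simps m
      by (intro if_cong refl) auto
  qed
  have E: "has_dynkin I c m" if sh: "has_shape I c m (fork m r)" "r = 2" "r + 4 \<le> m" for r
  proof (cases "m \<le> 8")
    case True
    then have "m \<in> {6, 7, 8}" using that by auto
    show ?thesis
    proof (rule has_dynkinI[OF sh(1), of Type_E])
      show "valid_type Type_E m" using \<open>m \<in> {6, 7, 8}\<close> by simp
      have m: "Suc k < m \<longleftrightarrow> k < m - 1" "Suc k = m \<longleftrightarrow> k = m - 1" for k using that(3) by auto
      show "fork m r i j = dynkin_entry Type_E m (i, j)" if "i < m" "j < m" for i j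
        unfolding fork_def dynkin_entry_simply_laced[OF disjI2[OF disjI2[OF refl]]] dynkin_edge.simps m sh(2)
        by (intro if_cong refl) auto
    qed
  next
    case False
    obtain N' where pd': "pd_gcm {..<m} (fork m r) N'" using has_shape_pd[OF sh(1) pd] by blast
    \<comment> \<open>the null root of \<open>E\<^sub>8\<^sup>(\<^sup>1\<^sup>)\<close>\<close>
    let ?x = "\<lambda>i. if i = 0 then 2 else if i = 1 then 4 else if i = 2 then 6 else if i = 3 then 5 else
      if i = 4 then 4 else if i = 5 then 3 else if i = 6 then 2 else if i = 7 then 1 else 3 :: int"
    have False
    proof (rule pd_gcm_no_null_vector[OF pd', of "{0, 1, 2, 3, 4, 5, 6, 7, m - 1}" 0 ?x])
      show "(\<Sum>j\<in>{0, 1, 2, 3, 4, 5, 6, 7, m - 1}. fork m r i j * ?x j) = 0"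
        if "i \<in> {0, 1, 2, 3, 4, 5, 6, 7, m - 1}" for i
      proof -
        obtain q where q: "m = q + 9" using that[of "m - 9"] False by simp
        show ?thesis using that unfolding q sh(2) by (elim insertE emptyE) (simp_all add: fork_def)
      qed
    qed (use False in auto)
    then show ?thesis ..
  qed
  consider "m = 1" "r = 0" | "m \<ge> 2" "r + 2 = m" | "r = 1" "4 \<le> m" | "1 \<le> r" "r + 3 = m" | "r = 2" "r + 4 \<le> m"
    | "r + 4 = m" "2 \<le> r" | "3 \<le> r" "r + 5 \<le> m" using r by linarith
  then show ?thesis
  proof cases
    case 1
    show ?thesis by (rule has_dynkinI[OF sh, of Type_A]) (use 1 in \<open>auto simp: fork_def\<close>)
  next
    case 2
    show ?thesis by (rule has_dynkinI[OF sh, of Type_A]) (use 2 in \<open>auto simp: fork_def\<close>)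
  next
    case 3
    show ?thesis by (rule D[OF fork_reverse[OF sh]]) (use 3 in auto)
  next
    case 4 then show ?thesis by (rule D[OF sh])
  next
    case 5 then show ?thesis by (rule E[OF sh])
  next
    case 6
    show ?thesis by (rule E[OF fork_reverse[OF sh]]) (use 6 in auto)
  next
    case 7
    obtain N' where pd': "pd_gcm {..<m} (fork m r) N'" using has_shape_pd[OF sh pd] by blast
    obtain k where k: "r = k + 3" using 7 by (metis le_add_diff_inverse2)
    obtain q where q: "m = k + q + 8" using that[of "m - k - 8"] 7 k by simp
    \<comment> \<open>the null root of \<open>E\<^sub>7\<^sup>(\<^sup>1\<^sup>)\<close>\<close>
    let ?x = "\<lambda>i. if i = k + 3 then 4 else if i = k + 2 \<or> i = k + 4 then 3 else if i = k + 1 \<or> i = k + 5 \<or> i = k + q + 7 then 2 else 1 :: int"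
    have False
    proof (rule pd_gcm_no_null_vector[OF pd', of "{k, k + 1, k + 2, k + 3, k + 4, k + 5, k + 6, k + q + 7}" k ?x])
      show "(\<Sum>j\<in>{k, k + 1, k + 2, k + 3, k + 4, k + 5, k + 6, k + q + 7}. fork m r i j * ?x j) = 0"
        if "i \<in> {k, k + 1, k + 2, k + 3, k + 4, k + 5, k + 6, k + q + 7}" for i
        using that unfolding q k by (elim insertE emptyE) (simp_all add: fork_def)
    qed (use q in auto)
    then show ?thesis ..
  qed
qed

text \<open>A triple bond admits no further bond. With vertices on both sides, a double bond admits only the
  diagram \<open>F\<^sub>4\<close>, since the next longer chain has a null root.\<close>

lemma bond_chain_dynkin:
  assumes sh: "has_shape I c m (bond_chain r u w)" and pd: "pd_gcm I c N"
    and r: "r + 2 \<le> m" and uw: "u > 0" "w > 0" "u * w \<ge> 2"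
  shows "has_dynkin I c m"
proof -
  obtain N' where pd': "pd_gcm {..<m} (bond_chain r u w) N'" using has_shape_pd[OF sh pd] by blast
  have le3: "u * w \<le> 3"
    by (rule interval_bound[OF pd', of r r "[(Suc r, r)]"]) (use r in \<open>auto simp: bond_chain_def\<close>)
  have le2: "u * w \<le> 2" if "m \<noteq> 2"
  proof -
    have "u * w + 1 \<le> 3"
    proof (cases "r = 0")
      case True
      show ?thesis
        by (rule interval_bound[OF pd', of "Suc r" "Suc r" "[(r, Suc r), (Suc (Suc r), Suc r)]"])
          (use r that True in \<open>auto simp: bond_chain_def mult.commute\<close>)
    next
      case False
      show ?thesis
        by (rule interval_bound[OF pd', of r r "[(Suc r, r), (r - 1, r)]"])
          (use r False in \<open>auto simp: bond_chain_def\<close>)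
    qed
    then show ?thesis by simp
  qed
  have uw2: "u * w = 2 \<Longrightarrow> u = 1 \<and> w = 2 \<or> u = 2 \<and> w = 1" if "u > 0" "w > 0" for u w :: int
  proof -
    assume e: "u * w = 2"
    then have "u dvd 2" "w dvd 2" by (metis dvd_triv_left, metis dvd_triv_right)
    then have "u \<le> 2" "w \<le> 2" by (auto intro: zdvd_imp_le)
    then have "u \<in> {1, 2}" "w \<in> {1, 2}" using that by auto
    then show ?thesis using e by auto
  qed
  have uw3: "u * w = 3 \<Longrightarrow> u = 1 \<and> w = 3 \<or> u = 3 \<and> w = 1"
  proof -
    assume e: "u * w = 3"
    then have "u dvd 3" "w dvd 3" by (metis dvd_triv_left, metis dvd_triv_right)
    then have "u \<le> 3" "w \<le> 3" by (auto intro: zdvd_imp_le)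
    then have "u \<in> {1, 2, 3}" "w \<in> {1, 2, 3}" using uw by auto
    then show ?thesis using e by auto
  qed
  have G: "has_dynkin I c m" if "has_shape I c m (bond_chain 0 3 1)" "m = 2"
    by (rule has_dynkinI[OF that(1), of Type_G]) (use that in \<open>auto simp: bond_chain_def\<close>)
  have B: "has_dynkin I c m" if "has_shape I c m (bond_chain r 1 2)" "r + 2 = m" for r
    by (rule has_dynkinI[OF that(1), of Type_B]) (use that in \<open>auto simp: bond_chain_def\<close>)
  have C: "has_dynkin I c m" if "has_shape I c m (bond_chain r 2 1)" "r + 2 = m" "m \<ge> 3" for r
    by (rule has_dynkinI[OF that(1), of Type_C]) (use that in \<open>auto simp: bond_chain_def\<close>)
  have F: "has_dynkin I c m" if "has_shape I c m (bond_chain r 1 2)" "r = 1" "m = 4" for r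
    by (rule has_dynkinI[OF that(1), of Type_F]) (use that in \<open>auto simp: bond_chain_def\<close>)
  have long: False if sh: "has_shape I c m (bond_chain r u w)" "u > 0" "w > 0" "u * w = 2" "r \<ge> 1" "r + 4 \<le> m" for r u w
  proof -
    obtain N' where pd': "pd_gcm {..<m} (bond_chain r u w) N'" using has_shape_pd[OF sh(1) pd] by blast
    obtain k where k: "r = k + 1" using sh(5) by (metis le_add_diff_inverse2)
    \<comment> \<open>the null roots of the two affine chains containing \<open>F\<^sub>4\<close>: 1, 2, 3, 2, 1 for w = 2 and 2, 4, 3, 2, 1 for w = 1\<close>
    let ?x = "\<lambda>i. if i = k then 2 div w else if i = k + 1 then 4 div w else if i = k + 2 then 3 else if i = k + 3 then 2 else 1"
    show False
    proof (rule pd_gcm_no_null_vector[OF pd', of "{k, k + 1, k + 2, k + 3, k + 4}" k ?x])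
      show "(\<Sum>j\<in>{k, k + 1, k + 2, k + 3, k + 4}. bond_chain r u w i j * ?x j) = 0"
        if "i \<in> {k, k + 1, k + 2, k + 3, k + 4}" for i
        using that uw2[OF sh(2-4)] unfolding k by (elim insertE emptyE) (auto simp: bond_chain_def)
    qed (use sh k uw2[OF sh(2-4)] in auto)
  qed
  show ?thesis
  proof (cases "u * w = 3")
    case True
    then have m2: "m = 2" using le2 by fastforce
    then have m: "m = 2" "r = 0" using r by auto
    show ?thesis using uw3[OF True] bond_chain_reverse[OF sh r] sh G m by auto
  next
    case False
    then have u2: "u * w = 2" using le3 uw by simp
    consider "r + 2 = m" | "r = 0" "m \<ge> 3" | "r = 1" "m = 4" | "r \<ge> 1" "r + 4 \<le> m" | "r \<ge> 2" "r + 3 = m"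
      using r by linarith
    then show ?thesis
    proof cases
      case 1
      then show ?thesis using uw2[OF uw(1,2) u2] bond_chain_reverse[OF sh r] sh B C r
        by (cases "m = 2") auto
    next
      case 2
      then show ?thesis using uw2[OF uw(1,2) u2] bond_chain_reverse[OF sh r] B[of "m - 2"] C[of "m - 2"] by auto
    next
      case 3
      then show ?thesis using uw2[OF uw(1,2) u2] bond_chain_reverse[OF sh r] F sh by auto
    next
      case 4
      then show ?thesis using long[OF sh uw(1,2) u2] by blast
    next
      case 5
      then show ?thesis using long[OF bond_chain_reverse[OF sh r] uw(2,1)] u2 by (auto simp: mult.commute)
    qed
  qed
qed

theorem pd_gcm_classification:
  assumes "pd_gcm I c N" "conn I c" "I \<noteq> {}"
  obtains X f where "valid_type X (card I)" "bij_betw f {..<card I} I"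
    "\<And>i j. i < card I \<Longrightarrow> j < card I \<Longrightarrow> c (f i) (f j) = dynkin_entry X (card I) (i, j)"
proof -
  obtain s where s: "good_shape (card I) s" "has_shape I c (card I) s"
    using pd_gcm_good_shape[OF assms] by blast
  have "has_dynkin I c (card I)"
    using s(1)[unfolded good_shape_def] s(2) fork_dynkin[OF _ assms(1)] bond_chain_dynkin[OF _ assms(1)] by blast
  then show ?thesis using that unfolding has_dynkin_def has_shape_def by blast
qed

section \<open>Reduction to a family of simple roots and their doubles\<close>

text \<open>Small digits: the lowest nonzero digit is not divisible by N.\<close>

lemma radix_sum_nonzero:
  fixes t :: "nat \<Rightarrow> int"
  assumes "\<And>i. i < n \<Longrightarrow> \<bar>t i\<bar> < N" "i < n" "t i \<noteq> 0"
  shows "(\<Sum>i<n. t i * N ^ i) \<noteq> 0"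
  using assms
proof (induction n arbitrary: t i)
  case (Suc n)
  have s: "(\<Sum>i<Suc n. t i * N ^ i) = t 0 + N * (\<Sum>i<n. t (Suc i) * N ^ i)"
    by (subst sum.lessThan_Suc_shift) (simp add: sum_distrib_left mult_ac)
  show ?case
  proof
    assume "(\<Sum>i<Suc n. t i * N ^ i) = 0"
    then have e: "t 0 = N * (- (\<Sum>i<n. t (Suc i) * N ^ i))" using s by simp
    then have "N dvd t 0" by simp
    then have t0: "t 0 = 0" using Suc.prems(1)[of 0] dvd_imp_le_int[of "t 0" N] by fastforce
    have N: "N \<noteq> 0" using Suc.prems(1)[of 0] by auto
    from Suc.prems t0 obtain i' where "i = Suc i'" by (cases i) auto
    then have "(\<Sum>i<n. t (Suc i) * N ^ i) \<noteq> 0"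
      using Suc.prems by (intro Suc.IH[of "\<lambda>i. t (Suc i)" i']) auto
    then show False using e t0 N by simp
  qed
qed simp

definition psd_form :: "nat \<Rightarrow> (nat \<Rightarrow> nat \<Rightarrow> int) \<Rightarrow> bool" where
  "psd_form m B \<longleftrightarrow> (\<forall>i<m. \<forall>j<m. B i j = B j i) \<and> (\<forall>x :: nat \<Rightarrow> real. form m B x x \<ge> 0)"

lemma psd_form_sym: "psd_form m B \<Longrightarrow> form m B x y = form m B y x"
  by (rule form_sym) (auto simp: psd_form_def)

lemma psd_form_int:
  fixes x :: "nat \<Rightarrow> int"
  assumes "psd_form m B" shows "form m B x x \<ge> 0"
proof -
  have "real_of_int (form m B x x) \<ge> 0" unfolding of_int_form using assms by (auto simp: psd_form_def)
  then show ?thesis by simp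
qed

lemma psd_form_Cauchy_Schwarz:
  fixes x y :: "nat \<Rightarrow> real"
  assumes "psd_form m B"
  shows "(form m B x y)\<^sup>2 \<le> form m B x x * form m B y y"
proof -
  define a b c where "a = form m B x x" and "b = form m B x y" and "c = form m B y y"
  have n: "a \<ge> 0" "c \<ge> 0" using assms by (auto simp: psd_form_def a_def c_def)
  have q: "a - 2 * k * b + k\<^sup>2 * c \<ge> 0" for k
  proof -
    have "form m B (\<lambda>p. x p - k * y p) (\<lambda>p. x p - k * y p) \<ge> 0" using assms by (auto simp: psd_form_def)
    then show ?thesis unfolding form_diff_left form_diff_right a_def b_def c_def
      by (simp add: psd_form_sym[OF assms, of y x] algebra_simps power2_eq_square)
  qed
  have "b\<^sup>2 \<le> a * c"
  proof (cases "c = 0")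
    case True
    have "b = 0"
    proof (rule ccontr)
      assume "b \<noteq> 0"
      then show False using q[of "(a + 1) / (2 * b)"] True by (simp add: field_simps)
    qed
    then show ?thesis using n by simp
  next
    case False
    then have "a - b\<^sup>2 / c \<ge> 0" using q[of "b / c"] by (simp add: field_simps power2_eq_square)
    then show ?thesis using False n by (simp add: field_simps)
  qed
  then show ?thesis by (simp add: a_def b_def c_def)
qed

lemma psd_form_radical:
  fixes x y :: "nat \<Rightarrow> real"
  assumes "psd_form m B" "form m B x x = 0"
  shows "form m B x y = 0"
  using psd_form_Cauchy_Schwarz[OF assms(1), of x y] assms(2) by simp

lemma psd_form_radical_int:
  fixes x y :: "nat \<Rightarrow> int"
  assumes "psd_form m B" "form m B x x = 0"
  shows "form m B x y = 0"
proof -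
  have "real_of_int (form m B x y) = 0"
    unfolding of_int_form by (rule psd_form_radical[OF assms(1)]) (use assms(2) in \<open>simp flip: of_int_form\<close>)
  then show ?thesis by simp
qed

lemma psd_form_Cauchy_Schwarz_int:
  fixes x y :: "nat \<Rightarrow> int"
  assumes "psd_form m B"
  shows "(form m B x y)\<^sup>2 \<le> form m B x x * form m B y y"
proof -
  have "real_of_int ((form m B x y)\<^sup>2) \<le> real_of_int (form m B x x * form m B y y)"
    unfolding of_int_power of_int_mult of_int_form by (rule psd_form_Cauchy_Schwarz[OF assms])
  then show ?thesis by (simp only: of_int_le_iff)
qed

text \<open>The products \<open>(x, e\<^sub>j)\<close> with the basis vectors are bounded by the Cauchy-Schwarz inequality and do not all
  vanish, so they are the digits of a nonzero number in a large base N. That number is \<open>(x, \<rho>)\<close> for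
  \<open>\<rho> = \<Sum>\<^sub>j N\<^sup>j e\<^sub>j\<close>. Since all braid images of basis vectors keep the lengths of the latter, one vector
  \<open>\<rho>\<close> serves the whole braid class.\<close>

lemma separating_vector:
  assumes "psd_form m B"
  shows "\<exists>\<rho> :: nat \<Rightarrow> int. \<forall>x :: nat \<Rightarrow> int. 0 < form m B x x \<longrightarrow> form m B x x \<le> K \<longrightarrow> form m B x \<rho> \<noteq> 0"
proof -
  define N where "N = 1 + (\<Sum>j<m. \<bar>K\<bar> * \<bar>B j j\<bar>)"
  define \<rho> where "\<rho> = (\<lambda>p. \<Sum>j<m. N ^ j * unitf j p)"
  have "form m B x \<rho> \<noteq> 0" if x: "0 < form m B x x" "form m B x x \<le> K" for x :: "nat \<Rightarrow> int"
  proof -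
    define t where "t j = form m B x (unitf j)" for j
    have 1: "form m B x \<rho> = (\<Sum>j<m. t j * N ^ j)"
      unfolding \<rho>_def form_sum_right form_smult_right t_def by (simp add: mult.commute)
    have 2: "\<bar>t j\<bar> < N" if j: "j < m" for j
    proof -
      have "\<bar>t j\<bar> \<le> (t j)\<^sup>2"
      proof (cases "t j = 0")
        case False
        then have "\<bar>t j\<bar> * 1 \<le> \<bar>t j\<bar> * \<bar>t j\<bar>" by (intro mult_left_mono) auto
        then show ?thesis by (simp add: power2_eq_square)
      qed simp
      also have "\<dots> \<le> form m B x x * B j j"
        unfolding t_def using psd_form_Cauchy_Schwarz_int[OF assms, of x "unitf j"] j by (simp add: form_unit)
      also have "\<dots> \<le> form m B x x * \<bar>B j j\<bar>" using x by (intro mult_left_mono) auto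
      also have "\<dots> \<le> \<bar>K\<bar> * \<bar>B j j\<bar>" using x by (intro mult_right_mono) auto
      also have "\<dots> \<le> (\<Sum>j<m. \<bar>K\<bar> * \<bar>B j j\<bar>)" using j by (intro member_le_sum) auto
      finally show ?thesis by (simp add: N_def)
    qed
    have 3: "\<exists>j<m. t j \<noteq> 0"
    proof (rule ccontr)
      assume "\<not> ?thesis"
      then have t0: "form m B x (unitf j) = 0" if "j < m" for j using that by (auto simp: t_def)
      have "form m B x x = (\<Sum>j<m. form m B x (unitf j) * x j)"
        unfolding form_def[of m B x x]
        by (subst sum.swap) (auto simp: form_unit_right sum_distrib_right sum_distrib_left intro!: sum.cong)
      then show False using t0 x(1) by simp
    qed
    then show ?thesis unfolding 1 using radix_sum_nonzero[of m t N] 2 by blast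
  qed
  then show ?thesis by blast
qed

lemma positive_semidefinite_form:
  assumes "SIM A" "positive_semidefinite A"
  obtains D where "symmetrizer A D" "psd_form (dim_row A) (\<lambda>i j. int (D i) * A $$ (i, j))"
proof -
  have sq: "square_mat A" using assms by (auto simp: SIM_def generalized_intersection_matrix_def)
  obtain D where D: "symmetrizer A D" "pos_semidef_mat (map_mat real_of_int (symmetrized A D))"
    using assms by (auto simp: positive_semidefinite_def)
  let ?B = "\<lambda>i j. int (D i) * A $$ (i, j)"
  have "form (dim_row A) ?B x x \<ge> 0" for x :: "nat \<Rightarrow> real"
  proof -
    let ?x = "vec (dim_row A) x"
    have "form (dim_row A) ?B x x = form (dim_row A) ?B (\<lambda>i. ?x $ i) (\<lambda>i. ?x $ i)"
      unfolding form_def by (intro sum.cong) auto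
    also have "\<dots> = ?x \<bullet> (map_mat of_int (symmetrized A D) *\<^sub>v ?x)"
      by (rule symmetrized_scalar_prod[OF sq, symmetric]) auto
    also have "\<dots> \<ge> 0"
      using D(2) symmetrized_carrier[OF sq, of D] unfolding pos_semidef_mat_def by auto
    finally show ?thesis .
  qed
  then have "psd_form (dim_row A) ?B"
    using D(1) symmetrizer_iff[OF sq] by (auto simp: psd_form_def)
  then show ?thesis using that D(1) by blast
qed

text \<open>Descent on the heights \<open>h\<^sub>i = (v\<^sub>i, \<rho>)\<close> over the braid class. At a minimum, \<open>|h\<^sub>b - k h\<^sub>a| \<ge> h\<^sub>b\<close> and
  \<open>|h\<^sub>a - k' h\<^sub>b| \<ge> h\<^sub>a\<close> together give \<open>k k' \<ge> 4\<close>, while semi-definiteness gives \<open>k k' \<le> 4\<close>.\<close>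

lemma exists_minimal_family:
  assumes A: "SIM A" and psd: "positive_semidefinite A" and ind: "indecomposable A"
  obtains B \<rho> A' X where "psd_form (dim_row A) B" "realizes (dim_row A) B X A'" "dim_row A' = dim_row A"
    "SIM A'" "indecomposable A'" "braid_step\<^sup>*\<^sup>* A A'"
    "\<And>i. i < dim_row A \<Longrightarrow> form (dim_row A) B (X i) \<rho> > 0"
    "\<And>a b. a < dim_row A \<Longrightarrow> b < dim_row A \<Longrightarrow> a \<noteq> b \<Longrightarrow> A' $$ (a, b) > 0 \<Longrightarrow>
       A' $$ (a, b) * A' $$ (b, a) = 4"
proof -
  define n where "n = dim_row A"
  obtain D where D: "symmetrizer A D" and psdf: "psd_form (dim_row A) (\<lambda>i j. int (D i) * A $$ (i, j))"
    by (rule positive_semidefinite_form[OF A psd])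
  define B where "B = (\<lambda>i j. int (D i) * A $$ (i, j))"
  have pB: "psd_form n B" using psdf by (simp add: n_def B_def)
  have rA: "realizes n B unitf A" unfolding n_def B_def by (rule SIM_realized[OF A D])
  have n0: "n > 0" using SIM_dim_pos[OF A] by (simp add: n_def)
  define K where "K = (\<Sum>i<n. B i i)"
  have Bp: "B i i > 0" if "i < n" for i
    using rA that by (auto simp: realizes_def n_def form_unit)
  have BK: "B i i \<le> K" if "i < n" for i
    unfolding K_def using that Bp by (intro member_le_sum) (auto intro: less_imp_le)
  obtain \<rho> :: "nat \<Rightarrow> int" where
    \<rho>: "\<And>x :: nat \<Rightarrow> int. 0 < form n B x x \<Longrightarrow> form n B x x \<le> K \<Longrightarrow> form n B x \<rho> \<noteq> 0"
    using separating_vector[OF pB, of K] by blast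
  define R where "R = (\<lambda>(A', X :: nat \<Rightarrow> nat \<Rightarrow> int). dim_row A' = n \<and> realizes n B X A' \<and> SIM A' \<and> indecomposable A' \<and>
     braid_step\<^sup>*\<^sup>* A A' \<and> (\<forall>i<n. form n B (X i) (X i) = B i i))"
  define h where "h X i = form n B (X i) \<rho>" for X :: "nat \<Rightarrow> nat \<Rightarrow> int" and i
  \<comment> \<open>doubled, so that a smaller absolute value means a smaller weight whatever the signs\<close>
  define w where "w t = nat (if t < 0 then 1 - 2 * t else 2 * t)" for t :: int
  define meas where "meas = (\<lambda>(A' :: int mat, X :: nat \<Rightarrow> nat \<Rightarrow> int). \<Sum>i<n. w (h X i))"
  have "R (A, unitf)"
    using rA A ind by (auto simp: R_def n_def form_unit)
  then obtain S where S: "R S" "\<And>T. R T \<Longrightarrow> meas S \<le> meas T"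
    using ex_has_least_nat[of R "(A, unitf)" meas] by auto
  obtain A' X where AX: "S = (A', X)" by (cases S)
  have d: "dim_row A' = n" and r: "realizes n B X A'" and sA: "SIM A'" and iA: "indecomposable A'"
    and bA: "braid_step\<^sup>*\<^sup>* A A'" and nm: "\<And>i. i < n \<Longrightarrow> form n B (X i) (X i) = B i i"
    using S(1) by (auto simp: R_def AX)
  have h0: "h X i \<noteq> 0" if "i < n" for i
    unfolding h_def using Bp BK nm that by (intro \<rho>) auto
  have step: "w (h X b) \<le> w (h X b - A' $$ (a, b) * h X a)" if ab: "a < n" "b < n" for a b
  proof -
    define v where "v = (\<lambda>p. X b p - A' $$ (a, b) * X a p)"
    define Y where "Y = X(b := v)"
    have "SIM (tau a b A')"
      by (rule realizes_SIM[OF realizes_tau[OF r]]) (use ab d n0 in auto)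
    then have "R (tau a b A', Y)"
      unfolding R_def Y_def v_def using realizes_tau[OF r, of a b] realizes_tau_norm[OF r, of a b] ab d nm
        indecomposable_tau[OF sA iA, of a b] braid_step_tau[OF sA, of a b] bA
      by auto
    then have "meas (A', X) \<le> meas (tau a b A', Y)" using S(2) AX by simp
    then have "(\<Sum>i<n. w (h X i)) \<le> (\<Sum>i<n. w (h Y i))" by (simp add: meas_def)
    moreover have "(\<Sum>i<n. w (h X i)) = w (h X b) + (\<Sum>i\<in>{..<n} - {b}. w (h X i))"
      using ab by (intro sum.remove) auto
    moreover have "(\<Sum>i<n. w (h Y i)) = w (h Y b) + (\<Sum>i\<in>{..<n} - {b}. w (h Y i))"
      using ab by (intro sum.remove) auto
    moreover have "(\<Sum>i\<in>{..<n} - {b}. w (h Y i)) = (\<Sum>i\<in>{..<n} - {b}. w (h X i))"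
      by (intro sum.cong) (auto simp: h_def Y_def)
    moreover have "h Y b = h X b - A' $$ (a, b) * h X a"
      by (simp add: h_def Y_def v_def form_diff_left)
    ultimately show ?thesis by simp
  qed
  have A2: "A' $$ (i, i) = 2" if "i < n" for i
    using sA that d by (auto simp: SIM_def generalized_intersection_matrix_def)
  have hp: "h X i > 0" if i: "i < n" for i
  proof (rule ccontr)
    assume "\<not> ?thesis"
    then have neg: "h X i < 0" using h0[OF i] by simp
    then have "w (h X i) \<le> w (- h X i)" using step[OF i i] A2[OF i] by simp
    then show False using neg by (simp add: w_def)
  qed
  have pr: "A' $$ (a, b) * A' $$ (b, a) = 4" if ab: "a < n" "b < n" and ne: "a \<noteq> b" and pos: "A' $$ (a, b) > 0" for a b
  proof -
    define k k' where "k = A' $$ (a, b)" and "k' = A' $$ (b, a)"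
    have kp: "k > 0" "k' > 0" using pos sA ab d
      by (auto simp: k_def k'_def SIM_def generalized_intersection_matrix_def)
    have 1: "k * h X a \<ge> 2 * h X b"
    proof (rule ccontr)
      assume "\<not> ?thesis"
      then have "w (h X b - k * h X a) < w (h X b)"
        using hp[OF ab(1)] hp[OF ab(2)] kp by (auto simp: w_def)
      then show False using step[OF ab] by (simp add: k_def)
    qed
    have 2: "k' * h X b \<ge> 2 * h X a"
    proof (rule ccontr)
      assume "\<not> ?thesis"
      then have "w (h X a - k' * h X b) < w (h X a)"
        using hp[OF ab(1)] hp[OF ab(2)] kp by (auto simp: w_def)
      then show False using step[OF ab(2,1)] by (simp add: k'_def)
    qed
    have "k * k' * h X a \<ge> 4 * h X a"
    proof -
      have "k' * (k * h X a) \<ge> k' * (2 * h X b)" using 1 kp by (intro mult_left_mono) auto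
      then show ?thesis using 2 by (simp add: mult_ac)
    qed
    then have ge: "k * k' \<ge> 4" using hp[OF ab(1)] by simp
    define G where "G i j = form n B (X i) (X j)" for i j
    have Gs: "G b a = G a b" unfolding G_def by (rule psd_form_sym[OF pB])
    have e1: "k * G a a = 2 * G a b" and e2: "k' * G b b = 2 * G a b" and Gb: "G b b > 0"
      using r ab d Gs unfolding realizes_def k_def k'_def G_def by auto
    have "form n B (\<lambda>p. 2 * X b p - k * X a p) (\<lambda>p. 2 * X b p - k * X a p) \<ge> 0"
      by (rule psd_form_int[OF pB])
    then have "4 * G b b - 4 * k * G a b + k * (k * G a a) \<ge> 0"
      unfolding form_diff_left form_diff_right form_smult_left form_smult_right
      using Gs by (simp add: G_def algebra_simps)
    then have "4 * G b b - k * (2 * G a b) \<ge> 0" unfolding e1 by simp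
    then have "(4 - k * k') * G b b \<ge> 0" unfolding e2[symmetric] by (simp add: algebra_simps)
    then have "k * k' \<le> 4" using Gb by (simp add: zero_le_mult_iff)
    then show ?thesis using ge by (simp add: k_def k'_def)
  qed
  show ?thesis
    by (rule that[of B X A' \<rho>]) (use pB r d sA iA bA hp pr in \<open>auto simp: n_def h_def\<close>)
qed

text \<open>Members with positive product are proportional modulo the radical, so this is an equivalence
  relation. The map \<open>\<sigma>\<close> picks the lowest member of each class. The ratio of a member to its
  representative is half of an entry that divides 4, and it is at least 1 by the choice of \<open>\<sigma>\<close>;
  therefore it is 1 or 2.\<close>

lemma minimal_family_representatives:
  assumes pB: "psd_form n B" and r: "realizes n B X A" and d: "dim_row A = n"
    and h: "\<And>i. i < n \<Longrightarrow> form n B (X i) \<rho> > 0"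
    and pr: "\<And>a b. a < n \<Longrightarrow> b < n \<Longrightarrow> a \<noteq> b \<Longrightarrow> A $$ (a, b) > 0 \<Longrightarrow> A $$ (a, b) * A $$ (b, a) = 4"
  shows "\<exists>\<sigma> c. \<forall>i<n. \<sigma> i < n \<and> \<sigma> (\<sigma> i) = \<sigma> i \<and> (c i = 1 \<or> c i = 2) \<and> c (\<sigma> i) = 1 \<and>
    (\<forall>x. form n B (X i) x = c i * form n B (X (\<sigma> i)) x) \<and>
    (\<forall>j<n. \<sigma> i \<noteq> \<sigma> j \<longrightarrow> A $$ (\<sigma> i, \<sigma> j) \<le> 0)"
proof -
  define Q where "Q i j = form n B (X i) (X j)" for i j
  have Qs: "Q i j = Q j i" for i j unfolding Q_def by (rule psd_form_sym[OF pB])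
  have Qp: "Q i i > 0" if "i < n" for i using r that d by (auto simp: realizes_def Q_def)
  have AQ: "A $$ (i, j) * Q i i = 2 * Q i j" if "i < n" "j < n" for i j
    using r that d by (auto simp: realizes_def Q_def)
  have A2: "A $$ (i, i) = 2" if "i < n" for i using AQ[OF that that] Qp[OF that] by simp
  have pr': "A $$ (a, b) * A $$ (b, a) = 4" if "a < n" "b < n" "A $$ (a, b) > 0" for a b
    using pr[OF that(1,2)] that(3) A2[OF that(1)] by (cases "a = b") auto
  have par: "2 * form n B (X j) x = A $$ (i, j) * form n B (X i) x" if ij: "i < n" "j < n" "A $$ (i, j) > 0" for i j x
  proof -
    let ?k = "A $$ (i, j)"
    let ?w = "\<lambda>p. 2 * X j p - ?k * X i p"
    have "?k * Q i i = 2 * Q i j" "A $$ (j, i) * Q j j = 2 * Q i j"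
      using AQ[OF ij(1,2)] AQ[OF ij(2,1)] Qs[of i j] by auto
    have "form n B ?w ?w = 4 * Q j j - 2 * (?k * Q j i) - ?k * (2 * Q i j - ?k * Q i i)"
      unfolding form_diff_left form_diff_right form_smult_left form_smult_right by (simp add: Q_def algebra_simps)
    also have "\<dots> = 4 * Q j j - ?k * (2 * Q i j)"
      unfolding Qs[of j i] \<open>?k * Q i i = 2 * Q i j\<close> by simp
    also have "\<dots> = (4 - ?k * A $$ (j, i)) * Q j j"
      unfolding \<open>A $$ (j, i) * Q j j = 2 * Q i j\<close>[symmetric] by (simp add: algebra_simps)
    also have "\<dots> = 0" using pr'[OF ij] by simp
    finally have "form n B ?w x = 0" by (rule psd_form_radical_int[OF pB])
    then show ?thesis unfolding form_diff_left form_smult_left by simp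
  qed
  define P where "P i j \<longleftrightarrow> A $$ (i, j) > 0" for i j
  have Psym: "P i j \<longleftrightarrow> P j i" if "i < n" "j < n" for i j
  proof -
    have "P j i" if "i < n" "j < n" "P i j" for i j
      using zero_less_mult_pos[of "A $$ (i, j)" "A $$ (j, i)"] pr'[of i j] that by (simp add: P_def)
    then show ?thesis using that by blast
  qed
  have Prefl: "P i i" if "i < n" for i using A2[OF that] by (simp add: P_def)
  have Ptrans: "P i k" if "i < n" "j < n" "k < n" "P i j" "P j k" for i j k
  proof -
    have "2 * Q k i = A $$ (j, k) * Q j i" using par[of j k "X i"] that by (simp add: P_def Q_def)
    moreover have "2 * Q i j = A $$ (i, j) * Q i i" using AQ[OF that(1,2)] by simp
    then have "Q j i > 0" using that Qp[OF that(1)] Qs[of i j]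
      by (metis P_def mult_pos_pos zero_less_mult_pos zero_less_numeral)
    ultimately have "Q i k > 0" using that Qs[of i k]
      by (metis P_def mult_pos_pos zero_less_mult_pos zero_less_numeral)
    moreover have "A $$ (i, k) * Q i i = 2 * Q i k" by (rule AQ[OF that(1,3)])
    ultimately show ?thesis using Qp[OF that(1)]
      by (metis P_def mult_pos_pos zero_less_mult_pos2 zero_less_numeral)
  qed
  define hh where "hh i = nat (form n B (X i) \<rho>)" for i
  define cls where "cls i = {j \<in> {..<n}. P i j}" for i
  \<comment> \<open>lowest height, then lowest index, so that the choice depends on the class only\<close>
  define \<sigma> where "\<sigma> i = arg_min_on (\<lambda>j. hh j * n + j) (cls i)" for i
  have clsne: "finite (cls i)" "cls i \<noteq> {}" if "i < n" for i using Prefl[OF that] that by (auto simp: cls_def)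
  have \<sigma>in: "\<sigma> i < n" "P i (\<sigma> i)" if "i < n" for i
    using arg_min_if_finite(1)[OF clsne[OF that], of "\<lambda>j. hh j * n + j"] by (auto simp: \<sigma>_def cls_def)
  have cls_eq: "cls i = cls j" if "i < n" "j < n" "P i j" for i j
    unfolding cls_def using that Ptrans Psym by blast
  have \<sigma>eq: "\<sigma> i = \<sigma> j" if "i < n" "j < n" "P i j" for i j
    unfolding \<sigma>_def cls_eq[OF that] ..
  have hmin: "hh (\<sigma> i) \<le> hh i" if i: "i < n" for i
  proof (rule ccontr)
    assume "\<not> ?thesis"
    then have "Suc (hh i) \<le> hh (\<sigma> i)" by simp
    then have "Suc (hh i) * n \<le> hh (\<sigma> i) * n" by (rule mult_le_mono1)
    then have "hh i * n + i < hh (\<sigma> i) * n + \<sigma> i" using i by simp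
    moreover have "i \<in> cls i" using Prefl[OF i] i by (simp add: cls_def)
    ultimately show False
      using arg_min_if_finite(2)[OF clsne[OF i], of "\<lambda>j. hh j * n + j"] by (auto simp: \<sigma>_def)
  qed
  have dbl: "A $$ (\<sigma> i, i) = 2 \<or> A $$ (\<sigma> i, i) = 4" if i: "i < n" for i
  proof -
    let ?k = "A $$ (\<sigma> i, i)" and ?k' = "A $$ (i, \<sigma> i)"
    have P': "?k > 0" "?k' > 0" using \<sigma>in[OF i] Psym[OF i \<sigma>in(1)[OF i]] by (auto simp: P_def)
    have kk: "?k * ?k' = 4" by (rule pr'[OF \<sigma>in(1)[OF i] i P'(1)])
    have "2 * form n B (X i) \<rho> = ?k * form n B (X (\<sigma> i)) \<rho>" by (rule par[OF \<sigma>in(1)[OF i] i P'(1)])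
    moreover have "form n B (X (\<sigma> i)) \<rho> \<le> form n B (X i) \<rho>"
      using hmin[OF i] h[OF i] h[OF \<sigma>in(1)[OF i]] by (simp add: hh_def)
    ultimately have "?k \<noteq> 1" using h[OF \<sigma>in(1)[OF i]] h[OF i] by auto
    have "?k dvd 4" using kk by (metis dvd_triv_left)
    then have "?k \<le> 4" by (rule zdvd_imp_le) simp
    then have "?k \<in> {1, 2, 3, 4}" using P'(1) by auto
    moreover have "?k \<noteq> 3" using \<open>?k dvd 4\<close> by auto
    ultimately show ?thesis using \<open>?k \<noteq> 1\<close> by auto
  qed
  have idem: "\<sigma> (\<sigma> i) = \<sigma> i" if "i < n" for i using \<sigma>eq[OF that \<sigma>in[OF that]] by simp
  define c where "c i = A $$ (\<sigma> i, i) div 2" for i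
  show ?thesis
  proof (intro exI[of _ \<sigma>] exI[of _ c] allI impI conjI)
    fix i assume i: "i < n"
    show "\<sigma> i < n" "\<sigma> (\<sigma> i) = \<sigma> i" using \<sigma>in[OF i] idem[OF i] by simp_all
    show "c i = 1 \<or> c i = 2" using dbl[OF i] by (auto simp: c_def)
    show "c (\<sigma> i) = 1" unfolding c_def idem[OF i] using A2[OF \<sigma>in(1)[OF i]] by simp
    show "form n B (X i) x = c i * form n B (X (\<sigma> i)) x" for x
    proof -
      have "A $$ (\<sigma> i, i) > 0" using dbl[OF i] by auto
      from par[OF \<sigma>in(1)[OF i] i this, of x] show ?thesis using dbl[OF i] by (auto simp: c_def)
    qed
    fix j assume j: "j < n" and ne: "\<sigma> i \<noteq> \<sigma> j"
    show "A $$ (\<sigma> i, \<sigma> j) \<le> 0"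
    proof (rule ccontr)
      assume "\<not> ?thesis"
      then have "P (\<sigma> i) (\<sigma> j)" by (simp add: P_def)
      then have "\<sigma> (\<sigma> i) = \<sigma> (\<sigma> j)" using \<sigma>eq \<sigma>in(1)[OF i] \<sigma>in(1)[OF j] by blast
      then show False using ne idem i j by simp
    qed
  qed
qed

text \<open>Linear independence of vectors with pairwise non-positive products in the half space of positive
  products with \<open>\<rho>\<close>: split a combination y as \<open>y\<^sup>+ - y\<^sup>-\<close> according to the signs of its coefficients. Then
  \<open>(y, y) \<ge> (y\<^sup>+, y\<^sup>+) + (y\<^sup>-, y\<^sup>-)\<close>, and a nonzero \<open>y\<^sup>+\<close> or \<open>y\<^sup>-\<close> is not in the radical because its product
  with \<open>\<rho>\<close> is positive.\<close>

lemma obtuse_family_pd: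
  assumes pB: "psd_form n B" and r: "realizes n B X A" and S: "S \<subseteq> {..<dim_row A}"
    and h: "\<And>i. i \<in> S \<Longrightarrow> form n B (X i) \<rho> > 0"
    and ob: "\<And>i j. i \<in> S \<Longrightarrow> j \<in> S \<Longrightarrow> i \<noteq> j \<Longrightarrow> A $$ (i, j) \<le> 0"
  shows "pd_gcm S (\<lambda>i j. A $$ (i, j)) (\<lambda>i. form n B (X i) (X i))"
proof (rule pd_gcmI)
  show fin: "finite S" using S finite_subset by blast
  define Q where "Q i j = form n B (X i) (X j)" for i j
  have Qs: "Q i j = Q j i" for i j unfolding Q_def by (rule psd_form_sym[OF pB])
  have Qp: "Q i i > 0" if "i \<in> S" for i using r that S by (auto simp: realizes_def Q_def)
  have AQ: "A $$ (i, j) * Q i i = 2 * Q i j" if "i \<in> S" "j \<in> S" for i j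
    using r that S unfolding realizes_def Q_def by blast
  show "form n B (X i) (X i) > 0" if "i \<in> S" for i using Qp[OF that] by (simp add: Q_def)
  show "A $$ (i, i) = 2" if "i \<in> S" for i using AQ[OF that that] Qp[OF that] by simp
  show "A $$ (i, j) \<le> 0" if "i \<in> S" "j \<in> S" "i \<noteq> j" for i j by (rule ob[OF that])
  show "form n B (X i) (X i) * A $$ (i, j) = form n B (X j) (X j) * A $$ (j, i)" if "i \<in> S" "j \<in> S" for i j
    using AQ[OF that] AQ[OF that(2,1)] Qs[of i j] by (simp add: Q_def mult.commute)
  have Qn: "Q i j \<le> 0" if "i \<in> S" "j \<in> S" "i \<noteq> j" for i j
  proof -
    have "A $$ (i, j) * Q i i \<le> 0" using ob[OF that] Qp[OF that(1)] by (simp add: mult_nonpos_nonneg)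
    then show ?thesis using AQ[OF that(1,2)] by simp
  qed
  fix x :: "nat \<Rightarrow> real" assume x: "\<exists>i\<in>S. x i \<noteq> 0"
  define y where "y f = (\<lambda>p. \<Sum>i\<in>S. f i * real_of_int (X i p))" for f :: "nat \<Rightarrow> real"
  have qy: "form n B (y f) (y g) = (\<Sum>i\<in>S. \<Sum>j\<in>S. real_of_int (Q i j) * f i * g j)" for f g
    unfolding y_def form_sum_left form_sum_right form_smult_left form_smult_right Q_def of_int_form
    by (simp add: sum_distrib_left mult_ac)
  have yh: "form n B (y f) (\<lambda>p. real_of_int (\<rho> p)) = (\<Sum>i\<in>S. f i * of_int (form n B (X i) \<rho>))" for f
    unfolding y_def form_sum_left form_smult_left of_int_form ..
  define xp where "xp i = max (x i) 0" for i
  define xm where "xm i = max (- x i) 0" for i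
  have xpm: "x i = xp i - xm i" "xp i \<ge> 0" "xm i \<ge> 0" "xp i * xm i = 0" for i
    by (auto simp: xp_def xm_def max_def)
  have nonneg: "form n B (y f) (y f) \<ge> 0" for f using pB by (auto simp: psd_form_def)
  have pos: "form n B (y f) (y f) > 0" if f: "\<And>i. f i \<ge> 0" "\<exists>i\<in>S. f i \<noteq> 0" for f
  proof (rule ccontr)
    assume "\<not> ?thesis"
    then have "form n B (y f) (y f) = 0" using nonneg[of f] by simp
    then have "form n B (y f) (\<lambda>p. real_of_int (\<rho> p)) = 0" by (rule psd_form_radical[OF pB])
    then have "(\<Sum>i\<in>S. f i * of_int (form n B (X i) \<rho>)) = 0" unfolding yh .
    moreover have "f i * of_int (form n B (X i) \<rho>) \<ge> 0" if "i \<in> S" for i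
      using f(1) h[OF that] by simp
    ultimately have "\<forall>i\<in>S. f i * of_int (form n B (X i) \<rho>) = 0"
      using fin by (subst (asm) sum_nonneg_eq_0_iff) auto
    then show False using f(2) h by fastforce
  qed
  have cross: "form n B (y xp) (y xm) \<le> 0"
    unfolding qy
  proof (intro sum_nonpos)
    fix i j assume ij: "i \<in> S" "j \<in> S"
    show "real_of_int (Q i j) * xp i * xm j \<le> 0"
    proof (cases "i = j")
      case True then show ?thesis using xpm(4)[of i] by (metis mult.assoc mult_zero_right order_refl)
    next
      case False
      then have "real_of_int (Q i j) \<le> 0" using Qn[OF ij] by simp
      then show ?thesis using xpm(2)[of i] xpm(3)[of j] by (intro mult_nonpos_nonneg)
    qed
  qed
  have "0 < form n B (y xp) (y xp) + form n B (y xm) (y xm)"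
  proof (cases "\<exists>i\<in>S. xp i \<noteq> 0")
    case True
    then show ?thesis using pos[of xp] nonneg[of xm] xpm(2) by auto
  next
    case False
    then have "\<exists>i\<in>S. xm i \<noteq> 0" using x xpm(1) by auto
    then show ?thesis using pos[of xm] nonneg[of xp] xpm(3) by auto
  qed
  also have "\<dots> \<le> form n B (y x) (y x)"
  proof -
    have "y x = (\<lambda>p. y xp p - 1 * y xm p)"
      unfolding y_def by (rule ext) (simp add: xpm(1) left_diff_distrib sum_subtractf)
    then have "form n B (y x) (y x) = form n B (y xp) (y xp) - 2 * form n B (y xp) (y xm) + form n B (y xm) (y xm)"
      using psd_form_sym[OF pB, of "y xm" "y xp"] by (simp only: form_diff_left form_diff_right) simp
    then show ?thesis using cross by simp
  qed
  also have "2 * form n B (y x) (y x) = (\<Sum>i\<in>S. \<Sum>j\<in>S. of_int (Q i i * A $$ (i, j)) * x i * x j)"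
    unfolding qy sum_distrib_left
  proof (intro sum.cong refl)
    fix i j assume ij: "i \<in> S" "j \<in> S"
    have "real_of_int (Q i i * A $$ (i, j)) = 2 * of_int (Q i j)"
      using AQ[OF ij] by (metis mult.commute of_int_mult of_int_numeral)
    then show "2 * (real_of_int (Q i j) * x i * x j) = of_int (Q i i * A $$ (i, j)) * x i * x j" by simp
  qed
  finally show "0 < (\<Sum>i\<in>S. \<Sum>j\<in>S. of_int (form n B (X i) (X i) * A $$ (i, j)) * x i * x j)"
    by (simp add: Q_def)
qed

section \<open>Dynkin diagrams and root lengths\<close>

text \<open>Squared lengths of the simple roots, normalised so that the shortest ones have squared length 1.\<close>

fun sqlen :: "family \<Rightarrow> nat \<Rightarrow> nat \<Rightarrow> int" where
  "sqlen Type_B l i = (if i = l - 1 then 1 else 2)"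
| "sqlen Type_C l i = (if i = l - 1 then 2 else 1)"
| "sqlen Type_F l i = (if i \<le> 1 then 2 else 1)"
| "sqlen Type_G l i = (if i = 0 then 1 else 3)"
| "sqlen _ l i = 1"

lemma sqlen_pos: "sqlen X l i > 0"
  by (cases X) auto

lemma dynkin_entry_diag: "dynkin_entry X l (i, i) = 2" by simp

lemma sqlen_sym:
  assumes "valid_type X l" "i < l" "j < l"
  shows "sqlen X l i * dynkin_entry X l (i, j) = sqlen X l j * dynkin_entry X l (j, i)"
proof -
  consider "i = j" | "j = Suc i" | "i = Suc j" | "i \<noteq> j" "j \<noteq> Suc i" "i \<noteq> Suc j" by blast
  note pos = this
  show ?thesis
  proof (cases X)
    case Type_B
    show ?thesis using pos by cases (use assms Type_B in auto)
  next
    case Type_C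
    show ?thesis using pos by cases (use assms Type_C in auto)
  next
    case Type_F
    show ?thesis using pos by cases (use assms Type_F in auto)
  next
    case Type_G
    show ?thesis using pos by cases (use assms Type_G in auto)
  qed (auto simp: dynkin_entry_simply_laced simp del: dynkin_entry.simps dynkin_edge.simps)
qed

lemma dynkin_nonpos: "i \<noteq> j \<Longrightarrow> dynkin_entry X l (i, j) \<le> 0"
  by simp

lemma dynkin_zero_iff: "dynkin_entry X l (i, j) = 0 \<longleftrightarrow> dynkin_entry X l (j, i) = 0"
  by auto

text \<open>Dynkin diagrams are trees rooted at the vertex 0, each vertex being numbered after its parent, so that
  connectedness arguments become inductions.\<close>

lemma dynkin_parent:
  assumes "valid_type X l" "0 < i" "i < l"
  shows "\<exists>j<i. dynkin_entry X l (i, j) \<noteq> 0"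
proof -
  define j where "j = (if X = Type_D \<and> i = l - 1 then l - 3 else if X = Type_E \<and> i = l - 1 then 2 else i - 1)"
  have "j < i" using assms by (cases X) (auto simp: j_def)
  moreover have "dynkin_edge X l j i" using assms by (cases X) (auto simp: j_def)
  ultimately show ?thesis by (intro exI[of _ j]) auto
qed

text \<open>In each diagram the vertices of one length form a subtree with simple bonds.\<close>

lemma dynkin_parent_same_sqlen:
  assumes "valid_type X l" "i < l"
  shows "(\<forall>j<i. sqlen X l j \<noteq> sqlen X l i) \<or>
    (\<exists>j<i. sqlen X l j = sqlen X l i \<and> dynkin_entry X l (i, j) = -1 \<and> dynkin_entry X l (j, i) = -1)"
proof (cases "\<forall>j<i. sqlen X l j \<noteq> sqlen X l i")
  case False
  then obtain k where k: "k < i" "sqlen X l k = sqlen X l i" by blast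
  define j where "j = (if X = Type_D \<and> i = l - 1 then l - 3 else if X = Type_E \<and> i = l - 1 then 2 else i - 1)"
  have "j < i" using assms k by (cases X) (auto simp: j_def)
  moreover have "dynkin_edge X l j i" using assms k by (cases X) (auto simp: j_def)
  moreover have "sqlen X l j = sqlen X l i" using assms k by (cases X) (auto simp: j_def split: if_splits)
  moreover have "dynkin_entry X l (i, j) = -1 \<and> dynkin_entry X l (j, i) = -1"
  proof (cases X)
    case Type_B then show ?thesis using assms k by (auto simp: j_def split: if_splits)
  next
    case Type_C then show ?thesis using assms k by (auto simp: j_def split: if_splits)
  next
    case Type_F then show ?thesis using assms k by (auto simp: j_def split: if_splits)
  next
    case Type_G then show ?thesis using assms k by (auto simp: j_def split: if_splits)
  qed (use \<open>dynkin_edge X l j i\<close> \<open>j < i\<close> in auto)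
  ultimately show ?thesis by blast
qed blast

text \<open>The condition that the double of the simple root p can be added: the entries
  \<open>2 (2\<alpha>\<^sub>p, \<alpha>\<^sub>q) / (2\<alpha>\<^sub>p, 2\<alpha>\<^sub>p)\<close> are half of those in row p.\<close>

lemma dynkin_even_row:
  assumes "valid_type X l" "p < l" "\<And>q. q < l \<Longrightarrow> even (dynkin_entry X l (p, q))"
  shows "X = Type_A \<and> l = 1 \<or> X = Type_B \<and> p = l - 1"
proof (rule ccontr)
  assume n: "\<not> ?thesis"
  define q where "q = (if X = Type_D \<and> p = l - 1 then l - 3 else if X = Type_E \<and> p = l - 1 then 2 else
    if p = 0 then 1 else p - 1)"
  have l2: "l \<ge> 2" using assms(1,2) n by (cases X) auto
  have q: "q < l" using assms(1,2) l2 by (cases X) (auto simp: q_def)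
  define q' where "q' = (if X = Type_F \<and> p = 2 then 3 else if X = Type_G then 1 - p else q)"
  have q': "q' < l" using q assms(1,2) by (cases X) (auto simp: q'_def)
  have "odd (dynkin_entry X l (p, q'))"
    using assms(1,2) n l2 by (cases X) (auto simp: q_def q'_def)
  then show False using assms(3)[OF q'] by simp
qed

declare dynkin_entry.simps [simp del] dynkin_edge.simps [simp del] dynkin_entry_diag [simp]

lemma dynkin_sqlen_unique:
  assumes v: "valid_type X l" and i: "i < l"
    and sym: "\<And>i j. i < l \<Longrightarrow> j < l \<Longrightarrow> D i * dynkin_entry X l (i, j) = D j * dynkin_entry X l (j, i)"
  shows "D i * sqlen X l 0 = D 0 * sqlen X l i"
  using i
proof (induction i rule: less_induct)
  case (less i)
  show ?case
  proof (cases "i = 0")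
    case False
    obtain j where j: "j < i" "dynkin_entry X l (i, j) \<noteq> 0"
      using dynkin_parent[OF v _ less.prems] False by blast
    let ?e = "dynkin_entry X l (i, j)" and ?e' = "dynkin_entry X l (j, i)"
    have jl: "j < l" using j less.prems by simp
    have "(D i * sqlen X l 0) * ?e = (D i * ?e) * sqlen X l 0" by (simp only: mult_ac)
    also have "\<dots> = (D j * ?e') * sqlen X l 0" by (simp only: sym[OF less.prems jl])
    also have "\<dots> = (D j * sqlen X l 0) * ?e'" by (simp only: mult_ac)
    also have "\<dots> = (D 0 * sqlen X l j) * ?e'" by (simp only: less.IH[OF j(1) jl])
    also have "\<dots> = D 0 * (sqlen X l j * ?e')" by (simp only: mult_ac)
    also have "\<dots> = D 0 * (sqlen X l i * ?e)" by (simp only: sqlen_sym[OF v less.prems jl])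
    finally have "(D i * sqlen X l 0) * ?e = (D 0 * sqlen X l i) * ?e" by (simp only: mult_ac)
    then show ?thesis using j(2) mult_right_cancel by blast
  qed simp
qed

lemma dynkin_indecomposable:
  assumes v: "valid_type X l"
  shows "indecomposable (mat l l (dynkin_entry X l))"
  unfolding indecomposable_def
proof (rule notI, elim exE conjE)
  fix I1 I2
  assume h: "I1 \<noteq> {}" "I2 \<noteq> {}" "I1 \<inter> I2 = {}" "I1 \<union> I2 = {..<dim_row (mat l l (dynkin_entry X l))}"
    "\<forall>i\<in>I1. \<forall>j\<in>I2. mat l l (dynkin_entry X l) $$ (i, j) = 0 \<and> mat l l (dynkin_entry X l) $$ (j, i) = 0"
  have u: "I1 \<union> I2 = {..<l}" using h(4) by simp
  have z: "dynkin_entry X l (i, j) = 0" "dynkin_entry X l (j, i) = 0" if "i \<in> I1" "j \<in> I2" for i j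
  proof -
    have "i < l" "j < l" using that u by auto
    then show "dynkin_entry X l (i, j) = 0" "dynkin_entry X l (j, i) = 0"
      using h(5) that by (metis index_mat(1) case_prod_conv)+
  qed
  have same: "i \<in> I1 \<longleftrightarrow> 0 \<in> I1" if "i < l" for i
    using that
  proof (induction i rule: less_induct)
    case (less i)
    show ?case
    proof (cases "i = 0")
      case False
      obtain j where j: "j < i" "dynkin_entry X l (i, j) \<noteq> 0"
        using dynkin_parent[OF v _ less.prems] False by blast
      have "i \<in> I1 \<longleftrightarrow> j \<in> I1"
      proof (rule ccontr)
        assume ne: "\<not> ?thesis"
        have "i \<in> I1 \<union> I2" "j \<in> I1 \<union> I2" using u j less.prems by auto
        then show False using ne z[of i j] z[of j i] j(2) h(3) by blast
      qed
      then show ?thesis using less.IH[OF j(1)] j less.prems by simp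
    qed simp
  qed
  obtain a b where "a \<in> I1" "b \<in> I2" using h(1,2) by blast
  moreover have "a < l" "b < l" using u \<open>a \<in> I1\<close> \<open>b \<in> I2\<close> by auto
  ultimately have "b \<in> I1" using same[of a] same[of b] by simp
  then show False using \<open>b \<in> I2\<close> h(3) by blast
qed

section \<open>Braid equivalence of standard affinizations of equal type\<close>

text \<open>Index i of the standard affinization matrix M belongs to \<open>c\<^sub>i\<close> times the simple root \<open>\<sigma>\<^sub>i\<close>. The
  first l indices carry each simple root once, in any order, which absorbs the permutation in
  the definition of the type.\<close>

definition std_data :: "int mat \<Rightarrow> family \<Rightarrow> nat \<Rightarrow> nat \<Rightarrow> (nat \<Rightarrow> nat) \<Rightarrow> (nat \<Rightarrow> int) \<Rightarrow> bool" where
  "std_data M X l d \<sigma> c \<longleftrightarrow> valid_type X l \<and> square_mat M \<and> dim_row M = l + d \<and>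
     bij_betw \<sigma> {..<l} {..<l} \<and> (\<forall>i<l. c i = 1) \<and> (\<forall>i<l + d. \<sigma> i < l \<and> (c i = 1 \<or> c i = 2)) \<and>
     (\<forall>i<l + d. \<forall>j<l + d. M $$ (i, j) * c i = c j * dynkin_entry X l (\<sigma> i, \<sigma> j))"

definition dynkin_form :: "family \<Rightarrow> nat \<Rightarrow> nat \<Rightarrow> nat \<Rightarrow> int" where
  "dynkin_form X l p q = sqlen X l p * dynkin_entry X l (p, q)"

definition std_vec :: "(nat \<Rightarrow> nat) \<Rightarrow> (nat \<Rightarrow> int) \<Rightarrow> nat \<Rightarrow> nat \<Rightarrow> int" where
  "std_vec \<sigma> c i = (\<lambda>p. c i * unitf (\<sigma> i) p)"

lemma valid_type_pos: "valid_type X l \<Longrightarrow> l > 0"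
  by (cases X) auto

lemma form_std_vec:
  assumes "\<sigma> i < l" "\<sigma> j < l"
  shows "form l (dynkin_form X l) (std_vec \<sigma> c i) (std_vec \<sigma> c j) =
    c i * c j * (sqlen X l (\<sigma> i) * dynkin_entry X l (\<sigma> i, \<sigma> j))"
  unfolding std_vec_def form_smult_left form_smult_right using assms
  by (simp add: form_unit dynkin_form_def del: dynkin_entry.simps)

lemma realizes_std_vec:
  assumes v: "valid_type X l" and sq: "square_mat M"
    and \<sigma>: "\<And>i. i < dim_row M \<Longrightarrow> \<sigma> i < l" and c: "\<And>i. i < dim_row M \<Longrightarrow> c i > 0"
  shows "realizes l (dynkin_form X l) (std_vec \<sigma> c) M \<longleftrightarrow>
    (\<forall>i<dim_row M. \<forall>j<dim_row M. M $$ (i, j) * c i = c j * dynkin_entry X l (\<sigma> i, \<sigma> j))"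
proof -
  have e: "M $$ (i, j) * form l (dynkin_form X l) (std_vec \<sigma> c i) (std_vec \<sigma> c i) =
      2 * form l (dynkin_form X l) (std_vec \<sigma> c i) (std_vec \<sigma> c j) \<longleftrightarrow>
      M $$ (i, j) * c i = c j * dynkin_entry X l (\<sigma> i, \<sigma> j)" if "i < dim_row M" "j < dim_row M" for i j
  proof -
    let ?k = "2 * c i * sqlen X l (\<sigma> i)"
    have "?k \<noteq> 0" using c[OF that(1)] sqlen_pos[of X l "\<sigma> i"] by simp
    moreover have "M $$ (i, j) * form l (dynkin_form X l) (std_vec \<sigma> c i) (std_vec \<sigma> c i) = ?k * (M $$ (i, j) * c i)"
      unfolding form_std_vec[of \<sigma> i l i, OF \<sigma>[OF that(1)] \<sigma>[OF that(1)]] dynkin_entry_diag by (simp only: mult_ac)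
    moreover have "2 * form l (dynkin_form X l) (std_vec \<sigma> c i) (std_vec \<sigma> c j) =
        ?k * (c j * dynkin_entry X l (\<sigma> i, \<sigma> j))"
      unfolding form_std_vec[of \<sigma> i l j, OF \<sigma>[OF that(1)] \<sigma>[OF that(2)]] by (simp only: mult_ac)
    ultimately show ?thesis using mult_left_cancel by metis
  qed
  have pos: "form l (dynkin_form X l) (std_vec \<sigma> c i) (std_vec \<sigma> c i) > 0" if "i < dim_row M" for i
    unfolding form_std_vec[of \<sigma> i l i, OF \<sigma>[OF that] \<sigma>[OF that]] dynkin_entry_diag
    using c[OF that] sqlen_pos[of X l "\<sigma> i"] by simp
  have sym: "dynkin_form X l i j = dynkin_form X l j i" if "i < l" "j < l" for i j
    unfolding dynkin_form_def by (rule sqlen_sym[OF v that])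
  show ?thesis unfolding realizes_def using sq e pos sym by blast
qed

lemma std_dataD:
  assumes "std_data M X l d \<sigma> c"
  shows "valid_type X l" "square_mat M" "dim_row M = l + d" "i < l \<Longrightarrow> c i = 1"
    "i < l + d \<Longrightarrow> \<sigma> i < l" "i < l + d \<Longrightarrow> c i = 1 \<or> c i = 2"
    "i < l + d \<Longrightarrow> j < l + d \<Longrightarrow> M $$ (i, j) * c i = c j * dynkin_entry X l (\<sigma> i, \<sigma> j)"
    "\<sigma> ` {..<l} = {..<l}"
  using assms unfolding std_data_def bij_betw_def by blast+

lemma std_data_realizes:
  assumes "std_data M X l d \<sigma> c"
  shows "realizes l (dynkin_form X l) (std_vec \<sigma> c) M"
proof -
  have c: "c i > 0" if "i < dim_row M" for i
  proof -
    have "c i = 1 \<or> c i = 2" using std_dataD(6)[OF assms, of i] std_dataD(3)[OF assms] that by simp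
    then show ?thesis by auto
  qed
  show ?thesis
    by (rule realizes_std_vec[THEN iffD2])
      (use std_dataD[OF assms] c in auto)
qed

lemma std_data_SIM:
  assumes sd: "std_data M X l d \<sigma> c"
  shows "SIM M"
proof (rule realizes_SIM[OF std_data_realizes[OF sd]])
  show "dim_row M > 0" using std_dataD(3)[OF sd] valid_type_pos[OF std_dataD(1)[OF sd]] by simp
qed

lemma std_data_unique:
  assumes "std_data M X l d \<sigma> c" "std_data M' X l d \<sigma>' c'"
    "\<And>i. i < l + d \<Longrightarrow> \<sigma> i = \<sigma>' i \<and> c i = c' i"
  shows "M = M'"
  by (rule realizes_unique[OF std_data_realizes[OF assms(1)] std_data_realizes[OF assms(2)]])
    (use assms in \<open>auto simp: std_data_def std_vec_def\<close>)

lemma std_data_permute: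
  assumes sd: "std_data M X l d \<sigma> c" and p: "p permutes {..<l + d}" and pl: "\<And>i. i < l \<Longrightarrow> p i < l"
  shows "std_data (permute_indices p M) X l d (\<sigma> \<circ> p) (c \<circ> p)"
proof -
  have pd: "p i < l + d" if "i < l + d" for i using permutes_in_image[OF p, of i] that by simp
  have "inj_on p {..<l}" using permutes_inj[OF p] by (auto simp: inj_on_def)
  moreover have "p ` {..<l} \<subseteq> {..<l}" using pl by auto
  ultimately have "bij_betw p {..<l} {..<l}"
    by (metis bij_betw_def endo_inj_surj finite_lessThan)
  then have "bij_betw (\<sigma> \<circ> p) {..<l} {..<l}"
    using sd by (auto simp: std_data_def intro: bij_betw_trans)
  then show ?thesis using sd pd pl unfolding std_data_def
    by (simp add: permute_indices_def del: dynkin_entry.simps)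
qed

text \<open>Let \<open>\<alpha>\<close> be the simple root of index i and \<open>\<beta>\<close> an adjacent one of the same length. The reflection in \<open>\<beta>\<close>
  followed by that in \<open>\<alpha>\<close> sends \<open>\<alpha>\<close> over \<open>\<alpha> + \<beta>\<close> to \<open>\<beta>\<close>. Both are braid transformations because \<open>\<alpha>\<close> and
  \<open>\<beta>\<close> occur among the first l members. The intermediate matrix is not standard.\<close>

lemma std_data_move_adjacent:
  assumes sd: "std_data M X l d \<sigma> c" and i: "l \<le> i" "i < l + d" and q: "q < l"
    and e: "dynkin_entry X l (\<sigma> i, q) = -1" "dynkin_entry X l (q, \<sigma> i) = -1"
  shows "\<exists>M'. braid_step\<^sup>*\<^sup>* M M' \<and> std_data M' X l d (\<sigma>(i := q)) c"
proof -
  let ?B = "dynkin_form X l"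
  have v: "valid_type X l" and dM: "dim_row M = l + d" using sd by (auto simp: std_data_def)
  have SM: "SIM M" by (rule std_data_SIM[OF sd])
  have img: "\<sigma> ` {..<l} = {..<l}" using sd by (auto simp: std_data_def bij_betw_def)
  have \<sigma>i: "\<sigma> i < l" using sd i by (auto simp: std_data_def)
  obtain a where a: "a < l" "\<sigma> a = q" using img q by (metis imageE lessThan_iff)
  obtain b where b: "b < l" "\<sigma> b = \<sigma> i" using img \<sigma>i by (metis imageE lessThan_iff)
  have c1: "c a = 1" "c b = 1" using sd a b by (auto simp: std_data_def)
  define k where "k = c i"
  have kk: "k > 0" using sd i by (auto simp: std_data_def k_def)
  have ai: "a \<noteq> i" "b \<noteq> i" using a b i by auto
  define M1 where "M1 = tau a i M"
  define Y1 where "Y1 = (std_vec \<sigma> c)(i := (\<lambda>p. std_vec \<sigma> c i p - M $$ (a, i) * std_vec \<sigma> c a p))"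
  have Mai: "M $$ (a, i) = - k"
  proof -
    have "M $$ (a, i) * c a = c i * dynkin_entry X l (\<sigma> a, \<sigma> i)"
      using a i by (intro std_dataD(7)[OF sd]) auto
    then show ?thesis unfolding a(2) e(2) c1 k_def by simp
  qed
  have r1: "realizes l ?B Y1 M1"
    unfolding Y1_def M1_def by (rule realizes_tau[OF std_data_realizes[OF sd]]) (use a i dM in auto)
  have d1: "dim_row M1 = l + d" by (simp add: M1_def dM)
  have S1: "SIM M1" by (rule realizes_SIM[OF r1]) (use d1 i in simp)
  have Y1i: "Y1 i = (\<lambda>p. k * unitf (\<sigma> i) p + k * unitf q p)"
    unfolding Y1_def Mai by (simp add: std_vec_def a c1 k_def)
  have Y1o: "Y1 j = std_vec \<sigma> c j" if "j \<noteq> i" for j using that by (simp add: Y1_def)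
  define M2 where "M2 = tau b i M1"
  define Y2 where "Y2 = Y1(i := (\<lambda>p. Y1 i p - M1 $$ (b, i) * Y1 b p))"
  have r2: "realizes l ?B Y2 M2"
    unfolding Y2_def M2_def by (rule realizes_tau[OF r1]) (use b i d1 in auto)
  have d2: "dim_row M2 = l + d" by (simp add: M2_def d1)
  have Ybb: "Y1 b = unitf (\<sigma> i)" unfolding Y1o[OF ai(2)] by (simp add: std_vec_def b c1)
  have M1bi: "M1 $$ (b, i) = k"
  proof -
    let ?u = "unitf (\<sigma> i) :: nat \<Rightarrow> int"
    have eq: "M1 $$ (b, i) * form l ?B (Y1 b) (Y1 b) = 2 * form l ?B (Y1 b) (Y1 i)"
      using r1 d1 b i by (auto simp: realizes_def)
    have n1: "form l ?B ?u ?u = 2 * sqlen X l (\<sigma> i)"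
      using form_unit[OF \<sigma>i \<sigma>i, of ?B, where 'a = int] dynkin_entry_diag[of X l "\<sigma> i"] by (simp add: dynkin_form_def)
    have n2: "form l ?B ?u (unitf q) = - sqlen X l (\<sigma> i)"
      using form_unit[OF \<sigma>i q, of ?B, where 'a = int] e(1) by (simp add: dynkin_form_def del: dynkin_entry.simps)
    have "form l ?B ?u (\<lambda>p. k * ?u p + k * unitf q p) = form l ?B ?u (\<lambda>p. k * ?u p - (-k) * unitf q p)" by simp
    also have "\<dots> = k * form l ?B ?u ?u + k * form l ?B ?u (unitf q)"
      unfolding form_diff_right form_smult_right by simp
    also have "\<dots> = k * sqlen X l (\<sigma> i)" unfolding n1 n2 by (simp add: algebra_simps)
    finally have "M1 $$ (b, i) * (2 * sqlen X l (\<sigma> i)) = k * (2 * sqlen X l (\<sigma> i))"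
      using eq unfolding Ybb Y1i n1 by simp
    then show ?thesis using sqlen_pos[of X l "\<sigma> i"] by simp
  qed
  have Y2: "Y2 = std_vec (\<sigma>(i := q)) c"
  proof (rule ext)
    fix j
    show "Y2 j = std_vec (\<sigma>(i := q)) c j"
      unfolding Y2_def M1bi Ybb using Y1i Y1o[of j] by (auto simp: std_vec_def k_def)
  qed
  have sdM2: "std_data M2 X l d (\<sigma>(i := q)) c"
  proof -
    have h: "\<And>j. j < l + d \<Longrightarrow> (\<sigma>(i := q)) j < l" "\<And>j. j < l + d \<Longrightarrow> c j > 0"
      using sd q by (auto simp: std_data_def)
    have sq: "square_mat M2" using r2 by (simp add: realizes_def)
    have "\<forall>i'<dim_row M2. \<forall>j<dim_row M2. M2 $$ (i', j) * c i' = c j * dynkin_entry X l ((\<sigma>(i := q)) i', (\<sigma>(i := q)) j)"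
      using r2 unfolding Y2 by (subst (asm) realizes_std_vec[OF v sq]) (use h d2 in auto)
    moreover have "bij_betw (\<sigma>(i := q)) {..<l} {..<l}"
    proof -
      have "bij_betw (\<sigma>(i := q)) {..<l} {..<l} \<longleftrightarrow> bij_betw \<sigma> {..<l} {..<l}"
        by (rule bij_betw_cong) (use i in auto)
      then show ?thesis using sd by (simp add: std_data_def)
    qed
    ultimately show ?thesis using sd h(1) d2 sq unfolding std_data_def by auto
  qed
  have "braid_step M M1" unfolding M1_def by (rule braid_step_tau[OF SM]) (use a i dM in auto)
  moreover have "braid_step M1 M2" unfolding M2_def by (rule braid_step_tau[OF S1]) (use b i d1 in auto)
  ultimately show ?thesis using sdM2 by (meson converse_rtranclp_into_rtranclp rtranclp.rtrancl_refl)
qed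


definition simple_bond :: "family \<Rightarrow> nat \<Rightarrow> nat \<Rightarrow> nat \<Rightarrow> bool" where
  "simple_bond X l p q \<longleftrightarrow> p < l \<and> q < l \<and> dynkin_entry X l (p, q) = -1 \<and> dynkin_entry X l (q, p) = -1"

lemma same_sqlen_simple_bond_path:
  assumes v: "valid_type X l" and p: "p < l" and q: "q < l" and eq: "sqlen X l p = sqlen X l q"
  shows "(simple_bond X l)\<^sup>*\<^sup>* p q"
proof -
  define m where "m = (LEAST j. sqlen X l j = sqlen X l q)"
  have down: "(simple_bond X l)\<^sup>*\<^sup>* i m" if "i < l" "sqlen X l i = sqlen X l q" for i
    using that
  proof (induction i rule: less_induct)
    case (less i)
    consider "\<forall>j<i. sqlen X l j \<noteq> sqlen X l i"
      | j where "j < i" "sqlen X l j = sqlen X l i" "dynkin_entry X l (i, j) = -1" "dynkin_entry X l (j, i) = -1"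
      using dynkin_parent_same_sqlen[OF v less.prems(1)] by blast
    then show ?case
    proof cases
      case 1
      then have "m = i" unfolding m_def using less.prems(2) by (intro Least_equality) (auto simp: not_less[symmetric])
      then show ?thesis by simp
    next
      case (2 j)
      then have "simple_bond X l i j" using less.prems by (simp add: simple_bond_def)
      moreover have "(simple_bond X l)\<^sup>*\<^sup>* j m" using less.IH[OF 2(1)] less.prems 2 by simp
      ultimately show ?thesis by (rule converse_rtranclp_into_rtranclp)
    qed
  qed
  have "symp (simple_bond X l)" by (rule sympI) (simp add: simple_bond_def)
  then have "(simple_bond X l)\<^sup>*\<^sup>* m q" using down[OF q refl] by (blast dest: symp_rtranclp sympD)
  then show ?thesis using down[OF p eq] by (rule rtranclp_trans[rotated])
qed

lemma std_data_move:
  assumes sd: "std_data M X l d \<sigma> c" and i: "l \<le> i" "i < l + d"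
    and q: "q < l" "sqlen X l q = sqlen X l (\<sigma> i)"
  shows "\<exists>M'. braid_step\<^sup>*\<^sup>* M M' \<and> std_data M' X l d (\<sigma>(i := q)) c"
proof -
  have "(simple_bond X l)\<^sup>*\<^sup>* (\<sigma> i) q"
    using same_sqlen_simple_bond_path[OF std_dataD(1)[OF sd] std_dataD(5)[OF sd i(2)] q(1)] q(2) by simp
  then show ?thesis
  proof (induction rule: rtranclp_induct)
    case base
    show ?case using sd by (intro exI[of _ M]) simp
  next
    case (step r q)
    then obtain M1 where M1: "braid_step\<^sup>*\<^sup>* M M1" "std_data M1 X l d (\<sigma>(i := r)) c" by blast
    then obtain M2 where "braid_step\<^sup>*\<^sup>* M1 M2" "std_data M2 X l d ((\<sigma>(i := r))(i := q)) c"
      using std_data_move_adjacent[OF M1(2) i, of q] step.hyps(2) by (auto simp: simple_bond_def)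
    then show ?case using M1(1) by (metis fun_upd_upd rtranclp_trans)
  qed
qed

lemma std_data_move_all:
  assumes sd: "std_data M X l d \<sigma> c" and sd': "std_data M' X l d \<sigma>' c"
    and o: "\<And>i. i < l \<Longrightarrow> \<sigma> i = \<sigma>' i" and nm: "\<And>i. i < l + d \<Longrightarrow> sqlen X l (\<sigma>' i) = sqlen X l (\<sigma> i)"
  shows "braid_step\<^sup>*\<^sup>* M M'"
proof -
  have "\<exists>M2. braid_step\<^sup>*\<^sup>* M M2 \<and> std_data M2 X l d (\<lambda>j. if j < l + k then \<sigma>' j else \<sigma> j) c" if "k \<le> d" for k
    using that
  proof (induction k)
    case 0
    have "(\<lambda>j. if j < l + 0 then \<sigma>' j else \<sigma> j) = \<sigma>" using o by auto
    then show ?case using sd by auto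
  next
    case (Suc k)
    let ?s = "\<lambda>j. if j < l + k then \<sigma>' j else \<sigma> j"
    obtain M1 where M1: "braid_step\<^sup>*\<^sup>* M M1" "std_data M1 X l d ?s c"
      using Suc by auto
    have "\<sigma>' (l + k) < l" using std_dataD(5)[OF sd', of "l + k"] Suc.prems by simp
    then obtain M2 where M2: "braid_step\<^sup>*\<^sup>* M1 M2" "std_data M2 X l d (?s(l + k := \<sigma>' (l + k))) c"
      using std_data_move[OF M1(2), of "l + k" "\<sigma>' (l + k)"] nm[of "l + k"] Suc.prems by auto
    moreover have "?s(l + k := \<sigma>' (l + k)) = (\<lambda>j. if j < l + Suc k then \<sigma>' j else \<sigma> j)" by auto
    ultimately show ?case using M1(1) by (metis rtranclp_trans)
  qed
  from this[of d] obtain M2 where "braid_step\<^sup>*\<^sup>* M M2" "std_data M2 X l d (\<lambda>j. if j < l + d then \<sigma>' j else \<sigma> j) c"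
    by auto
  moreover have "M2 = M'" by (rule std_data_unique[OF calculation(2) sd']) auto
  ultimately show ?thesis by simp
qed

text \<open>Compare the entries in row i at the columns of the simple roots.\<close>

lemma std_data_double_row:
  assumes sd: "std_data M X l d \<sigma> c" and i: "i < l + d" "c i = 2"
  shows "X = Type_A \<and> l = 1 \<or> X = Type_B \<and> \<sigma> i = l - 1"
proof (rule dynkin_even_row)
  show "valid_type X l" "\<sigma> i < l" using std_dataD[OF sd] i by auto
  fix q assume q: "q < l"
  obtain j where j: "j < l" "\<sigma> j = q" using std_dataD(8)[OF sd] q by (metis imageE lessThan_iff)
  have "M $$ (i, j) * c i = c j * dynkin_entry X l (\<sigma> i, \<sigma> j)"
    using std_dataD(7)[OF sd] i(1) j(1) by simp
  then have "dynkin_entry X l (\<sigma> i, q) = 2 * M $$ (i, j)"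
    using std_dataD(4)[OF sd j(1)] i j by simp
  then show "even (dynkin_entry X l (\<sigma> i, q))" by simp
qed

definition longest :: "family \<Rightarrow> nat \<Rightarrow> nat \<Rightarrow> bool" where
  "longest X l p \<longleftrightarrow> (\<forall>q<l. sqlen X l q \<le> sqlen X l p)"

lemma longest_iff_sqlen_eq:
  assumes "valid_type X l" "p < l" "q < l" "longest X l p \<longleftrightarrow> longest X l q"
  shows "sqlen X l p = sqlen X l q"
  using assms by (cases X) (auto simp: longest_def split: if_splits)

lemma count_image_mset_set:
  assumes "finite A"
  shows "count (image_mset f (mset_set A)) y = card {x \<in> A. f x = y}"
proof -
  have "count (image_mset f (mset_set A)) y = (\<Sum>x\<in>f -` {y} \<inter> A. 1)"
    using assms by (auto simp: count_image_mset intro!: sum.cong)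
  also have "f -` {y} \<inter> A = {x \<in> A. f x = y}" by auto
  finally show ?thesis by simp
qed

text \<open>After a permutation, corresponding indices agree for the simple roots and have the same length and
  the same factor for the added ones; then the added roots are moved into place. A doubled simple root
  cannot be moved and does not have to be, as its place is determined by the type.\<close>

lemma std_data_braid_equivalent:
  assumes sd: "std_data M X l d \<sigma> c" and sd': "std_data M' X l d \<sigma>' c'"
    and cnt: "card {i \<in> {l..<l + d}. c i = 1 \<and> longest X l (\<sigma> i)} = card {i \<in> {l..<l + d}. c' i = 1 \<and> longest X l (\<sigma>' i)}"
      "card {i \<in> {l..<l + d}. c i = 1 \<and> \<not> longest X l (\<sigma> i)} = card {i \<in> {l..<l + d}. c' i = 1 \<and> \<not> longest X l (\<sigma>' i)}"
      "card {i \<in> {l..<l + d}. c i = 2} = card {i \<in> {l..<l + d}. c' i = 2}"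
  shows "braid_equivalent M M'"
proof -
  \<comment> \<open>labels of the indices: the simple root itself below l, and the kind of the added root above\<close>
  define L where "L \<sigma> c i = (if i < l then (0, \<sigma> i) else if c i = 2 then (3, 0) else if longest X l (\<sigma> i) then (1, 0) else (2, 0) :: nat \<times> nat)"
    for \<sigma> and c :: "nat \<Rightarrow> int" and i
  have fib: "card {i \<in> {..<l + d}. L \<sigma> c i = (t, k)} =
     (if t = 0 then if k < l then 1 else 0 else if k = 0 then
        if t = 1 then card {i \<in> {l..<l + d}. c i = 1 \<and> longest X l (\<sigma> i)} else
        if t = 2 then card {i \<in> {l..<l + d}. c i = 1 \<and> \<not> longest X l (\<sigma> i)} else
        if t = 3 then card {i \<in> {l..<l + d}. c i = 2} else 0 else 0)"
    if sd: "std_data M X l d \<sigma> c" for M \<sigma> c t k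
  proof -
    have c12: "c i = 1 \<or> c i = 2" if "i < l + d" for i using std_dataD(6)[OF sd that] .
    have img: "\<sigma> ` {..<l} = {..<l}" by (rule std_dataD(8)[OF sd])
    have inj: "inj_on \<sigma> {..<l}" using sd by (auto simp: std_data_def bij_betw_def)
    consider "t = 0" "k < l" | "t = 0" "\<not> k < l" | "t = 1" "k = 0" | "t = 2" "k = 0" | "t = 3" "k = 0"
      | "t > 3" "k = 0" | "t > 0" "k \<noteq> 0" by linarith
    then show ?thesis
    proof cases
      case 1
      then obtain a where a: "a < l" "\<sigma> a = k" using img by (metis imageE lessThan_iff)
      have "{i \<in> {..<l + d}. L \<sigma> c i = (t, k)} = {a}"
        using a 1 inj by (auto simp: L_def inj_on_def split: if_splits)
      then show ?thesis using 1 by simp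
    next
      case 2
      have "{i \<in> {..<l + d}. L \<sigma> c i = (t, k)} = {}"
        using 2 img by (auto simp: L_def split: if_splits)
      then show ?thesis using 2 by simp
    next
      case 3
      have "{i \<in> {..<l + d}. L \<sigma> c i = (t, k)} = {i \<in> {l..<l + d}. c i = 1 \<and> longest X l (\<sigma> i)}"
        using 3 c12 by (fastforce simp: L_def split: if_splits)
      then show ?thesis using 3 by simp
    next
      case 4
      have "{i \<in> {..<l + d}. L \<sigma> c i = (t, k)} = {i \<in> {l..<l + d}. c i = 1 \<and> \<not> longest X l (\<sigma> i)}"
        using 4 c12 by (fastforce simp: L_def split: if_splits)
      then show ?thesis using 4 by simp
    next
      case 5
      have "{i \<in> {..<l + d}. L \<sigma> c i = (t, k)} = {i \<in> {l..<l + d}. c i = 2}"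
        using 5 c12 by (fastforce simp: L_def split: if_splits)
      then show ?thesis using 5 by simp
    next
      case 6
      have "{i \<in> {..<l + d}. L \<sigma> c i = (t, k)} = {}"
        using 6 by (auto simp: L_def split: if_splits)
      then show ?thesis using 6 by simp
    next
      case 7
      have "{i \<in> {..<l + d}. L \<sigma> c i = (t, k)} = {}"
        using 7 by (auto simp: L_def split: if_splits)
      then show ?thesis using 7 by simp
    qed
  qed
  have "image_mset (L \<sigma>' c') (mset_set {..<l + d}) = image_mset (L \<sigma> c) (mset_set {..<l + d})"
  proof (rule multiset_eqI)
    fix y :: "nat \<times> nat"
    obtain t k where y: "y = (t, k)" by (cases y)
    show "count (image_mset (L \<sigma>' c') (mset_set {..<l + d})) y = count (image_mset (L \<sigma> c) (mset_set {..<l + d})) y"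
      unfolding y count_image_mset_set[OF finite_lessThan] fib[OF sd] fib[OF sd'] cnt by simp
  qed
  then obtain p where p: "p permutes {..<l + d}" "\<forall>i\<in>{..<l + d}. L \<sigma>' c' i = L \<sigma> c (p i)"
    by (rule image_mset_eq_implies_permutes[OF finite_lessThan])
  have pi: "p i < l + d" if "i < l + d" for i using permutes_in_image[OF p(1), of i] that by simp
  have small: "p i < l \<and> \<sigma> (p i) = \<sigma>' i" if "i < l" for i
  proof -
    have "L \<sigma>' c' i = L \<sigma> c (p i)" using p(2) that by simp
    then have "L \<sigma> c (p i) = (0, \<sigma>' i)" using that by (simp add: L_def)
    then show ?thesis by (simp add: L_def split: if_splits)
  qed
  have big: "c (p i) = c' i \<and> sqlen X l (\<sigma>' i) = sqlen X l (\<sigma> (p i))" if i: "i < l + d" for i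
  proof (cases "i < l")
    case True
    then show ?thesis using small[OF True] std_dataD(4)[OF sd, of "p i"] std_dataD(4)[OF sd' True] by simp
  next
    case False
    have eq: "L \<sigma>' c' i = L \<sigma> c (p i)" using p(2) i by simp
    have c12: "c (p i) = 1 \<or> c (p i) = 2" "c' i = 1 \<or> c' i = 2"
      using std_dataD(6)[OF sd pi[OF i]] std_dataD(6)[OF sd' i] by auto
    have s: "\<sigma>' i < l" "\<sigma> (p i) < l" "valid_type X l"
      using std_dataD(5)[OF sd pi[OF i]] std_dataD(5)[OF sd' i] std_dataD(1)[OF sd] by auto
    have cc: "c (p i) = c' i" using eq False c12 by (auto simp: L_def split: if_splits)
    show ?thesis
    proof (cases "c' i = 2")
      case True
      then have "\<sigma>' i = \<sigma> (p i)"
        using std_data_double_row[OF sd pi[OF i]] std_data_double_row[OF sd' i] cc s by auto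
      then show ?thesis using cc by simp
    next
      case f: False
      then have "longest X l (\<sigma>' i) = longest X l (\<sigma> (p i))"
        using eq False cc by (auto simp: L_def split: if_splits)
      then show ?thesis using longest_iff_sqlen_eq[OF s(3,1,2)] cc by simp
    qed
  qed
  let ?M1 = "permute_indices p M"
  have sd1: "std_data ?M1 X l d (\<sigma> \<circ> p) (c \<circ> p)"
    by (rule std_data_permute[OF sd p(1)]) (use small in auto)
  have sd2: "std_data ?M1 X l d (\<sigma> \<circ> p) c'"
    using sd1 big std_dataD(4)[OF sd'] unfolding std_data_def by auto
  have "braid_step M ?M1"
    by (rule braid_step.permutation) (use p(1) std_dataD(3)[OF sd] in simp)
  moreover have "braid_step\<^sup>*\<^sup>* ?M1 M'"
    by (rule std_data_move_all[OF sd2 sd']) (use small big in auto)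
  ultimately show ?thesis
    unfolding braid_equivalent_def using std_data_SIM[OF sd] std_data_SIM[OF sd']
    by (meson converse_rtranclp_into_rtranclp)
qed

section \<open>Root systems and types of standard affinizations\<close>

lemma Cartan_matrix_of_typeE:
  assumes "Cartan_matrix_of_type C X l"
  obtains \<pi> where "valid_type X l" "\<pi> permutes {..<l}" "square_mat C" "dim_row C = l"
    "\<And>i j. i < l \<Longrightarrow> j < l \<Longrightarrow> C $$ (i, j) = dynkin_entry X l (\<pi> i, \<pi> j)"
proof -
  obtain \<pi> where p: "valid_type X l" "\<pi> permutes {..<l}" "C = permute_indices \<pi> (mat l l (dynkin_entry X l))"
    using assms by (auto simp: Cartan_matrix_of_type_def)
  have "\<pi> i < l" if "i < l" for i using permutes_in_image[OF p(2), of i] that by simp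
  then show ?thesis using that[of \<pi>] p by (simp add: permute_indices_def)
qed

lemma root_form_vec:
  assumes "square_mat C" "dim_row C = l"
  shows "root_form C D (vec l (\<lambda>p. of_int (u p))) (vec l (\<lambda>p. of_int (v p))) =
    of_int (form l (\<lambda>i j. int (D i) * C $$ (i, j)) u v)"
proof -
  have "root_form C D (vec l (\<lambda>p. of_int (u p))) (vec l (\<lambda>p. of_int (v p))) =
     form l (\<lambda>i j. int (D i) * C $$ (i, j)) (\<lambda>i. vec l (\<lambda>p. rat_of_int (u p)) $ i) (\<lambda>i. vec l (\<lambda>p. of_int (v p)) $ i)"
    using assms by (subst root_form_eq_form) auto
  also have "\<dots> = form l (\<lambda>i j. int (D i) * C $$ (i, j)) (\<lambda>i. of_int (u i)) (\<lambda>i. of_int (v i))"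
    unfolding form_def by (intro sum.cong refl) simp
  finally show ?thesis by (simp add: of_int_form)
qed

lemma unit_vec_eq_vec: "unit_vec l i = vec l (\<lambda>p. rat_of_int (unitf i p))"
  by (rule eq_vecI) (auto simp: unitf_def unit_vec_def)

lemma smult_unit_vec_eq_vec: "rat_of_int k \<cdot>\<^sub>v unit_vec l i = vec l (\<lambda>p. rat_of_int (k * unitf i p))"
  by (rule eq_vecI) (auto simp: unitf_def unit_vec_def)

lemma root_form_smult_unit_vec:
  assumes "square_mat C" "dim_row C = l" "i < l" "j < l"
  shows "root_form C D (rat_of_int a \<cdot>\<^sub>v unit_vec l i) (rat_of_int b \<cdot>\<^sub>v unit_vec l j) =
    of_int (a * b * (int (D i) * C $$ (i, j)))"
  unfolding smult_unit_vec_eq_vec root_form_vec[OF assms(1,2)] form_smult_left form_smult_right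
    form_unit[OF assms(3,4)] by simp

text \<open>Invariants of the Weyl group orbit of the simple roots. Coordinates are integral and not all even,
  since reflections are invertible over the integers; hence no root is the double of a root, and
  single and double added roots cannot be confused. Squared lengths are those of simple roots; hence
  long roots can be recognised among the simple ones.\<close>

lemma root_system_coordinates:
  assumes sq: "square_mat C" and l: "dim_row C = l" and D: "symmetrizer C D"
    and diag: "\<And>i. i < l \<Longrightarrow> C $$ (i, i) = 2" and \<beta>: "\<beta> \<in> root_system C D"
  shows "\<exists>u. \<beta> = vec l (\<lambda>p. of_int (u p)) \<and> (\<exists>p<l. odd (u p)) \<and>
    (\<exists>p<l. root_form C D \<beta> \<beta> = of_int (2 * int (D p)))"
  using \<beta>
proof induction
  case (simple i)
  then have i: "i < l" using l by simp
  have n: "root_form C D (root_basis (dim_row C) i) (root_basis (dim_row C) i) = of_int (2 * int (D i))"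
    using root_form_smult_unit_vec[OF sq l i i, of D 1 1] diag[OF i] l
    by (simp add: root_basis_def scalar_vec_one mult.commute)
  show ?case
    using i n l unfolding root_basis_def
    by (intro exI[of _ "unitf i"] conjI exI[of _ i]) (auto simp: unit_vec_eq_vec unitf_def)
next
  case (reflect \<beta> i)
  let ?B = "\<lambda>i j. int (D i) * C $$ (i, j)"
  obtain u p0 p where u: "\<beta> = vec l (\<lambda>p. of_int (u p))" "p0 < l" "odd (u p0)" "p < l"
    "root_form C D \<beta> \<beta> = of_int (2 * int (D p))" using reflect.IH by blast
  have i: "i < l" using reflect l by simp
  have Bs: "?B x y = ?B y x" if "x < l" "y < l" for x y
    using D symmetrizer_iff[OF sq, of D] that l by simp
  have Di: "D i > 0" using D symmetrizer_iff[OF sq, of D] i l by simp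
  define K where "K = (\<Sum>q<l. C $$ (i, q) * u q)"
  have qi: "form l ?B (unitf i) u = int (D i) * K"
  proof -
    have "form l ?B (unitf i) u = form l ?B u (unitf i)" by (rule form_sym) (rule Bs)
    also have "\<dots> = (\<Sum>q<l. ?B i q * u q)"
      unfolding form_unit_right[OF i] by (intro sum.cong refl) (use Bs i in \<open>simp\<close>)
    finally show ?thesis by (simp add: K_def sum_distrib_left mult.assoc)
  qed
  have qii: "form l ?B (unitf i) (unitf i) = 2 * int (D i)"
    using form_unit[OF i i, of ?B, where 'a = int] diag[OF i] by (simp add: mult.commute)
  define u' where "u' = (\<lambda>p. u p - K * unitf i p)"
  have k: "2 * root_form C D (root_basis l i) \<beta> / root_form C D (root_basis l i) (root_basis l i) = of_int K"
    unfolding root_basis_def unit_vec_eq_vec u(1) root_form_vec[OF sq l] qi qii using Di by simp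
  have r: "reflection (root_form C D) (root_basis (dim_row C) i) \<beta> = vec l (\<lambda>p. of_int (u' p))"
    unfolding reflection_def l k unfolding u(1) u'_def root_basis_def
    by (rule eq_vecI) (auto simp: unitf_def unit_vec_def)
  have "form l ?B u' u' = form l ?B u u"
  proof -
    have "form l ?B u (unitf i) = form l ?B (unitf i) u" by (rule form_sym) (rule Bs)
    then show ?thesis unfolding u'_def form_diff_left form_diff_right qi qii by (simp add: qi algebra_simps)
  qed
  then have "root_form C D (vec l (\<lambda>p. of_int (u' p))) (vec l (\<lambda>p. of_int (u' p))) = of_int (2 * int (D p))"
    using u(5) unfolding u(1) root_form_vec[OF sq l] by simp
  moreover have "\<exists>p<l. odd (u' p)"
  proof (cases "\<exists>p<l. p \<noteq> i \<and> odd (u p)")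
    case True then show ?thesis by (auto simp: u'_def unitf_def)
  next
    case False
    then have ev: "even (u q)" if "q < l" "q \<noteq> i" for q using that by blast
    \<comment> \<open>the diagonal entry 2 makes the subtracted multiple even when \<open>u\<^sub>i\<close> is the only odd coordinate\<close>
    then have oi: "odd (u i)" using u(2,3) by blast
    have "K = C $$ (i, i) * u i + (\<Sum>q\<in>{..<l} - {i}. C $$ (i, q) * u q)"
      unfolding K_def using i by (intro sum.remove) auto
    moreover have "even (\<Sum>q\<in>{..<l} - {i}. C $$ (i, q) * u q)" by (rule dvd_sum) (use ev in auto)
    ultimately have "even K" using diag[OF i] by simp
    then have "odd (u' i)" using oi by (simp add: u'_def unitf_def)
    then show ?thesis using i by blast
  qed
  ultimately show ?case unfolding r using u(4) by blast
qed

text \<open>Translation of the definition of standard affinizations, which speaks of rational vectors and the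
  orbit of the Weyl group, into data on the Dynkin diagram.\<close>

lemma standard_affinization_data:
  assumes st: "standard_affinization C D d \<alpha> M" and ty: "Cartan_matrix_of_type C X l"
  shows "\<exists>\<sigma> c. std_data M X l d \<sigma> c \<and> (\<forall>i\<in>{l..<l + d}.
    (\<alpha> i \<in> long_roots C D \<longleftrightarrow> c i = 1 \<and> longest X l (\<sigma> i)) \<and>
    (\<alpha> i \<in> short_roots C D \<longleftrightarrow> c i = 1 \<and> \<not> longest X l (\<sigma> i)) \<and>
    (\<alpha> i \<in> double (root_system C D) \<longleftrightarrow> c i = 2) \<and>
    (\<alpha> i \<in> double (root_system C D) \<longrightarrow> \<not> longest X l (\<sigma> i) \<longrightarrow> \<alpha> i \<in> double (short_roots C D)))"
proof -
  obtain \<pi> where v: "valid_type X l" and \<pi>: "\<pi> permutes {..<l}" and sq: "square_mat C" and l: "dim_row C = l"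
    and C: "\<And>i j. i < l \<Longrightarrow> j < l \<Longrightarrow> C $$ (i, j) = dynkin_entry X l (\<pi> i, \<pi> j)"
    using Cartan_matrix_of_typeE[OF ty] by metis
  have \<pi>l: "\<pi> i < l \<longleftrightarrow> i < l" for i using permutes_in_image[OF \<pi>, of i] by simp
  have D: "symmetrizer C D" using st by (auto simp: standard_affinization_def affinization_def)
  have Dp: "D i > 0" if "i < l" for i using D that symmetrizer_iff[OF sq] l by simp
  have diag: "C $$ (i, i) = 2" if "i < l" for i using C that by simp
  let ?R = "root_system C D" and ?Q = "root_form C D"
  have coord: "\<exists>u. \<beta> = vec l (\<lambda>p. of_int (u p)) \<and> (\<exists>p<l. odd (u p)) \<and> (\<exists>p<l. ?Q \<beta> \<beta> = of_int (2 * int (D p)))"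
    if "\<beta> \<in> ?R" for \<beta>
    by (rule root_system_coordinates[OF sq l D diag that])
  have eR: "unit_vec l p \<in> ?R" if "p < l" for p
    using root_system.simple[of p C D] that l by (simp add: root_basis_def)
  have Qe: "?Q (unit_vec l p) (unit_vec l p) = of_int (2 * int (D p))" if "p < l" for p
    using root_form_smult_unit_vec[OF sq l that that, of D 1 1] diag[OF that] by (simp add: scalar_vec_one mult.commute)
  have R2: "2 \<cdot>\<^sub>v unit_vec l p \<notin> ?R" if "p < l" for p
  proof
    assume "2 \<cdot>\<^sub>v unit_vec l p \<in> ?R"
    then obtain u q where u: "2 \<cdot>\<^sub>v unit_vec l p = vec l (\<lambda>p. rat_of_int (u p))" "q < l" "odd (u q)"
      using coord by blast
    have "rat_of_int (u q) = (2 \<cdot>\<^sub>v unit_vec l p :: rat vec) $ q" unfolding u(1) using u(2) by simp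
    also have "\<dots> = of_int (2 * unitf p q)" using u(2) that by (simp add: unitf_def)
    finally have "u q = 2 * unitf p q" by (simp only: of_int_eq_iff)
    then show False using u(3) by simp
  qed
  have R1: "unit_vec l p \<notin> double ?R" if "p < l" for p
  proof
    assume "unit_vec l p \<in> double ?R"
    then obtain \<beta> where b: "\<beta> \<in> ?R" "unit_vec l p = 2 \<cdot>\<^sub>v \<beta>" by (auto simp: double_def)
    obtain u where u: "\<beta> = vec l (\<lambda>p. rat_of_int (u p))" using coord[OF b(1)] by blast
    have "(1 :: rat) = unit_vec l p $ p" using that by simp
    also have "\<dots> = of_int (2 * u p)" unfolding b(2) u using that by simp
    finally have "1 = 2 * u p" by (metis of_int_1 of_int_eq_iff)
    then show False by presburger
  qed
  have inj2: "unit_vec l p = (\<beta> :: rat vec)" if "2 \<cdot>\<^sub>v unit_vec l p = 2 \<cdot>\<^sub>v \<beta>" for p \<beta>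
  proof (rule eq_vecI)
    have "dim_vec (2 \<cdot>\<^sub>v unit_vec l p :: rat vec) = dim_vec (2 \<cdot>\<^sub>v \<beta>)" using that by simp
    then show d: "dim_vec (unit_vec l p :: rat vec) = dim_vec \<beta>" by simp
    fix i assume i: "i < dim_vec \<beta>"
    have "(2 \<cdot>\<^sub>v unit_vec l p :: rat vec) $ i = (2 \<cdot>\<^sub>v \<beta>) $ i" using that by simp
    then show "unit_vec l p $ i = \<beta> $ i" using i d by simp
  qed
  \<comment> \<open>the given symmetrizer, transported to the Dynkin diagram, is proportional to the squared lengths\<close>
  define E where "E k = int (D (inv_into UNIV \<pi> k))" for k
  have E: "E i * sqlen X l 0 = E 0 * sqlen X l i" if "i < l" for i
  proof (rule dynkin_sqlen_unique[OF v that])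
    fix i j assume ij: "i < l" "j < l"
    then have "inv_into UNIV \<pi> i < l" "inv_into UNIV \<pi> j < l" using permutes_in_image[OF permutes_inv[OF \<pi>]] by auto
    then have "int (D (inv_into UNIV \<pi> i)) * C $$ (inv_into UNIV \<pi> i, inv_into UNIV \<pi> j) = int (D (inv_into UNIV \<pi> j)) * C $$ (inv_into UNIV \<pi> j, inv_into UNIV \<pi> i)"
      using D symmetrizer_iff[OF sq, of D] l by simp
    then show "E i * dynkin_entry X l (i, j) = E j * dynkin_entry X l (j, i)"
      unfolding E_def using C \<open>inv_into UNIV \<pi> i < l\<close> \<open>inv_into UNIV \<pi> j < l\<close> by (simp add: permutes_inverses[OF \<pi>])
  qed
  have E0: "E 0 > 0" 
  proof -
    have "inv_into UNIV \<pi> 0 < l" using permutes_in_image[OF permutes_inv[OF \<pi>], of 0] valid_type_pos[OF v] by simp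
    then show ?thesis using Dp by (simp add: E_def)
  qed
  have Dle: "D p \<le> D q \<longleftrightarrow> sqlen X l (\<pi> p) \<le> sqlen X l (\<pi> q)" if "p < l" "q < l" for p q
  proof -
    have e: "int (D p) * sqlen X l 0 = E 0 * sqlen X l (\<pi> p)" if "p < l" for p
      using E[of "\<pi> p"] \<pi>l that by (simp add: E_def permutes_inverses[OF \<pi>])
    have "D p \<le> D q \<longleftrightarrow> int (D p) * sqlen X l 0 \<le> int (D q) * sqlen X l 0"
      using sqlen_pos[of X l 0] by simp
    also have "\<dots> \<longleftrightarrow> sqlen X l (\<pi> p) \<le> sqlen X l (\<pi> q)"
      unfolding e[OF that(1)] e[OF that(2)] using E0 by simp
    finally show ?thesis .
  qed
  have long: "unit_vec l p \<in> long_roots C D \<longleftrightarrow> longest X l (\<pi> p)" if p: "p < l" for p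
  proof -
    have "unit_vec l p \<in> long_roots C D \<longleftrightarrow> (\<forall>\<gamma>\<in>?R. ?Q \<gamma> \<gamma> \<le> of_int (2 * int (D p)))"
      unfolding long_roots_def using eR[OF p] Qe[OF p] by simp
    also have "\<dots> \<longleftrightarrow> (\<forall>q<l. D q \<le> D p)"
    proof
      assume h: "\<forall>\<gamma>\<in>?R. ?Q \<gamma> \<gamma> \<le> of_int (2 * int (D p))"
      show "\<forall>q<l. D q \<le> D p"
      proof (intro allI impI)
        fix q assume q: "q < l"
        have "rat_of_int (2 * int (D q)) \<le> of_int (2 * int (D p))" using h eR[OF q] Qe[OF q] by metis
        then show "D q \<le> D p" by simp
      qed
    next
      assume h: "\<forall>q<l. D q \<le> D p"
      show "\<forall>\<gamma>\<in>?R. ?Q \<gamma> \<gamma> \<le> of_int (2 * int (D p))"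
      proof
        fix \<gamma> assume "\<gamma> \<in> ?R"
        then obtain q where "q < l" "?Q \<gamma> \<gamma> = of_int (2 * int (D q))" using coord by blast
        then show "?Q \<gamma> \<gamma> \<le> of_int (2 * int (D p))" using h by (simp only: of_int_le_iff) simp
      qed
    qed
    also have "\<dots> \<longleftrightarrow> (\<forall>q<l. sqlen X l (\<pi> q) \<le> sqlen X l (\<pi> p))" using Dle p by blast
    also have "\<dots> \<longleftrightarrow> longest X l (\<pi> p)"
      unfolding longest_def using \<pi>l permutes_image[OF \<pi>] by (metis imageE lessThan_iff)
    finally show ?thesis .
  qed
  have "\<exists>p k. p < l \<and> (k = 1 \<or> k = 2) \<and> \<alpha> i = rat_of_int k \<cdot>\<^sub>v unit_vec l p \<and> (i < l \<longrightarrow> p = i \<and> k = 1)"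
    if i: "i < l + d" for i
  proof (cases "i < l")
    case True
    then have "\<alpha> i = unit_vec l i"
      using st l by (auto simp: standard_affinization_def affinization_def root_basis_def)
    then show ?thesis using True by (intro exI[of _ i] exI[of _ 1]) (simp add: scalar_vec_one)
  next
    case False
    then have "\<alpha> i \<in> simple_roots C \<union> double (simple_roots C)"
      using st l i by (auto simp: standard_affinization_def)
    then obtain p where "p < l" "\<alpha> i = unit_vec l p \<or> \<alpha> i = 2 \<cdot>\<^sub>v unit_vec l p"
      using l by (auto simp: simple_roots_def double_def root_basis_def)
    then show ?thesis using False
      by (elim disjE) (rule exI[of _ p], rule exI[of _ 1], simp add: scalar_vec_one, rule exI[of _ p], rule exI[of _ 2], simp)
  qed
  then obtain s c where s: "\<And>i. i < l + d \<Longrightarrow> s i < l" and c: "\<And>i. i < l + d \<Longrightarrow> c i = 1 \<or> c i = 2"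
    and \<alpha>: "\<And>i. i < l + d \<Longrightarrow> \<alpha> i = rat_of_int (c i) \<cdot>\<^sub>v unit_vec l (s i)"
    and s0: "\<And>i. i < l \<Longrightarrow> s i = i \<and> c i = 1"
    by (metis trans_less_add1)
  have M: "map_mat rat_of_int M = structural_matrix (l + d) ?Q \<alpha>"
    using st l by (auto simp: standard_affinization_def affinization_def Let_def)
  have dM: "dim_row M = l + d" "dim_col M = l + d"
    using arg_cong[OF M, of dim_row] arg_cong[OF M, of dim_col] by (auto simp: structural_matrix_def)
  have ent: "M $$ (i, j) * c i = c j * dynkin_entry X l (\<pi> (s i), \<pi> (s j))" if ij: "i < l + d" "j < l + d" for i j
  proof -
    have "rat_of_int (M $$ (i, j)) = map_mat rat_of_int M $$ (i, j)" using ij dM by simp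
    also have "\<dots> = 2 * ?Q (\<alpha> i) (\<alpha> j) / ?Q (\<alpha> i) (\<alpha> i)"
      unfolding M using ij by (simp add: structural_matrix_def)
    also have "\<dots> = 2 * of_int (c i * c j * (int (D (s i)) * C $$ (s i, s j))) / of_int (c i * c i * (int (D (s i)) * 2))"
      unfolding \<alpha>[OF ij(1)] \<alpha>[OF ij(2)] root_form_smult_unit_vec[OF sq l s[OF ij(1)] s[OF ij(2)]]
        root_form_smult_unit_vec[OF sq l s[OF ij(1)] s[OF ij(1)]] diag[OF s[OF ij(1)]] by simp
    also have "\<dots> = of_int (c j * C $$ (s i, s j)) / of_int (c i)"
      using c[OF ij(1)] Dp[OF s[OF ij(1)]] by (auto simp: field_simps)
    finally have "rat_of_int (M $$ (i, j) * c i) = of_int (c j * C $$ (s i, s j))"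
      using c[OF ij(1)] by (auto simp: field_simps)
    then have "M $$ (i, j) * c i = c j * C $$ (s i, s j)" by (simp only: of_int_eq_iff)
    then show ?thesis using C s ij by simp
  qed
  have sd: "std_data M X l d (\<pi> \<circ> s) c"
    unfolding std_data_def
  proof (intro conjI allI impI v)
    show "square_mat M" using dM by simp
    have "bij_betw (\<pi> \<circ> s) {..<l} {..<l} \<longleftrightarrow> bij_betw \<pi> {..<l} {..<l}"
      by (rule bij_betw_cong) (simp add: s0)
    then show "bij_betw (\<pi> \<circ> s) {..<l} {..<l}" using permutes_imp_bij[OF \<pi>] by simp
  qed (use dM s0 s c ent \<pi>l in auto)
  have cls: "\<alpha> i = unit_vec l (s i) \<and> c i = 1 \<or> \<alpha> i = 2 \<cdot>\<^sub>v unit_vec l (s i) \<and> c i = 2" if "i < l + d" for i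
    using \<alpha>[OF that] c[OF that] by (auto simp: scalar_vec_one)
  show ?thesis
  proof (intro exI[of _ "\<pi> \<circ> s"] exI[of _ c] conjI[OF sd] ballI)
    fix i assume i: "i \<in> {l..<l + d}"
    then have il: "i < l + d" by simp
    note si = s[OF il]
    have "\<alpha> i \<in> long_roots C D \<longleftrightarrow> c i = 1 \<and> longest X l (\<pi> (s i))"
      using cls[OF il] long[OF si] R2[OF si] by (auto simp: long_roots_def)
    then have 1: "\<alpha> i \<in> long_roots C D \<longleftrightarrow> c i = 1 \<and> longest X l ((\<pi> \<circ> s) i)" by simp
    moreover have "\<alpha> i \<in> short_roots C D \<longleftrightarrow> c i = 1 \<and> \<not> longest X l ((\<pi> \<circ> s) i)"
      unfolding short_roots_def Diff_iff 1 using cls[OF il] eR[OF si] R2[OF si] by auto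
    moreover have "2 \<cdot>\<^sub>v unit_vec l (s i) \<in> double ?R" using eR[OF si] by (auto simp: double_def)
    then have 2: "\<alpha> i \<in> double ?R \<longleftrightarrow> c i = 2"
      using cls[OF il] R1[OF si] by auto
    moreover have "\<alpha> i \<in> double (short_roots C D)" if "\<alpha> i \<in> double ?R" and n: "\<not> longest X l ((\<pi> \<circ> s) i)"
    proof -
      have "\<alpha> i = 2 \<cdot>\<^sub>v unit_vec l (s i)" using that 2 cls[OF il] by auto
      moreover have "unit_vec l (s i) \<in> short_roots C D"
        unfolding short_roots_def using eR[OF si] long[OF si] n by simp
      ultimately show ?thesis by (auto simp: double_def)
    qed
    ultimately show "(\<alpha> i \<in> long_roots C D \<longleftrightarrow> c i = 1 \<and> longest X l ((\<pi> \<circ> s) i)) \<and>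
      (\<alpha> i \<in> short_roots C D \<longleftrightarrow> c i = 1 \<and> \<not> longest X l ((\<pi> \<circ> s) i)) \<and>
      (\<alpha> i \<in> double ?R \<longleftrightarrow> c i = 2) \<and>
      (\<alpha> i \<in> double ?R \<longrightarrow> \<not> longest X l ((\<pi> \<circ> s) i) \<longrightarrow> \<alpha> i \<in> double (short_roots C D))"
      by blast
  qed
qed

text \<open>In the simply laced types all roots have the same length, and doubled simple roots are confined to
  even rows of the Cartan matrix.\<close>

lemma standard_affinization_type_cases:
  assumes st: "standard_affinization C D d \<alpha> M" and ty: "affinization_type C D d \<alpha> X l b s t"
  shows "b + s + t = d \<and>
     ((X = Type_A \<and> l \<ge> 2 \<or> X = Type_D \<and> l \<ge> 4 \<or> X = Type_E \<and> l \<in> {6, 7, 8}) \<and> b = d \<and> s = 0 \<and> t = 0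
      \<or> (X = Type_C \<and> l \<ge> 3 \<or> X = Type_F \<and> l = 4 \<or> X = Type_G \<and> l = 2) \<and> t = 0
      \<or> X = Type_A \<and> l = 1 \<and> s = 0
      \<or> X = Type_B \<and> l \<ge> 2 \<and>
         (\<forall>i\<in>{l..<l + d}. \<alpha> i \<in> double (root_system C D) \<longrightarrow> \<alpha> i \<in> double (short_roots C D)))"
proof -
  have Ct: "Cartan_matrix_of_type C X l" using ty by (simp add: affinization_type_def)
  obtain \<sigma> c where sd: "std_data M X l d \<sigma> c"
    and lo: "\<And>i. i \<in> {l..<l + d} \<Longrightarrow> \<alpha> i \<in> long_roots C D \<longleftrightarrow> c i = 1 \<and> longest X l (\<sigma> i)"
    and sh: "\<And>i. i \<in> {l..<l + d} \<Longrightarrow> \<alpha> i \<in> short_roots C D \<longleftrightarrow> c i = 1 \<and> \<not> longest X l (\<sigma> i)"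
    and db: "\<And>i. i \<in> {l..<l + d} \<Longrightarrow> \<alpha> i \<in> double (root_system C D) \<longleftrightarrow> c i = 2"
    and ds: "\<And>i. i \<in> {l..<l + d} \<Longrightarrow> \<alpha> i \<in> double (root_system C D) \<Longrightarrow> \<not> longest X l (\<sigma> i) \<Longrightarrow>
       \<alpha> i \<in> double (short_roots C D)"
    using standard_affinization_data[OF st Ct] by blast
  have v: "valid_type X l" by (rule std_dataD(1)[OF sd])
  let ?b = "{i \<in> {l..<l + d}. \<alpha> i \<in> long_roots C D}" and ?s = "{i \<in> {l..<l + d}. \<alpha> i \<in> short_roots C D}"
    and ?t = "{i \<in> {l..<l + d}. \<alpha> i \<in> double (root_system C D)}"
  have bst: "b = card ?b" "s = card ?s" "t = card ?t" using ty by (auto simp: affinization_type_def)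
  have c12: "c i = 1 \<or> c i = 2" if "i \<in> {l..<l + d}" for i using std_dataD(6)[OF sd, of i] that by simp
  have un: "?b \<union> ?s \<union> ?t = {l..<l + d}" using lo sh db c12 by blast
  have "card (?b \<union> ?s \<union> ?t) = card (?b \<union> ?s) + card ?t"
  proof (rule card_Un_disjoint)
    show "(?b \<union> ?s) \<inter> ?t = {}" using lo sh db by fastforce
  qed auto
  also have "card (?b \<union> ?s) = card ?b + card ?s"
    by (rule card_Un_disjoint) (auto simp: short_roots_def)
  finally have sum: "b + s + t = d" unfolding un bst by simp
  have t0: "t = 0" if "\<not> (X = Type_A \<and> l = 1)" "X \<noteq> Type_B"
  proof -
    have "?t = {}" using db std_data_double_row[OF sd] that by auto
    then show ?thesis unfolding bst by simp
  qed
  have s0: "s = 0" if "X = Type_A \<or> X = Type_D \<or> X = Type_E"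
  proof -
    have "longest X l (\<sigma> i)" for i using that by (auto simp: longest_def)
    then have "?s = {}" using sh by auto
    then show ?thesis unfolding bst by simp
  qed
  have B: "\<forall>i\<in>{l..<l + d}. \<alpha> i \<in> double (root_system C D) \<longrightarrow> \<alpha> i \<in> double (short_roots C D)" if X: "X = Type_B"
  proof (intro ballI impI)
    fix i assume i: "i \<in> {l..<l + d}" "\<alpha> i \<in> double (root_system C D)"
    then have "\<sigma> i = l - 1" using db std_data_double_row[OF sd, of i] X by auto
    moreover have "l \<ge> 2" using v X by simp
    ultimately have "\<not> longest X l (\<sigma> i)" using X by (auto simp: longest_def intro!: exI[of _ 0])
    then show "\<alpha> i \<in> double (short_roots C D)" using ds i by blast
  qed
  show ?thesis
  proof (cases X)
    case Type_A then show ?thesis using sum s0 t0 v by (cases "l = 1") auto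
  next
    case Type_B then show ?thesis using sum B v by auto
  next
    case Type_C then show ?thesis using sum t0 v by auto
  next
    case Type_D then show ?thesis using sum s0 t0 v by auto
  next
    case Type_E then show ?thesis using sum s0 t0 v by auto
  next
    case Type_F then show ?thesis using sum t0 v by auto
  next
    case Type_G then show ?thesis using sum t0 v by auto
  qed
qed

lemma standard_affinization_matrices_braid_equivalent:
  assumes "standard_affinization_matrix M d X l b s t" "standard_affinization_matrix M' d X l b s t"
  shows "braid_equivalent M M'"
proof -
  have data: "\<exists>\<sigma> c. std_data M X l d \<sigma> c \<and> b = card {i \<in> {l..<l + d}. c i = 1 \<and> longest X l (\<sigma> i)} \<and>
      s = card {i \<in> {l..<l + d}. c i = 1 \<and> \<not> longest X l (\<sigma> i)} \<and> t = card {i \<in> {l..<l + d}. c i = 2}"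
    if sm: "standard_affinization_matrix M d X l b s t" for M
  proof -
    obtain C D \<alpha> where st: "standard_affinization C D d \<alpha> M" and ty: "affinization_type C D d \<alpha> X l b s t"
      using sm by (auto simp: standard_affinization_matrix_def)
    have Ct: "Cartan_matrix_of_type C X l" using ty by (simp add: affinization_type_def)
    obtain \<sigma> c where sd: "std_data M X l d \<sigma> c"
      and lo: "\<And>i. i \<in> {l..<l + d} \<Longrightarrow> \<alpha> i \<in> long_roots C D \<longleftrightarrow> c i = 1 \<and> longest X l (\<sigma> i)"
      and sh: "\<And>i. i \<in> {l..<l + d} \<Longrightarrow> \<alpha> i \<in> short_roots C D \<longleftrightarrow> c i = 1 \<and> \<not> longest X l (\<sigma> i)"
      and db: "\<And>i. i \<in> {l..<l + d} \<Longrightarrow> \<alpha> i \<in> double (root_system C D) \<longleftrightarrow> c i = 2"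
      using standard_affinization_data[OF st Ct] by blast
    have "b = card {i \<in> {l..<l + d}. \<alpha> i \<in> long_roots C D}" "s = card {i \<in> {l..<l + d}. \<alpha> i \<in> short_roots C D}"
      "t = card {i \<in> {l..<l + d}. \<alpha> i \<in> double (root_system C D)}"
      using ty by (auto simp: affinization_type_def)
    then show ?thesis using sd lo sh db by (intro exI[of _ \<sigma>] exI[of _ c]) (simp cong: conj_cong)
  qed
  obtain \<sigma> c \<sigma>' c' where h: "std_data M X l d \<sigma> c" "std_data M' X l d \<sigma>' c'"
    "b = card {i \<in> {l..<l + d}. c i = 1 \<and> longest X l (\<sigma> i)}"
    "s = card {i \<in> {l..<l + d}. c i = 1 \<and> \<not> longest X l (\<sigma> i)}" "t = card {i \<in> {l..<l + d}. c i = 2}"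
    "b = card {i \<in> {l..<l + d}. c' i = 1 \<and> longest X l (\<sigma>' i)}"
    "s = card {i \<in> {l..<l + d}. c' i = 1 \<and> \<not> longest X l (\<sigma>' i)}" "t = card {i \<in> {l..<l + d}. c' i = 2}"
    using data[OF assms(1)] data[OF assms(2)] by blast
  show ?thesis by (rule std_data_braid_equivalent[OF h(1,2)]) (use h in simp_all)
qed

section \<open>Existence of a standard form\<close>

lemma std_data_standard:
  assumes sd: "std_data M X l d \<sigma> c" and \<sigma>: "\<And>i. i < l \<Longrightarrow> \<sigma> i = i"
    and pd: "pd_gcm {..<l} (\<lambda>i j. dynkin_entry X l (i, j)) N"
  shows "\<exists>b s t. standard_affinization_matrix M d X l b s t \<and> b + s + t = d"
proof -
  define C where "C = mat l l (dynkin_entry X l)"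
  have C: "square_mat C" "dim_row C = l" "\<And>i j. i < l \<Longrightarrow> j < l \<Longrightarrow> C $$ (i, j) = dynkin_entry X l (i, j)"
    by (auto simp: C_def)
  have v: "valid_type X l" by (rule std_dataD(1)[OF sd])
  have l0: "l > 0" by (rule valid_type_pos[OF v])
  obtain D k where D: "symmetrizer C D" and k: "k > 0" and Nk: "\<And>i. i < l \<Longrightarrow> N i = k * int (D i)"
  proof (rule symmetrizer_of_norms[OF C(1), of N])
    show "dim_row C > 0" using l0 C by simp
    show "N i > 0" if "i < dim_row C" for i using pd_gcmD(2)[OF pd, of i] that C by simp
    show "N i * C $$ (i, j) = N j * C $$ (j, i)" if "i < dim_row C" "j < dim_row C" for i j
      using pd_gcmD(5)[OF pd, of i j] that C by simp
  qed (use C in auto)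
  have Dp: "D i > 0" if "i < l" for i using D symmetrizer_iff[OF C(1)] that C(2) by simp
  have gcm: "generalized_Cartan_matrix C"
    unfolding generalized_Cartan_matrix_def C(2)
  proof (intro conjI allI impI C(1))
    fix i assume i: "i < l"
    show "C $$ (i, i) = 2" using C(3)[OF i i] by simp
    fix j assume j: "j < l"
    show "C $$ (i, j) = 0 \<longleftrightarrow> C $$ (j, i) = 0" unfolding C(3)[OF i j] C(3)[OF j i] by (rule dynkin_zero_iff)
    show "C $$ (i, j) \<le> 0" if "i \<noteq> j" unfolding C(3)[OF i j] by (rule dynkin_nonpos[OF that])
  qed
  have "pos_def_mat (map_mat real_of_int (symmetrized C D))"
    unfolding pos_def_mat_def
  proof (intro ballI impI)
    let ?S = "map_mat real_of_int (symmetrized C D)"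
    have dS: "dim_row ?S = l" using symmetrized_carrier[OF C(1), of D] C(2) by auto
    fix x :: "real vec" assume x: "x \<in> carrier_vec (dim_row ?S)" "x \<noteq> 0\<^sub>v (dim_row ?S)"
    then have xl: "x \<in> carrier_vec l" using dS by simp
    obtain i where i: "i < l" "x $ i \<noteq> 0"
    proof -
      have "\<not> (\<forall>i<l. x $ i = 0)"
      proof
        assume "\<forall>i<l. x $ i = 0"
        then have "x = 0\<^sub>v l" using xl by (intro eq_vecI) auto
        then show False using x(2) dS by simp
      qed
      then show ?thesis using that by blast
    qed
    have "0 < (\<Sum>i<l. \<Sum>j<l. of_int (N i * dynkin_entry X l (i, j)) * x $ i * x $ j)"
      using i by (intro pd_gcmD(6)[OF pd, of i]) auto
    also have "\<dots> = of_int k * form l (\<lambda>i j. int (D i) * C $$ (i, j)) (\<lambda>i. x $ i) (\<lambda>i. x $ i)"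
      unfolding form_def sum_distrib_left by (intro sum.cong refl) (simp add: Nk C(3) mult_ac)
    also have "form l (\<lambda>i j. int (D i) * C $$ (i, j)) (\<lambda>i. x $ i) (\<lambda>i. x $ i) = x \<bullet> (?S *\<^sub>v x)"
      using symmetrized_scalar_prod[of C x x D] C(1,2) xl by simp
    finally show "x \<bullet> (?S *\<^sub>v x) > 0" using k by (simp add: zero_less_mult_iff)
  qed
  then have Cartan: "Cartan_matrix C"
    unfolding Cartan_matrix_def positive_definite_def using gcm D by blast
  define \<alpha> where "\<alpha> i = rat_of_int (c i) \<cdot>\<^sub>v unit_vec l (\<sigma> i)" for i
  have c12: "c i = 1 \<or> c i = 2" and sl: "\<sigma> i < l" if "i < l + d" for i
    using std_dataD(5,6)[OF sd that] by auto
  have eR: "unit_vec l p \<in> root_system C D" if "p < l" for p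
    using root_system.simple[of p C D] that C(2) by (simp add: root_basis_def)
  have eS: "unit_vec l p \<in> simple_roots C" if "p < l" for p
    using that C(2) by (auto simp: simple_roots_def root_basis_def)
  have dM: "dim_row M = l + d" "dim_col M = l + d" using std_dataD(2,3)[OF sd] by auto
  have struct: "map_mat rat_of_int M = structural_matrix (l + d) (root_form C D) \<alpha>"
  proof (rule eq_matI)
    fix i j assume "i < dim_row (structural_matrix (l + d) (root_form C D) \<alpha>)"
      "j < dim_col (structural_matrix (l + d) (root_form C D) \<alpha>)"
    then have ij: "i < l + d" "j < l + d" by (auto simp: structural_matrix_def)
    have ci: "rat_of_int (c i) \<noteq> 0" "rat_of_nat (D (\<sigma> i)) \<noteq> 0" using c12[OF ij(1)] Dp[OF sl[OF ij(1)]] by auto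
    have "2 * root_form C D (\<alpha> i) (\<alpha> j) / root_form C D (\<alpha> i) (\<alpha> i) =
      2 * of_int (c i * c j * (int (D (\<sigma> i)) * dynkin_entry X l (\<sigma> i, \<sigma> j))) / of_int (c i * c i * (int (D (\<sigma> i)) * 2))"
      unfolding \<alpha>_def root_form_smult_unit_vec[OF C(1,2) sl[OF ij(1)] sl[OF ij(2)]]
        root_form_smult_unit_vec[OF C(1,2) sl[OF ij(1)] sl[OF ij(1)]] C(3)[OF sl[OF ij(1)] sl[OF ij(2)]]
        C(3)[OF sl[OF ij(1)] sl[OF ij(1)]] by simp
    also have "\<dots> = of_int (c j * dynkin_entry X l (\<sigma> i, \<sigma> j)) / of_int (c i)"
      using ci by (simp add: field_simps)
    also have "c j * dynkin_entry X l (\<sigma> i, \<sigma> j) = M $$ (i, j) * c i" using std_dataD(7)[OF sd ij] by simp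
    finally show "map_mat rat_of_int M $$ (i, j) = structural_matrix (l + d) (root_form C D) \<alpha> $$ (i, j)"
      using ci ij dM by (simp add: structural_matrix_def)
  qed (use dM in \<open>auto simp: structural_matrix_def\<close>)
  have \<alpha>R: "\<alpha> i \<in> root_system C D \<union> double (root_system C D)" and
    \<alpha>S: "\<alpha> i \<in> simple_roots C \<union> double (simple_roots C)" if "i < l + d" for i
    using c12[OF that] eR[OF sl[OF that]] eS[OF sl[OF that]] by (auto simp: \<alpha>_def double_def)
  have "\<alpha> i = root_basis l i" if "i < l" for i
    using std_dataD(4)[OF sd that] \<sigma>[OF that] by (simp add: \<alpha>_def root_basis_def)
  then have st: "standard_affinization C D d \<alpha> M"
    unfolding standard_affinization_def affinization_def Let_def C(2)
    using Cartan D struct \<alpha>R \<alpha>S by auto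
  have "Cartan_matrix_of_type C X l"
    unfolding Cartan_matrix_of_type_def
    by (intro conjI v exI[of _ id]) (auto simp: C_def permute_indices_def permutes_id)
  moreover have "indecomposable C" unfolding C_def by (rule dynkin_indecomposable[OF v])
  ultimately have ty: "affinization_type C D d \<alpha> X l
      (card {i \<in> {l..<l + d}. \<alpha> i \<in> long_roots C D}) (card {i \<in> {l..<l + d}. \<alpha> i \<in> short_roots C D})
      (card {i \<in> {l..<l + d}. \<alpha> i \<in> double (root_system C D)})"
    by (simp add: affinization_type_def)
  then show ?thesis
    using standard_affinization_type_cases[OF st ty] st unfolding standard_affinization_matrix_def by blast
qed

lemma extend_to_permutation:
  assumes f: "bij_betw f {..<l} S" and S: "S \<subseteq> {..<n::nat}"
  obtains g where "g permutes {..<n}" "\<And>i. i < l \<Longrightarrow> g i = f i"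
proof -
  have cS: "card S = l" using bij_betw_same_card[OF f] by simp
  have ln: "l \<le> n" using card_mono[OF _ S] cS by simp
  have "card {l..<n} = card ({..<n} - S)" using cS S finite_subset[OF S] by (simp add: card_Diff_subset)
  then obtain f' where f': "bij_betw f' {l..<n} ({..<n} - S)"
    using finite_same_card_bij[of "{l..<n}" "{..<n} - S"] by auto
  define g where "g i = (if i < l then f i else if i < n then f' i else i)" for i
  have "bij_betw g ({..<l} \<union> {l..<n}) (S \<union> ({..<n} - S))"
  proof (rule bij_betw_combine)
    show "bij_betw g {..<l} S" using f by (rule bij_betw_cong[THEN iffD1, rotated]) (simp add: g_def)
    show "bij_betw g {l..<n} ({..<n} - S)" using f' by (rule bij_betw_cong[THEN iffD1, rotated]) (simp add: g_def)
  qed auto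
  moreover have "{..<l} \<union> {l..<n} = {..<n}" using ln by auto
  moreover have "S \<union> ({..<n} - S) = {..<n}" using S by auto
  ultimately have "bij_betw g {..<n} {..<n}" by simp
  then have "g permutes {..<n}" by (rule bij_imp_permutes) (use ln in \<open>auto simp: g_def\<close>)
  then show ?thesis by (rule that) (simp add: g_def)
qed

text \<open>The representatives in a minimal family form the Cartan matrix. They are permuted to the front in the
  order of the Dynkin diagram, and the remaining members become the added roots.\<close>

lemma braid_equivalent_to_standard:
  assumes A: "SIM A" and psd: "positive_semidefinite A" and ind: "indecomposable A"
  shows "\<exists>M d X l b s t. standard_affinization_matrix M d X l b s t \<and> b + s + t = d \<and> braid_equivalent A M"
proof -
  define n where "n = dim_row A"
  obtain B \<rho> A' X where pB: "psd_form n B" and r: "realizes n B X A'" and d: "dim_row A' = n"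
    and SA': "SIM A'" and iA': "indecomposable A'" and steps: "braid_step\<^sup>*\<^sup>* A A'"
    and h: "\<And>i. i < n \<Longrightarrow> form n B (X i) \<rho> > 0"
    and pr: "\<And>a b. a < n \<Longrightarrow> b < n \<Longrightarrow> a \<noteq> b \<Longrightarrow> A' $$ (a, b) > 0 \<Longrightarrow> A' $$ (a, b) * A' $$ (b, a) = 4"
    unfolding n_def using exists_minimal_family[OF A psd ind] by metis
  obtain \<sigma> c where \<sigma>: "\<And>i. i < n \<Longrightarrow> \<sigma> i < n \<and> \<sigma> (\<sigma> i) = \<sigma> i"
    and c: "\<And>i. i < n \<Longrightarrow> c i = 1 \<or> c i = (2 :: int)" and c\<sigma>: "\<And>i. i < n \<Longrightarrow> c (\<sigma> i) = 1"
    and Xc: "\<And>i x. i < n \<Longrightarrow> form n B (X i) x = c i * form n B (X (\<sigma> i)) x"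
    and ob: "\<And>i j. i < n \<Longrightarrow> j < n \<Longrightarrow> \<sigma> i \<noteq> \<sigma> j \<Longrightarrow> A' $$ (\<sigma> i, \<sigma> j) \<le> 0"
    using minimal_family_representatives[OF pB r d h pr] by blast
  have n0: "n > 0" using SIM_dim_pos[OF A] by (simp add: n_def)
  define S where "S = \<sigma> ` {..<n}"
  have Sn: "S \<subseteq> {..<n}" using \<sigma> by (auto simp: S_def)
  have S\<sigma>: "\<sigma> i = i" if "i \<in> S" for i using that \<sigma> by (auto simp: S_def)
  have Sne: "S \<noteq> {}" using n0 by (auto simp: S_def)
  have ent: "A' $$ (i, j) * c i = c j * A' $$ (\<sigma> i, \<sigma> j)" if ij: "i < n" "j < n" for i j
  proof -
    define Q where "Q i j = form n B (X i) (X j)" for i j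
    have Qs: "Q i j = Q j i" for i j unfolding Q_def by (rule psd_form_sym[OF pB])
    have AQ: "A' $$ (i, j) * Q i i = 2 * Q i j" if "i < n" "j < n" for i j
      using r that d by (auto simp: realizes_def Q_def)
    have QQ: "Q i j = c i * c j * Q (\<sigma> i) (\<sigma> j)" if "i < n" "j < n" for i j
      using Xc[OF that(1), of "X j"] Xc[OF that(2), of "X (\<sigma> i)"] Qs[of "\<sigma> i" j] Qs[of "\<sigma> i" "\<sigma> j"]
      by (simp add: Q_def)
    have p: "Q (\<sigma> i) (\<sigma> i) > 0" using r \<sigma>[OF ij(1)] d by (auto simp: realizes_def Q_def)
    have "A' $$ (i, j) * (c i * c i * Q (\<sigma> i) (\<sigma> i)) = c i * c j * (2 * Q (\<sigma> i) (\<sigma> j))"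
      using AQ[OF ij] unfolding QQ[OF ij] QQ[OF ij(1,1)] by (simp only: mult_ac)
    also have "\<dots> = c i * c j * (A' $$ (\<sigma> i, \<sigma> j) * Q (\<sigma> i) (\<sigma> i))"
      using AQ[of "\<sigma> i" "\<sigma> j"] \<sigma>[OF ij(1)] \<sigma>[OF ij(2)] by simp
    finally have "(c i * Q (\<sigma> i) (\<sigma> i)) * (A' $$ (i, j) * c i) = (c i * Q (\<sigma> i) (\<sigma> i)) * (c j * A' $$ (\<sigma> i, \<sigma> j))"
      by (simp add: mult_ac)
    moreover have "c i * Q (\<sigma> i) (\<sigma> i) \<noteq> 0" using c[OF ij(1)] p by auto
    ultimately show ?thesis using mult_left_cancel by blast
  qed
  have pd: "pd_gcm S (\<lambda>i j. A' $$ (i, j)) (\<lambda>i. form n B (X i) (X i))"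
  proof (rule obtuse_family_pd[OF pB r])
    show "S \<subseteq> {..<dim_row A'}" using Sn d by simp
    show "form n B (X i) \<rho> > 0" if "i \<in> S" for i using h that Sn by auto
    show "A' $$ (i, j) \<le> 0" if "i \<in> S" "j \<in> S" "i \<noteq> j" for i j
      using ob[of i j] S\<sigma> that Sn by auto
  qed
  have cn: "conn S (\<lambda>i j. A' $$ (i, j))"
    unfolding conn_def
  proof (rule notI, elim exE conjE)
    fix S1 S2 assume s: "S1 \<noteq> {}" "S2 \<noteq> {}" "S1 \<inter> S2 = {}" "S1 \<union> S2 = S"
      "\<forall>i\<in>S1. \<forall>j\<in>S2. A' $$ (i, j) = 0 \<and> A' $$ (j, i) = 0"
    define J where "J T = {i \<in> {..<n}. \<sigma> i \<in> T}" for T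
    have "J S1 \<inter> J S2 = {}" "J S1 \<union> J S2 = {..<dim_row A'}" using s d by (auto simp: J_def S_def)
    moreover have "T \<subseteq> J T" if "T \<subseteq> S" for T using that S\<sigma> Sn by (auto simp: J_def)
    then have "J S1 \<noteq> {}" "J S2 \<noteq> {}" using s by blast+
    moreover have "\<forall>i\<in>J S1. \<forall>j\<in>J S2. A' $$ (i, j) = 0 \<and> A' $$ (j, i) = 0"
    proof (intro ballI)
      fix i j assume ij: "i \<in> J S1" "j \<in> J S2"
      then have "A' $$ (\<sigma> i, \<sigma> j) = 0" "A' $$ (\<sigma> j, \<sigma> i) = 0" using s(5) by (auto simp: J_def)
      then show "A' $$ (i, j) = 0 \<and> A' $$ (j, i) = 0"
        using ent[of i j] ent[of j i] c[of i] c[of j] ij by (auto simp: J_def)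
    qed
    ultimately show False using iA' unfolding indecomposable_def by blast
  qed
  define l where "l = card S"
  obtain Y f where v: "valid_type Y l" and f: "bij_betw f {..<l} S"
    and fe: "\<And>i j. i < l \<Longrightarrow> j < l \<Longrightarrow> A' $$ (f i, f j) = dynkin_entry Y l (i, j)"
    unfolding l_def using pd_gcm_classification[OF pd cn Sne] by metis
  obtain g where g: "g permutes {..<n}" "\<And>i. i < l \<Longrightarrow> g i = f i"
    using extend_to_permutation[OF f Sn] by metis
  have ln: "l \<le> n" using card_mono[OF _ Sn] by (simp add: l_def)
  define e where "e = n - l"
  have n: "n = l + e" using ln by (simp add: e_def)
  have gn: "g i < n" if "i < n" for i using permutes_in_image[OF g(1), of i] that by simp
  define \<tau> where "\<tau> i = the_inv_into {..<l} f (\<sigma> (g i))" for i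
  have \<tau>: "\<tau> i < l \<and> f (\<tau> i) = \<sigma> (g i)" if "i < n" for i
  proof -
    have "\<sigma> (g i) \<in> f ` {..<l}" using f gn[OF that] by (auto simp: bij_betw_def S_def)
    then show ?thesis using f the_inv_into_into[of f "{..<l}" "\<sigma> (g i)" "{..<l}"] f_the_inv_into_f[of f "{..<l}" "\<sigma> (g i)"]
      by (auto simp: \<tau>_def bij_betw_def)
  qed
  have \<tau>l: "\<tau> i = i \<and> c (g i) = 1" if i: "i < l" for i
  proof -
    have "f i \<in> S" using f i by (auto simp: bij_betw_def)
    then have "\<sigma> (g i) = f i" "f i < n" using S\<sigma> g(2)[OF i] Sn by auto
    then show ?thesis using f i c\<sigma>[of "f i"] g(2)[OF i] by (auto simp: \<tau>_def bij_betw_def the_inv_into_f_f)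
  qed
  define M where "M = permute_indices g A'"
  have sd: "std_data M Y l e \<tau> (c \<circ> g)"
    unfolding std_data_def
  proof (intro conjI allI impI v)
    show "square_mat M" "dim_row M = l + e" using d n by (auto simp: M_def permute_indices_def)
    have "bij_betw \<tau> {..<l} {..<l} \<longleftrightarrow> bij_betw id {..<l} {..<l}"
      by (rule bij_betw_cong) (simp add: \<tau>l)
    then show "bij_betw \<tau> {..<l} {..<l}" by simp
    show "(c \<circ> g) i = 1" if "i < l" for i using \<tau>l[OF that] by simp
    fix i assume i: "i < l + e"
    show "\<tau> i < l" "(c \<circ> g) i = 1 \<or> (c \<circ> g) i = 2" using \<tau>[of i] c[OF gn[of i]] i n by auto
    fix j assume j: "j < l + e"
    have "M $$ (i, j) = A' $$ (g i, g j)" using i j n d by (simp add: M_def permute_indices_def)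
    moreover have "A' $$ (\<sigma> (g i), \<sigma> (g j)) = dynkin_entry Y l (\<tau> i, \<tau> j)"
      using fe[of "\<tau> i" "\<tau> j"] \<tau>[of i] \<tau>[of j] i j n by simp
    ultimately show "M $$ (i, j) * (c \<circ> g) i = (c \<circ> g) j * dynkin_entry Y l (\<tau> i, \<tau> j)"
      using ent[OF gn[of i] gn[of j]] i j n by simp
  qed
  have "has_shape S (\<lambda>i j. A' $$ (i, j)) l (\<lambda>i j. dynkin_entry Y l (i, j))"
    unfolding has_shape_def using f fe by blast
  from has_shape_pd[OF this pd] obtain N where "pd_gcm {..<l} (\<lambda>i j. dynkin_entry Y l (i, j)) N" by blast
  then obtain b s t where "standard_affinization_matrix M e Y l b s t" "b + s + t = e"
    using std_data_standard[OF sd] \<tau>l by blast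
  moreover have "braid_equivalent A M"
  proof -
    have "braid_step A' M" unfolding M_def by (rule braid_step.permutation) (use g d in simp)
    then show ?thesis unfolding braid_equivalent_def using A steps std_data_SIM[OF sd] by auto
  qed
  ultimately show ?thesis by blast
qed

theorem theorem3p12:
  shows "(\<forall>A. indecomposable A \<and> SIM A \<and> positive_semidefinite A \<longrightarrow>
            (\<exists>M d X l b s t. standard_affinization_matrix M d X l b s t \<and> b + s + t = d \<and>
               braid_equivalent A M))
       \<and> (\<forall>M M' d X l b s t.
            standard_affinization_matrix M d X l b s t \<and>
            standard_affinization_matrix M' d X l b s t \<longrightarrow> braid_equivalent M M')
       \<and> (\<forall>C D d \<alpha> M X l b s t.
            standard_affinization C D d \<alpha> M \<and> affinization_type C D d \<alpha> X l b s t \<longrightarrow>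
              b + s + t = d \<and>
              ((X = Type_A \<and> l \<ge> 2 \<or> X = Type_D \<and> l \<ge> 4 \<or> X = Type_E \<and> l \<in> {6, 7, 8})
                 \<and> b = d \<and> s = 0 \<and> t = 0
             \<or> (X = Type_C \<and> l \<ge> 3 \<or> X = Type_F \<and> l = 4 \<or> X = Type_G \<and> l = 2) \<and> t = 0
             \<or> X = Type_A \<and> l = 1 \<and> s = 0
             \<or> X = Type_B \<and> l \<ge> 2 \<and>
                 (\<forall>i\<in>{l..<l + d}. \<alpha> i \<in> double (root_system C D) \<longrightarrow>
                    \<alpha> i \<in> double (short_roots C D))))"
proof (rule conjI[OF _ conjI], goal_cases)
  case 1
  show ?case by (intro allI impI, elim conjE, rule braid_equivalent_to_standard)
next
  case 2
  show ?case by (intro allI impI, elim conjE, rule standard_affinization_matrices_braid_equivalent)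
next
  case 3
  show ?case by (intro allI impI, elim conjE, rule standard_affinization_type_cases)
qed

end
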